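(* Let $\lambda>0$, $\tau>0$, $d\ge 1$, $E=\{1,\dots,m\}$ with $m\ge 2$, and let $S=\{A_i\mid i\in E\}\subset M_d(\mathbb{R})$ be such that the family of induced vector fields $\{\pi_*A_i\mid i\in E\}$ on $\mathbb{RP}^{d-1}$ satisfies the Lie algebra rank condition, that is, at every $q\in\mathbb{RP}^{d-1}$ the Lie algebra generated by the family, evaluated at $q$, equals $T_q\mathbb{RP}^{d-1}$. Denote by $D\subset\mathbb{RP}^{d-1}$ the unique invariant $\tau$ dwell-time control set ($\tau$-ICS) of the projected switched system on $\mathbb{RP}^{d-1}$ with modes $\pi_*A_i$, $i\in E$, and by $\mu$ the unique ergodic invariant measure of the process $(Z_n)_{n\ge 0}$ on $\mathbb{RP}^{d-1}\times E$ with support contained in $D\times E$. For every $i\in E$, let $\mu_i$ be the measure on $\mathbb{RP}^{d-1}\times E$ defined by $\mu_i(A)=\mu(A\cap(\mathbb{RP}^{d-1}\times\{i\}))$. Then the probability measure $\nu$ on $\mathbb{RP}^{d-1}\times E$ defined by $$\nu=\frac{\lambda^2}{\tau\lambda+1}\sum_{i=1}^m\int_\tau^\infty\left(\int_0^s\left(e^{tA_i},\mathrm{Id}\right)_*\mu_i\,dt\right)e^{-\lambda(s-\tau)}\,ds$$ satisfies $$\mathrm{supp}\,\nu\subset\bigcup_{i\in E,\ t\in[0,\tau]}e^{tA_i}(D)\times\{i\}$$ and $$\chi_\tau(S)=\int_{\mathbb{RP}^{d-1}\times E}\langle\theta,A_i\theta\rangle\,d\nu(\theta,i).$$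
   Context: Projected system: for a matrix $A$, $\pi_*A$ is the vector field on $\mathbb{RP}^{d-1}$ induced by the linear vector field $x\mapsto Ax$ on $\mathbb{R}^d\setminus\{0\}$; $e^{tA}$ also denotes its flow on $\mathbb{RP}^{d-1}$. In $\langle\theta,A_i\theta\rangle$, $\theta\in\mathbb{RP}^{d-1}$ is represented by a unit vector of $\mathbb{R}^d$. $(e^{tA_i},\mathrm{Id})_*$ denotes the push-forward along the map $(\theta,j)\mapsto(e^{tA_i}\theta,j)$ of $\mathbb{RP}^{d-1}\times E$. Control sets: let $\mathfrak{S}^\tau$ be the semigroup of diffeomorphisms of $\mathbb{RP}^{d-1}$ $\{e^{t_kA_{i_k}}\circ\dots\circ e^{t_1A_{i_1}}\mid k\ge 1,\ i_1,\dots,i_k\in E,\ t_1,\dots,t_k\ge\tau\}$. Let $\mathcal{S}^\tau$ be the set of $S$-valued functions on compact intervals $[0,T]$ which are finite concatenations of at least one constant piece, all pieces having length $\ge\tau$, and $\mathcal{S}^\tau_\infty$ the set of piecewise constant $u:[0,\infty)\to S$ such that $u|_{[0,T_n]}\in\mathcal{S}^\tau$ for some sequence $T_n\to+\infty$; $\phi(t,q,u)$ is the trajectory of the projected system from $q$ driven by $u$. Membership of $u|_{[t,+\infty)}$ is understood after shifting time to start at $0$. A set $D\subset\mathbb{RP}^{d-1}$ is a $\tau$ dwell-time control set ($\tau$-CS) if (i) for every $q\in D$ there is $u\in\mathcal{S}^\tau_\infty$ such that $\phi(t,q,u)\in D$ for all $t>0$ with $u|_{[0,t]}\in\mathcal{S}^\tau$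 and $u|_{[t,+\infty)}\in\mathcal{S}^\tau_\infty$; (ii) $D\subset\overline{\mathfrak{S}^\tau(q)}$ for every $q\in D$; (iii) $D$ is maximal (for inclusion) with properties (i), (ii). A $\tau$-ICS is a $\tau$-CS $D$ with $\overline{D}=\overline{\mathfrak{S}^\tau(q)}$ for every $q\in D$. (Under the Lie algebra rank condition there is exactly one $\tau$-ICS in $\mathbb{RP}^{d-1}$.) Random process: $\mathcal{Q}=(\mathcal{Q}(i,j))_{i,j\in E}$ is a Markov transition matrix with $\mathcal{Q}(i,i)=0$ and $\mathcal{Q}(i,j)>0$ for $i\neq j$. $(U_i)_{i\ge1}$ are i.i.d. with density $f(t)=\lambda e^{-\lambda(t-\tau)}\mathbf{1}_{\{t\ge\tau\}}$; $T_0=0$, $T_n=U_1+\dots+U_n$. $Z_0=(Q_0,L_0)$ is a random variable on $\mathbb{RP}^{d-1}\times E$ independent of $(U_i)$, and $Z_n=(Q_n,L_n)$ is the Markov chain with $Q_{n+1}=e^{U_{n+1}A_{L_n}}Q_n$ and $\mathbb{P}(L_{n+1}=j\mid Q_{n+1},L_n=i)=\mathcal{Q}(i,j)$. An invariant measure is an invariant probability measure of this Markov chain; it is ergodic if it is not a proper convex combination of invariant measures. Lyapunov exponent: $\Phi_0=\mathrm{Id}$, $\Phi_{n+1}=e^{U_{n+1}A_{L_n}}\Phi_n$ and $\Psi_t=e^{(t-T_n)A_{L_n}}\Phi_n$ for $t\in[T_n,T_{n+1})$. There is a real constant $\chi_\tau(S)$, the Lyapunov exponent of the stochastic process $\Psi_t$,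 such that almost surely $\lim_{t\to\infty}\frac1t\log\|\Psi_t\|=\chi_\tau(S)$. *)

theory Defs
  imports "HOL-Probability.Probability"
begin

definition mat_exp :: "real^'d^'d \<Rightarrow> real^'d^'d" where
  "mat_exp B = (\<Sum>n. (1 / fact n) *\<^sub>R (((**) B ^^ n) (mat 1)))"

text \<open>The projective space of \<open>real^'d\<close> is the set of its lines, with the quotient topology
  of \<open>real^'d\<close> minus the origin.\<close>

typedef (overloaded) 'd proj_space = "{l :: (real^'d::finite) set. subspace l \<and> dim l = 1}"
proof -
  have "dim (span {axis undefined 1 :: real^'d}) = 1"
    by (simp add: dim_span dim_singleton axis_eq_0_iff)
  then show ?thesis
    by (intro exI[of _ "span {axis undefined 1 :: real^'d}"]) simp
qed

definition to_proj :: "real^'d \<Rightarrow> 'd::finite proj_space" where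
  "to_proj x = Abs_proj_space (span {x})"

instantiation proj_space :: (finite) topological_space
begin

definition open_proj_space :: "'a proj_space set \<Rightarrow> bool" where
  "open_proj_space V \<longleftrightarrow> open {x. x \<noteq> 0 \<and> to_proj x \<in> V}"

instance
proof
  have "{x :: real^'a. x \<noteq> 0 \<and> to_proj x \<in> UNIV} = - {0}" by auto
  then show "open (UNIV :: 'a proj_space set)"
    unfolding open_proj_space_def by (simp add: open_Compl)
next
  fix S T :: "'a proj_space set"
  assume "open S" "open T"
  then have "open ({x. x \<noteq> 0 \<and> to_proj x \<in> S} \<inter> {x. x \<noteq> 0 \<and> to_proj x \<in> T})"
    unfolding open_proj_space_def by (rule open_Int)
  moreover have "{x. x \<noteq> 0 \<and> to_proj x \<in> S} \<inter> {x. x \<noteq> 0 \<and> to_proj x \<in> T}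
      = {x. x \<noteq> 0 \<and> to_proj x \<in> S \<inter> T}" by auto
  ultimately show "open (S \<inter> T)" unfolding open_proj_space_def by simp
next
  fix K :: "'a proj_space set set"
  assume "\<forall>S\<in>K. open S"
  then have "open (\<Union>S\<in>K. {x. x \<noteq> 0 \<and> to_proj x \<in> S})"
    unfolding open_proj_space_def by auto
  moreover have "(\<Union>S\<in>K. {x. x \<noteq> 0 \<and> to_proj x \<in> S}) = {x. x \<noteq> 0 \<and> to_proj x \<in> \<Union>K}" by auto
  ultimately show "open (\<Union>K)" unfolding open_proj_space_def by simp
qed

end

text \<open>Meaningful for invertible matrices only: these map lines to lines.\<close>

definition proj_act :: "real^'d^'d \<Rightarrow> 'd::finite proj_space \<Rightarrow> 'd proj_space" where
  "proj_act B q = Abs_proj_space ((*v) B ` Rep_proj_space q)"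

definition proj_flow :: "real^'d^'d \<Rightarrow> real \<Rightarrow> 'd::finite proj_space \<Rightarrow> 'd proj_space" where
  "proj_flow B t = proj_act (mat_exp (t *\<^sub>R B))"

definition unit_rep :: "'d::finite proj_space \<Rightarrow> real^'d" where
  "unit_rep q = (SOME x. norm x = 1 \<and> x \<in> Rep_proj_space q)"

text \<open>A vector field on projective space is represented by its lift to \<open>real^'d\<close> minus the origin
  that is homogeneous of degree 1 and tangent to the spheres centred at the origin; the tangent
  space at the line through a unit vector \<open>x\<close> is then the orthogonal complement of \<open>x\<close>.  The lift is
  unique, and such fields are closed under the Lie bracket of \<open>real^'d\<close>; this bracket is the
  lift of the bracket on projective space.  The lift of the field induced by \<open>x \<mapsto> B x\<close> is
  the component of \<open>B x\<close> orthogonal to \<open>x\<close>.\<close>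

definition proj_field :: "real^'d^'d \<Rightarrow> real^'d \<Rightarrow> real^'d::finite" where
  "proj_field B x = B *v x - ((x \<bullet> (B *v x)) / (x \<bullet> x)) *\<^sub>R x"

definition lie_bracket :: "('v::real_normed_vector \<Rightarrow> 'v) \<Rightarrow> ('v \<Rightarrow> 'v) \<Rightarrow> 'v \<Rightarrow> 'v" where
  "lie_bracket X Y x = frechet_derivative Y (at x) (X x) - frechet_derivative X (at x) (Y x)"

inductive_set lie_algebra_generated ::
    "('v::real_normed_vector \<Rightarrow> 'v) set \<Rightarrow> ('v \<Rightarrow> 'v) set" for F where
  base: "X \<in> F \<Longrightarrow> X \<in> lie_algebra_generated F"
| zero: "(\<lambda>x. 0) \<in> lie_algebra_generated F"
| add: "X \<in> lie_algebra_generated F \<Longrightarrow> Y \<in> lie_algebra_generated F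
    \<Longrightarrow> (\<lambda>x. X x + Y x) \<in> lie_algebra_generated F"
| scale: "X \<in> lie_algebra_generated F \<Longrightarrow> (\<lambda>x. c *\<^sub>R X x) \<in> lie_algebra_generated F"
| bracket: "X \<in> lie_algebra_generated F \<Longrightarrow> Y \<in> lie_algebra_generated F
    \<Longrightarrow> lie_bracket X Y \<in> lie_algebra_generated F"

definition lie_algebra_rank_condition :: "('e \<Rightarrow> real^'d^'d::finite) \<Rightarrow> bool" where
  "lie_algebra_rank_condition A \<longleftrightarrow>
    (\<forall>x. norm x = 1 \<longrightarrow>
      {X x | X. X \<in> lie_algebra_generated (range (\<lambda>i. proj_field (A i)))} = {v. v \<bullet> x = 0})"

definition dwell_semigroup ::
    "('e \<Rightarrow> real^'d^'d) \<Rightarrow> real \<Rightarrow> ('d::finite proj_space \<Rightarrow> 'd proj_space) set" where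
  "dwell_semigroup A \<tau> =
    {fold (\<lambda>(t, i). proj_flow (A i) t) w | w. w \<noteq> [] \<and> (\<forall>(t, i) \<in> set w. \<tau> \<le> t)}"

definition dwell_orbit ::
    "('e \<Rightarrow> real^'d^'d) \<Rightarrow> real \<Rightarrow> 'd::finite proj_space \<Rightarrow> 'd proj_space set" where
  "dwell_orbit A \<tau> q = {g q | g. g \<in> dwell_semigroup A \<tau>}"

text \<open>\<open>dwell_signal A \<tau> T u\<close>: the restriction of \<open>u\<close> to \<open>[0,T]\<close> is a finite concatenation of constant
  pieces of length at least \<open>\<tau>\<close>.  At an endpoint of a piece the value only has to be a mode, as
  it depends on how concatenation treats the common endpoint and does not affect trajectories.\<close>

definition dwell_signal :: "('e \<Rightarrow> real^'d^'d) \<Rightarrow> real \<Rightarrow> real \<Rightarrow> (real \<Rightarrow> real^'d^'d) \<Rightarrow> bool" where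
  "dwell_signal A \<tau> T u \<longleftrightarrow>
    (\<forall>t\<in>{0..T}. u t \<in> range A) \<and>
    (\<exists>k s. k \<ge> (1::nat) \<and> s 0 = 0 \<and> s k = T \<and>
      (\<forall>j<k. s j + \<tau> \<le> s (Suc j) \<and> (\<exists>B\<in>range A. \<forall>t\<in>{s j<..<s (Suc j)}. u t = B)))"

text \<open>Piecewise constancy on \<open>[0,\<infinity>)\<close> follows from the condition on the intervals \<open>[0, T n]\<close>.\<close>

definition dwell_signal_inf :: "('e \<Rightarrow> real^'d^'d) \<Rightarrow> real \<Rightarrow> (real \<Rightarrow> real^'d^'d) \<Rightarrow> bool" where
  "dwell_signal_inf A \<tau> u \<longleftrightarrow>
    (\<forall>t\<ge>0. u t \<in> range A) \<and>
    (\<exists>T. filterlim T at_top sequentially \<and> (\<forall>n::nat. dwell_signal A \<tau> (T n) u))"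

text \<open>The trajectory of the projected system is the projection of a nonzero solution of the linear
  system \<open>x' = u x\<close>; the finite set \<open>F\<close> accounts for the switching times.\<close>

definition proj_trajectory ::
    "real \<Rightarrow> 'd::finite proj_space \<Rightarrow> (real \<Rightarrow> real^'d^'d) \<Rightarrow> 'd proj_space" where
  "proj_trajectory t q u =
    (THE p. \<exists>x F. x 0 \<noteq> 0 \<and> to_proj (x 0) = q \<and> to_proj (x t) = p \<and>
      continuous_on {0..t} x \<and> finite F \<and>
      (\<forall>s\<in>{0..t} - F. (x has_vector_derivative (u s *v x s)) (at s within {0..t})))"

definition viable_and_approx_controllable ::
    "('e \<Rightarrow> real^'d^'d) \<Rightarrow> real \<Rightarrow> 'd::finite proj_space set \<Rightarrow> bool" where
  "viable_and_approx_controllable A \<tau> D \<longleftrightarrow>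
    (\<forall>q\<in>D. \<exists>u. dwell_signal_inf A \<tau> u \<and>
      (\<forall>t>0. dwell_signal A \<tau> t u \<and> dwell_signal_inf A \<tau> (\<lambda>s. u (t + s))
        \<longrightarrow> proj_trajectory t q u \<in> D)) \<and>
    (\<forall>q\<in>D. D \<subseteq> closure (dwell_orbit A \<tau> q))"

definition dwell_control_set ::
    "('e \<Rightarrow> real^'d^'d) \<Rightarrow> real \<Rightarrow> 'd::finite proj_space set \<Rightarrow> bool" where
  "dwell_control_set A \<tau> D \<longleftrightarrow>
    viable_and_approx_controllable A \<tau> D \<and>
    (\<forall>D'. viable_and_approx_controllable A \<tau> D' \<and> D \<subseteq> D' \<longrightarrow> D' = D)"

definition invariant_dwell_control_set ::
    "('e \<Rightarrow> real^'d^'d) \<Rightarrow> real \<Rightarrow> 'd::finite proj_space set \<Rightarrow> bool" where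
  "invariant_dwell_control_set A \<tau> D \<longleftrightarrow>
    dwell_control_set A \<tau> D \<and> (\<forall>q\<in>D. closure D = closure (dwell_orbit A \<tau> q))"

definition switching_matrix :: "('e::finite \<Rightarrow> 'e \<Rightarrow> real) \<Rightarrow> bool" where
  "switching_matrix P \<longleftrightarrow>
    (\<forall>i. (\<Sum>j\<in>UNIV. P i j) = 1 \<and> P i i = 0 \<and> (\<forall>j. i \<noteq> j \<longrightarrow> P i j > 0))"

definition dwell_density :: "real \<Rightarrow> real \<Rightarrow> real \<Rightarrow> real" where
  "dwell_density lam \<tau> t = (if \<tau> \<le> t then lam * exp (- lam * (t - \<tau>)) else 0)"

abbreviation state_space :: "('d::finite proj_space \<times> 'e::finite) measure" where
  "state_space \<equiv> borel \<Otimes>\<^sub>M count_space UNIV"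

definition transition_prob :: "('e::finite \<Rightarrow> real^'d^'d) \<Rightarrow> ('e \<Rightarrow> 'e \<Rightarrow> real) \<Rightarrow> real \<Rightarrow> real
    \<Rightarrow> 'd::finite proj_space \<times> 'e \<Rightarrow> ('d proj_space \<times> 'e) set \<Rightarrow> ennreal" where
  "transition_prob A P lam \<tau> = (\<lambda>(q, i) B.
    \<Sum>j\<in>UNIV. ennreal (P i j) *
      (\<integral>\<^sup>+ t. indicator B (proj_flow (A i) t q, j) * ennreal (dwell_density lam \<tau> t) \<partial>lborel))"

definition invariant_measure :: "('e::finite \<Rightarrow> real^'d^'d) \<Rightarrow> ('e \<Rightarrow> 'e \<Rightarrow> real) \<Rightarrow> real \<Rightarrow> real
    \<Rightarrow> ('d::finite proj_space \<times> 'e) measure \<Rightarrow> bool" where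
  "invariant_measure A P lam \<tau> \<mu> \<longleftrightarrow>
    prob_space \<mu> \<and> sets \<mu> = sets state_space \<and>
    (\<forall>B\<in>sets state_space. emeasure \<mu> B = (\<integral>\<^sup>+ z. transition_prob A P lam \<tau> z B \<partial>\<mu>))"

definition ergodic_invariant_measure :: "('e::finite \<Rightarrow> real^'d^'d) \<Rightarrow> ('e \<Rightarrow> 'e \<Rightarrow> real) \<Rightarrow> real
    \<Rightarrow> real \<Rightarrow> ('d::finite proj_space \<times> 'e) measure \<Rightarrow> bool" where
  "ergodic_invariant_measure A P lam \<tau> \<mu> \<longleftrightarrow>
    invariant_measure A P lam \<tau> \<mu> \<and>
    \<not> (\<exists>\<mu>1 \<mu>2 c. invariant_measure A P lam \<tau> \<mu>1 \<and> invariant_measure A P lam \<tau> \<mu>2 \<and> \<mu>1 \<noteq> \<mu>2 \<and>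
      0 < c \<and> c < 1 \<and>
      (\<forall>B\<in>sets state_space. measure \<mu> B = c * measure \<mu>1 B + (1 - c) * measure \<mu>2 B))"

text \<open>Topological support, for the discrete topology on the set of modes.\<close>

definition measure_support :: "('a::topological_space \<times> 'e) measure \<Rightarrow> ('a \<times> 'e) set" where
  "measure_support \<mu> = {(q, i). \<forall>V. open V \<and> q \<in> V \<longrightarrow> emeasure \<mu> (V \<times> {i}) > 0}"

text \<open>The durations \<open>U\<close> are indexed from 1.  The next mode is drawn according to the row \<open>P (L n)\<close>
  given the initial state, the modes up to time \<open>n\<close> and all durations, so that the choice of modes
  does not depend on the durations; this fixes the joint law of the process.\<close>

locale switching_process = prob_space M
  for M :: "'w measure"
    and A :: "'e::finite \<Rightarrow> real^'d^'d::finite" and P :: "'e \<Rightarrow> 'e \<Rightarrow> real" and lam \<tau> :: real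
    and U :: "nat \<Rightarrow> 'w \<Rightarrow> real" and Q :: "nat \<Rightarrow> 'w \<Rightarrow> 'd proj_space" and L :: "nat \<Rightarrow> 'w \<Rightarrow> 'e" +
  assumes durations_indep: "indep_vars (\<lambda>_. borel) U {1..}"
    and durations_density: "\<And>n. n \<ge> 1 \<Longrightarrow> distributed M lborel (U n) (\<lambda>t. ennreal (dwell_density lam \<tau> t))"
    and initial_measurable: "(\<lambda>\<omega>. (Q 0 \<omega>, L 0 \<omega>)) \<in> measurable M state_space"
    and initial_indep: "indep_set
      (sets (vimage_algebra (space M) (\<lambda>\<omega>. (Q 0 \<omega>, L 0 \<omega>)) state_space))
      (sets (vimage_algebra (space M) (\<lambda>\<omega>. \<lambda>k\<in>{1..}. U k \<omega>) (PiM {1..} (\<lambda>_. borel))))"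
    and position: "\<And>n \<omega>. \<omega> \<in> space M \<Longrightarrow>
      Q (Suc n) \<omega> = proj_flow (A (L n \<omega>)) (U (Suc n) \<omega>) (Q n \<omega>)"
    and modes_measurable: "\<And>n. L n \<in> measurable M (count_space UNIV)"
    and modes_transition: "\<And>n j. AE \<omega> in M.
      real_cond_exp M
        (vimage_algebra (space M)
          (\<lambda>\<omega>. (Q 0 \<omega>, (\<lambda>k\<in>{..n}. L k \<omega>), (\<lambda>k\<in>{1..}. U k \<omega>)))
          (borel \<Otimes>\<^sub>M PiM {..n} (\<lambda>_. count_space UNIV) \<Otimes>\<^sub>M PiM {1..} (\<lambda>_. borel)))
        (indicator {\<omega> \<in> space M. L (Suc n) \<omega> = j}) \<omega>
      = P (L n \<omega>) j"

definition jump_time :: "(nat \<Rightarrow> 'w \<Rightarrow> real) \<Rightarrow> nat \<Rightarrow> 'w \<Rightarrow> real" where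
  "jump_time U n \<omega> = (\<Sum>k=1..n. U k \<omega>)"

primrec Phi :: "('e \<Rightarrow> real^'d^'d) \<Rightarrow> (nat \<Rightarrow> 'w \<Rightarrow> real) \<Rightarrow> (nat \<Rightarrow> 'w \<Rightarrow> 'e)
    \<Rightarrow> nat \<Rightarrow> 'w \<Rightarrow> real^'d^'d" where
  "Phi A U L 0 \<omega> = mat 1"
| "Phi A U L (Suc n) \<omega> = mat_exp (U (Suc n) \<omega> *\<^sub>R A (L n \<omega>)) ** Phi A U L n \<omega>"

definition Psi :: "('e \<Rightarrow> real^'d^'d) \<Rightarrow> (nat \<Rightarrow> 'w \<Rightarrow> real) \<Rightarrow> (nat \<Rightarrow> 'w \<Rightarrow> 'e)
    \<Rightarrow> real \<Rightarrow> 'w \<Rightarrow> real^'d^'d" where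
  "Psi A U L t \<omega> =
    (let n = (THE n. jump_time U n \<omega> \<le> t \<and> t < jump_time U (Suc n) \<omega>)
     in mat_exp ((t - jump_time U n \<omega>) *\<^sub>R A (L n \<omega>)) ** Phi A U L n \<omega>)"

definition is_lyapunov_exponent :: "'w measure \<Rightarrow> ('e \<Rightarrow> real^'d^'d) \<Rightarrow> (nat \<Rightarrow> 'w \<Rightarrow> real)
    \<Rightarrow> (nat \<Rightarrow> 'w \<Rightarrow> 'e) \<Rightarrow> real \<Rightarrow> bool" where
  "is_lyapunov_exponent M A U L chi \<longleftrightarrow>
    (AE \<omega> in M. ((\<lambda>t. 1 / t * ln (onorm ((*v) (Psi A U L t \<omega>)))) \<longlongrightarrow> chi) at_top)"

definition mode_part :: "('d::finite proj_space \<times> 'e::finite) measure \<Rightarrow> 'e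
    \<Rightarrow> ('d proj_space \<times> 'e) measure" where
  "mode_part \<mu> i =
    measure_of UNIV (sets state_space) (\<lambda>B. emeasure \<mu> (B \<inter> (UNIV \<times> {i})))"

definition averaged_measure :: "('e::finite \<Rightarrow> real^'d^'d) \<Rightarrow> real \<Rightarrow> real
    \<Rightarrow> ('d::finite proj_space \<times> 'e) measure \<Rightarrow> ('d proj_space \<times> 'e) measure" where
  "averaged_measure A lam \<tau> \<mu> =
    measure_of UNIV (sets state_space) (\<lambda>B.
      ennreal (lam\<^sup>2 / (\<tau> * lam + 1)) *
      (\<Sum>i\<in>UNIV. \<integral>\<^sup>+ s\<in>{\<tau>..}.
        (\<integral>\<^sup>+ t\<in>{0..s}.
          emeasure (distr (mode_part \<mu> i) state_space (\<lambda>(q, j). (proj_flow (A i) t q, j))) B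
          \<partial>lborel) * ennreal (exp (- lam * (s - \<tau>))) \<partial>lborel))"

end

theory Submission
  imports Defs
begin

text \<open>
  Write \<open>g (q, i)\<close> for the expected logarithm of the factor by which \<open>e\<^sup>t\<^sup>A\<close> with \<open>A = A i\<close> stretches
  the line \<open>q\<close>, where \<open>t\<close> has the dwell-time law.  Along the flow, the derivative of this logarithm is
  \<open>\<langle>\<theta>, A \<theta>\<rangle>\<close>; integrating over the piece of trajectory between two jumps (\<open>integral_form_along_flow\<close>)
  shows that the integral of \<open>\<langle>\<theta>, A \<theta>\<rangle>\<close> against \<open>\<nu>\<close> is the mean of \<open>g\<close> under \<open>\<mu>\<close> divided by the mean
  duration \<open>(\<tau> \<lambda> + 1) / \<lambda>\<close> (\<open>integral_averaged_measure\<close>).  What has to be proved is that this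
  quotient is the growth rate \<open>\<chi>\<close> of the matrix products \<open>\<Phi> n\<close> (\<open>mean_log_growth\<close>).

  Let a line be drawn from \<open>\<mu>\<close> independently of the process.  The logarithmic growth of a vector of
  this line is the sum of the increments along the chain of positions and modes.  If on events
  of probability bounded away from 0 these sums have a fixed sign, then the mean increment
  under \<open>\<mu>\<close> has this sign (\<open>increments_nonneg\<close>): the occupation measures of the chain restricted to
  the events are dominated by \<open>\<mu>\<close>, a law of large numbers for centred increments makes their
  cluster points invariant, and extremality of \<open>\<mu>\<close> among the invariant measures makes these cluster
  points positive multiples of \<open>\<mu>\<close>.  This is applied to the increments minus \<open>\<chi> \<plusminus> \<epsilon>\<close> times the duration.

  The upper bound holds as vectors grow at most like the norm of \<open>\<Phi> n\<close>.  For the lower bound the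
  line must stretch almost like the norm of \<open>\<Phi> n\<close> with probability bounded below, uniformly in the
  matrix \<open>\<Phi> n\<close> (\<open>spread_directions\<close>).  This holds when the lines in the support of \<open>\<mu>\<close> with a given mode
  span the space.  Their spans turn out to be one common subspace that is invariant under all modes
  (\<open>span_support_UNIV\<close>), and the rank condition leaves no proper nonzero invariant subspace: on such a
  subspace all iterated brackets are tangent to it (\<open>invariant_subspace_is_UNIV\<close>).

  The support of \<open>\<nu>\<close> is found from the fact that flowing for a time of at least \<open>\<tau>\<close> maps the support of
  one mode part of \<open>\<mu>\<close> into that of every other mode (\<open>support_averaged_measure\<close>).
\<close>

section \<open>The matrix exponential\<close>

lemma matrix_power_mult_vector: "((**) B ^^ n) (mat 1) *v x = ((*v) B ^^ n) x"
  for B :: "real^'d^'d::finite"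
  by (induction n) (auto simp flip: matrix_vector_mul_assoc)

lemma norm_matrix_power_le: "norm (((*v) B ^^ n) x) \<le> onorm ((*v) B) ^ n * norm x"
  for B :: "real^'d^'d::finite"
proof (induction n)
  case (Suc n)
  have "norm (((*v) B ^^ Suc n) x) \<le> onorm ((*v) B) * norm (((*v) B ^^ n) x)"
    by (simp add: onorm)
  also have "\<dots> \<le> onorm ((*v) B) * (onorm ((*v) B) ^ n * norm x)"
    using Suc by (intro mult_left_mono) (auto simp: onorm_pos_le)
  finally show ?case by (simp add: algebra_simps)
qed simp

lemma norm_matrix_le_columns: "norm R \<le> (\<Sum>i\<in>(UNIV::'d set). \<Sum>j\<in>UNIV. norm (R *v axis j 1))"
  for R :: "real^'d^'d::finite"
proof -
  have "norm R \<le> (\<Sum>i\<in>UNIV. norm (R $ i))"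
    unfolding norm_vec_def by (intro L2_set_le_sum) auto
  also have "\<dots> \<le> (\<Sum>i\<in>UNIV. \<Sum>j\<in>UNIV. norm (R $ i $ j))"
    using norm_le_l1_cart by (intro sum_mono) (auto simp: real_norm_def)
  also have "\<dots> \<le> (\<Sum>i\<in>(UNIV::'d set). \<Sum>j\<in>UNIV. norm (R *v axis j 1))"
  proof (intro sum_mono)
    fix i j
    have "R $ i $ j = (R *v axis j 1) $ i" by (simp add: matrix_vector_mult_basis column_def)
    then show "norm (R $ i $ j) \<le> norm (R *v axis j 1)"
      using component_le_norm_cart[of "R *v axis j 1" i] by simp
  qed
  finally show ?thesis .
qed

lemma mat_exp_summable: "summable (\<lambda>n. (1 / fact n) *\<^sub>R (((**) B ^^ n) (mat 1)))"
  for B :: "real^'d^'d::finite"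
proof (rule summable_comparison_test')
  let ?c = "\<Sum>i\<in>(UNIV::'d set). \<Sum>j\<in>(UNIV::'d set). 1 :: real"
  show "summable (\<lambda>n. ?c * (inverse (fact n) * onorm ((*v) B) ^ n))"
    by (intro summable_mult summable_exp)
  fix n :: nat assume "n \<ge> 0"
  have "norm (((**) B ^^ n) (mat 1)) \<le> (\<Sum>i\<in>(UNIV::'d set). \<Sum>j\<in>(UNIV::'d set). onorm ((*v) B) ^ n)"
  proof (rule order_trans[OF norm_matrix_le_columns], intro sum_mono)
    fix j :: 'd
    show "norm (((**) B ^^ n) (mat 1) *v axis j 1) \<le> onorm ((*v) B) ^ n"
      using norm_matrix_power_le[where B=B and n=n and x="axis j 1"] by (simp add: matrix_power_mult_vector)
  qed
  then show "norm ((1 / fact n) *\<^sub>R (((**) B ^^ n) (mat 1))) \<le> ?c * (inverse (fact n) * onorm ((*v) B) ^ n)"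
    by (simp add: field_simps)
qed

lemma mat_exp_mult_vector_sums:
  "(\<lambda>n. (1 / fact n) *\<^sub>R (((*v) B ^^ n) x)) sums (mat_exp B *v x)" for B :: "real^'d^'d::finite"
proof -
  have bl: "bounded_linear (\<lambda>M::real^'d^'d. M *v x)"
    by (intro linear_conv_bounded_linear[THEN iffD1] linearI)
      (auto simp: matrix_vector_mult_add_rdistrib scaleR_matrix_vector_assoc)
  show ?thesis
    using bounded_linear.sums[OF bl summable_sums[OF mat_exp_summable[of B]]]
    by (simp add: matrix_power_mult_vector mat_exp_def scaleR_matrix_vector_assoc[symmetric])
qed

lemma mat_exp_zero: "mat_exp (0 :: real^'d^'d::finite) = mat 1"
proof -
  have "(\<lambda>n. (1 / fact n) *\<^sub>R (((**) (0::real^'d^'d) ^^ n) (mat 1)))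
      = (\<lambda>n. if n = 0 then mat 1 else 0)"
  proof
    fix n show "(1 / fact n) *\<^sub>R (((**) (0::real^'d^'d) ^^ n) (mat 1)) = (if n = 0 then mat 1 else 0)"
      by (cases n) auto
  qed
  then show ?thesis using sums_If_finite_set[of "{0}" "\<lambda>_. mat 1 :: real^'d^'d"]
    by (simp add: mat_exp_def sums_iff)
qed

lemma matrix_power_scale: "((*v) (t *\<^sub>R B) ^^ n) x = t ^ n *\<^sub>R (((*v) B ^^ n) x)"
  for B :: "real^'d^'d::finite"
  by (induction n) (auto simp: matrix_vector_mult_scaleR scaleR_matrix_vector_assoc[symmetric])

text \<open>Each component of the orbit is an everywhere convergent power series in \<open>t\<close>, whose
  derivative has the coefficients of the orbit of \<open>B x\<close>.\<close>

lemma mat_exp_has_vector_derivative: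
  "((\<lambda>t. mat_exp (t *\<^sub>R B) *v x) has_vector_derivative (B *v (mat_exp (t *\<^sub>R B) *v x))) (at t)"
  for B :: "real^'d^'d::finite"
proof -
  have *: "((\<lambda>t. (mat_exp (t *\<^sub>R B) *v x) $ k) has_real_derivative (B *v (mat_exp (t *\<^sub>R B) *v x)) $ k) (at t)" for k
  proof -
    define c where "c n = (((*v) B ^^ n) x $ k) / fact n" for n
    have s: "(\<lambda>n. c n * t ^ n) sums ((mat_exp (t *\<^sub>R B) *v x) $ k)" for t
      using bounded_linear.sums[OF bounded_linear_vec_nth[of k] mat_exp_mult_vector_sums[of "t *\<^sub>R B" x]]
      by (simp add: matrix_power_scale c_def mult.commute)
    have d: "diffs c n = (B *v (((*v) B ^^ n) x)) $ k / fact n" for n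
      by (simp add: diffs_def c_def)
    have "(\<lambda>n. diffs c n * t ^ n) sums ((B *v (mat_exp (t *\<^sub>R B) *v x)) $ k)"
      using bounded_linear.sums[OF bounded_linear_vec_nth[of k] bounded_linear.sums[OF
          matrix_vector_mul_bounded_linear[of B] mat_exp_mult_vector_sums[of "t *\<^sub>R B" x]]]
      by (simp add: matrix_power_scale d mult.commute matrix_vector_mult_scaleR)
    moreover have "summable (\<lambda>n. c n * t ^ n)" for t using s by (auto simp: sums_iff)
    moreover have "(\<lambda>t. (mat_exp (t *\<^sub>R B) *v x) $ k) = (\<lambda>t. \<Sum>n. c n * t ^ n)"
      using s by (auto simp: sums_iff)
    ultimately show ?thesis
      using termdiffs_strong_converges_everywhere[of c t] by (simp add: sums_iff)
  qed
  have "((\<lambda>t. \<chi> k. (mat_exp (t *\<^sub>R B) *v x) $ k) has_vector_derivative (\<chi> k. (B *v (mat_exp (t *\<^sub>R B) *v x)) $ k)) (at t)"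
    unfolding has_vector_derivative_def has_derivative_componentwise_within[where f="\<lambda>t. \<chi> k. _ t k"]
    using * by (auto simp: Basis_vec_def inner_axis has_field_derivative_def mult_commute_abs)
  then show ?thesis by simp
qed

lemma norm_square_mat_exp_derivative:
  fixes B :: "real^'d^'d::finite" and x :: "real^'d"
  defines "y \<equiv> \<lambda>t. mat_exp (t *\<^sub>R B) *v x"
  shows "((\<lambda>t. y t \<bullet> y t) has_real_derivative 2 * (y t \<bullet> (B *v y t))) (at t)"
  unfolding y_def
  using bounded_bilinear.has_vector_derivative[OF bounded_bilinear_inner
      mat_exp_has_vector_derivative[of B x t] mat_exp_has_vector_derivative[of B x t]]
  by (simp add: has_real_derivative_iff_has_vector_derivative inner_commute algebra_simps)

text \<open>By Cauchy-Schwarz, \<open>\<bar>y \<bullet> B y\<bar> \<le> K (y \<bullet> y)\<close> along the orbit \<open>y\<close>, so that the products of \<open>y \<bullet> y\<close> with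
  \<open>e\<^sup>2\<^sup>K\<^sup>t\<close> and with \<open>e\<^sup>-\<^sup>2\<^sup>K\<^sup>t\<close> are monotone.  The lower bound is the reason why the flow acts on lines.\<close>

lemma norm_mat_exp_bounds:
  fixes B :: "real^'d^'d::finite"
  assumes K: "onorm ((*v) B) \<le> K"
  shows "exp (- K * \<bar>t\<bar>) * norm x \<le> norm (mat_exp (t *\<^sub>R B) *v x)"
    and "norm (mat_exp (t *\<^sub>R B) *v x) \<le> exp (K * \<bar>t\<bar>) * norm x"
proof -
  have *: "exp (- K * t) * norm x \<le> norm (mat_exp (t *\<^sub>R B) *v x) \<and> norm (mat_exp (t *\<^sub>R B) *v x) \<le> exp (K * t) * norm x"
    if "onorm ((*v) B) \<le> K" "t \<ge> 0" for t and B :: "real^'d^'d"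
  proof -
    let ?y = "\<lambda>t. mat_exp (t *\<^sub>R B) *v x"
    have d: "((\<lambda>t. ?y t \<bullet> ?y t) has_real_derivative 2 * (?y t \<bullet> (B *v ?y t))) (at t)" for t
      by (rule norm_square_mat_exp_derivative)
    have e2: "exp (2 * K * t) = (exp (K * t))\<^sup>2"
      by (simp add: exp_double[symmetric] mult.assoc)
    have b: "\<bar>?y t \<bullet> (B *v ?y t)\<bar> \<le> K * (?y t \<bullet> ?y t)" for t
    proof -
      have "\<bar>?y t \<bullet> (B *v ?y t)\<bar> \<le> norm (?y t) * (onorm ((*v) B) * norm (?y t))"
        by (rule order_trans[OF Cauchy_Schwarz_ineq2]) (auto intro!: mult_left_mono onorm)
      also have "\<dots> \<le> norm (?y t) * (K * norm (?y t))"
        using that by (intro mult_left_mono mult_right_mono) auto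
      finally show ?thesis by (simp add: dot_square_norm power2_eq_square algebra_simps)
    qed
    have "exp (2 * K * 0) * (?y 0 \<bullet> ?y 0) \<le> exp (2 * K * t) * (?y t \<bullet> ?y t)"
    proof (rule DERIV_nonneg_imp_nondecreasing[OF \<open>t \<ge> 0\<close>])
      fix s
      have "((\<lambda>s. exp (2 * K * s) * (?y s \<bullet> ?y s)) has_real_derivative
          exp (2 * K * s) * (2 * (?y s \<bullet> (B *v ?y s)) + 2 * K * (?y s \<bullet> ?y s))) (at s)"
        by (auto intro!: derivative_eq_intros d simp: algebra_simps)
      moreover have "exp (2 * K * s) * (2 * (?y s \<bullet> (B *v ?y s)) + 2 * K * (?y s \<bullet> ?y s)) \<ge> 0"
        using b[of s] by (intro mult_nonneg_nonneg) auto
      ultimately show "\<exists>y. ((\<lambda>s. exp (2 * K * s) * (?y s \<bullet> ?y s)) has_real_derivative y) (at s) \<and> 0 \<le> y"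
        by blast
    qed
    then have "x \<bullet> x \<le> exp (2 * K * t) * (?y t \<bullet> ?y t)" by (simp add: mat_exp_zero)
    then have "(norm x)\<^sup>2 \<le> (exp (K * t) * norm (?y t))\<^sup>2"
      by (simp only: e2 dot_square_norm power_mult_distrib)
    then have "norm x \<le> exp (K * t) * norm (?y t)" by (rule power2_le_imp_le) simp
    then have "exp (- K * t) * norm x \<le> norm (?y t)"
      by (simp add: exp_minus divide_simps) (simp add: mult.commute)
    moreover have "exp (- 2 * K * t) * (?y t \<bullet> ?y t) \<le> exp (- 2 * K * 0) * (?y 0 \<bullet> ?y 0)"
    proof (rule DERIV_nonpos_imp_nonincreasing[OF \<open>t \<ge> 0\<close>])
      fix s
      have "((\<lambda>s. exp (- 2 * K * s) * (?y s \<bullet> ?y s)) has_real_derivative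
          exp (- 2 * K * s) * (2 * (?y s \<bullet> (B *v ?y s)) - 2 * K * (?y s \<bullet> ?y s))) (at s)"
        by (auto intro!: derivative_eq_intros d simp: algebra_simps)
      moreover have "exp (- 2 * K * s) * (2 * (?y s \<bullet> (B *v ?y s)) - 2 * K * (?y s \<bullet> ?y s)) \<le> 0"
        using b[of s] by (intro mult_nonneg_nonpos) auto
      ultimately show "\<exists>y. ((\<lambda>s. exp (- 2 * K * s) * (?y s \<bullet> ?y s)) has_real_derivative y) (at s) \<and> y \<le> 0"
        by blast
    qed
    then have "inverse (exp (2 * K * t)) * (?y t \<bullet> ?y t) \<le> x \<bullet> x" by (simp add: mat_exp_zero exp_minus)
    then have "(?y t \<bullet> ?y t) \<le> exp (2 * K * t) * (x \<bullet> x)"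
      by (simp add: inverse_eq_divide divide_le_eq mult.commute)
    then have "(norm (?y t))\<^sup>2 \<le> (exp (K * t) * norm x)\<^sup>2"
      by (simp only: e2 dot_square_norm power_mult_distrib)
    then have "norm (?y t) \<le> exp (K * t) * norm x" by (rule power2_le_imp_le) simp
    ultimately show ?thesis by blast
  qed
  \<comment> \<open>For negative times, the orbit is that of the opposite matrix at the opposite time.\<close>
  have "(- B) *v y = - (B *v y)" for y
    using scaleR_matrix_vector_assoc[of "-1" B y] by simp
  then have "onorm ((*v) (- B)) = onorm ((*v) B)"
    by (simp add: onorm_def)
  then show "exp (- K * \<bar>t\<bar>) * norm x \<le> norm (mat_exp (t *\<^sub>R B) *v x)"
    "norm (mat_exp (t *\<^sub>R B) *v x) \<le> exp (K * \<bar>t\<bar>) * norm x"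
    using *[of B t] *[of "- B" "- t"] K by (cases "t \<ge> 0"; simp)+
qed

lemma mat_exp_mult_eq_0_iff [simp]: "mat_exp (t *\<^sub>R B) *v x = 0 \<longleftrightarrow> x = 0"
  for B :: "real^'d^'d::finite"
  using norm_mat_exp_bounds(1)[OF order_refl, of B t x]
  by (auto simp: mult_le_0_iff not_le)

lemma vec_sum_axis: "(\<Sum>j\<in>UNIV. (x $ j) *\<^sub>R axis j 1) = x" for x :: "real^'d::finite"
  by (simp add: vec_eq_iff axis_def if_distrib cong: if_cong)

lemma continuous_on_mat_exp_mult:
  fixes B :: "real^'d^'d::finite"
  shows "continuous_on UNIV (\<lambda>(t, x). mat_exp (t *\<^sub>R B) *v x)"
proof -
  have c: "continuous_on UNIV (\<lambda>t. mat_exp (t *\<^sub>R B) *v y)" for y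
    by (intro continuous_on_vector_derivative) (use mat_exp_has_vector_derivative in auto)
  have "(\<lambda>(t, x). mat_exp (t *\<^sub>R B) *v x) = (\<lambda>(t, x). \<Sum>j\<in>UNIV. (x $ j) *\<^sub>R (mat_exp (t *\<^sub>R B) *v axis j 1))"
  proof (intro ext, clarify)
    fix t and x :: "real^'d"
    have "mat_exp (t *\<^sub>R B) *v x = mat_exp (t *\<^sub>R B) *v (\<Sum>j\<in>UNIV. (x $ j) *\<^sub>R axis j 1)"
      by (simp only: vec_sum_axis)
    also have "\<dots> = (\<Sum>j\<in>UNIV. (x $ j) *\<^sub>R (mat_exp (t *\<^sub>R B) *v axis j 1))"
      by (simp add: linear_sum matrix_vector_mult_scaleR)
    finally show "mat_exp (t *\<^sub>R B) *v x = (\<Sum>j\<in>UNIV. (x $ j) *\<^sub>R (mat_exp (t *\<^sub>R B) *v axis j 1))" .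
  qed
  moreover have "continuous_on UNIV (\<lambda>p. \<Sum>j\<in>UNIV. (snd p $ j) *\<^sub>R (mat_exp (fst p *\<^sub>R B) *v axis j 1))"
    by (intro continuous_intros continuous_on_compose2[OF c]) auto
  ultimately show ?thesis by (simp add: case_prod_beta)
qed

lemma mat_exp_mem_subspace:
  fixes B :: "real^'d^'d::finite"
  assumes W: "subspace W" and B: "\<And>x. x \<in> W \<Longrightarrow> B *v x \<in> W" and x: "x \<in> W"
  shows "mat_exp (t *\<^sub>R B) *v x \<in> W"
proof -
  have "((*v) (t *\<^sub>R B) ^^ n) x \<in> W" for n
    by (induction n) (use x B W in \<open>auto simp: scaleR_matrix_vector_assoc[symmetric] subspace_scale\<close>)
  then have "(\<Sum>k<n. (1 / fact k) *\<^sub>R (((*v) (t *\<^sub>R B) ^^ k) x)) \<in> W" for n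
    by (intro subspace_sum subspace_scale W) auto
  with mat_exp_mult_vector_sums[of "t *\<^sub>R B" x] show ?thesis
    unfolding sums_def by (rule closed_sequentially[OF closed_subspace[OF W],
      where f="\<lambda>n. \<Sum>k<n. (1 / fact k) *\<^sub>R (((*v) (t *\<^sub>R B) ^^ k) x)", rotated])
qed

section \<open>Projective space\<close>

lemma Rep_to_proj: "x \<noteq> 0 \<Longrightarrow> Rep_proj_space (to_proj x) = span {x}"
  unfolding to_proj_def by (rule Abs_proj_space_inverse) (simp add: dim_span dim_singleton)

lemma to_proj_scaleR: "c \<noteq> 0 \<Longrightarrow> to_proj (c *\<^sub>R x) = to_proj x"
  unfolding to_proj_def by (simp add: span_image_scale[of "{x}" "\<lambda>_. c", simplified])

lemma to_proj_eq_iff: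
  assumes "x \<noteq> 0" "y \<noteq> 0"
  shows "to_proj x = to_proj y \<longleftrightarrow> (\<exists>c. c \<noteq> 0 \<and> y = c *\<^sub>R x)"
proof
  assume "to_proj x = to_proj y"
  then have "span {x} = span {y}" using Rep_to_proj assms by metis
  then have "y \<in> span {x}" by (simp add: span_base)
  then show "\<exists>c. c \<noteq> 0 \<and> y = c *\<^sub>R x" using assms by (auto simp: span_singleton)
qed (auto simp: to_proj_scaleR)

lemma Rep_proj_space_line: "\<exists>x. x \<noteq> 0 \<and> Rep_proj_space q = span {x}"
proof -
  have q: "subspace (Rep_proj_space q)" "dim (Rep_proj_space q) = 1" using Rep_proj_space[of q] by auto
  obtain B where B: "B \<subseteq> Rep_proj_space q" "independent B" "Rep_proj_space q \<subseteq> span B" "card B = dim (Rep_proj_space q)"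
    using basis_exists by blast
  then obtain b where b: "B = {b}" using q card_1_singletonE by metis
  have "b \<noteq> 0" using B(2) b dependent_zero by blast
  moreover have "Rep_proj_space q = span {b}"
    using B q b by (metis span_minimal subset_antisym)
  ultimately show ?thesis by blast
qed

lemma unit_rep: "norm (unit_rep q) = 1" "unit_rep q \<in> Rep_proj_space q"
proof -
  obtain x where x: "x \<noteq> 0" "Rep_proj_space q = span {x}" using Rep_proj_space_line by blast
  then have "norm (x /\<^sub>R norm x) = 1 \<and> x /\<^sub>R norm x \<in> Rep_proj_space q"
    by (auto simp: span_base span_scale)
  from someI[where P="\<lambda>x. norm x = 1 \<and> x \<in> Rep_proj_space q", OF this]
  show "norm (unit_rep q) = 1" "unit_rep q \<in> Rep_proj_space q" unfolding unit_rep_def by auto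
qed

lemma unit_rep_nonzero [simp]: "unit_rep q \<noteq> 0"
  using unit_rep(1)[of q] by auto

lemma to_proj_unit_rep [simp]: "to_proj (unit_rep q) = q"
proof -
  obtain x where x: "x \<noteq> 0" "Rep_proj_space q = span {x}" using Rep_proj_space_line by blast
  then have "unit_rep q \<in> span {x}" using unit_rep by blast
  then obtain c where "unit_rep q = c *\<^sub>R x" by (auto simp: span_singleton)
  then have "to_proj (unit_rep q) = to_proj x" using to_proj_scaleR[of c x] unit_rep_nonzero[of q] by auto
  also have "\<dots> = q" using x by (metis Rep_proj_space_inverse to_proj_def)
  finally show ?thesis .
qed

lemma unit_vectors_same_line:
  assumes "to_proj x = to_proj y" "norm x = 1" "norm y = 1"
  shows "y = x \<or> y = - x"
proof -
  have "x \<noteq> 0" "y \<noteq> 0" using assms by auto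
  then obtain c where c: "y = c *\<^sub>R x" using to_proj_eq_iff assms by blast
  then have "\<bar>c\<bar> = 1" using assms by simp
  then show ?thesis using c by (auto simp: abs_if split: if_splits)
qed

lemma open_proj_iff: "open V \<longleftrightarrow> open {x. x \<noteq> 0 \<and> to_proj x \<in> V}"
  by (simp add: open_proj_space_def)

text \<open>The universal property of the quotient topology.\<close>

lemma continuous_on_proj_space:
  fixes h :: "real^'d::finite \<Rightarrow> 'b::topological_space"
  assumes "continuous_on (- {0}) h" "\<And>x. x \<noteq> 0 \<Longrightarrow> k (to_proj x) = h x"
  shows "continuous_on UNIV k"
  unfolding continuous_on_open_vimage[OF open_UNIV]
proof (intro allI impI)
  fix V :: "'b set" assume V: "open V"
  have "open (h -` V \<inter> - {0})"
    using assms(1) V continuous_on_open_vimage[of "- {0}" h] by (auto simp: open_Compl)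
  moreover have "h -` V \<inter> - {0} = {x. x \<noteq> 0 \<and> to_proj x \<in> k -` V \<inter> UNIV}" using assms(2) by auto
  ultimately show "open (k -` V \<inter> UNIV)" unfolding open_proj_iff by simp
qed

text \<open>The lines meeting an open set fill the union of its nonzero multiples, which is open.\<close>

lemma open_to_proj_image:
  assumes "open S" shows "open (to_proj ` (S - {0}))"
proof -
  have "{x. x \<noteq> 0 \<and> to_proj x \<in> to_proj ` (S - {0})} = (\<Union>c\<in>-{0}. (\<lambda>x. c *\<^sub>R x) ` (S - {0}))"
  proof (intro equalityI subsetI)
    fix x :: "real^'a" assume "x \<in> {x. x \<noteq> 0 \<and> to_proj x \<in> to_proj ` (S - {0})}"
    then obtain y where *: "x \<noteq> 0" "to_proj x = to_proj y" "y \<in> S" "y \<noteq> 0" by auto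
    then obtain c where "c \<noteq> 0" "x = c *\<^sub>R y" using to_proj_eq_iff[of y x] by auto
    then show "x \<in> (\<Union>c\<in>-{0}. (\<lambda>x. c *\<^sub>R x) ` (S - {0}))" using * by auto
  qed (auto simp: to_proj_scaleR)
  moreover have "open (\<Union>c\<in>-{0::real}. (\<lambda>x. c *\<^sub>R x) ` (S - {0}))"
    by (intro open_UN ballI open_scaling) (auto simp: assms open_delete)
  ultimately show ?thesis unfolding open_proj_iff by simp
qed

lemma measurable_to_proj:
  assumes f: "f \<in> borel_measurable M" and nz: "\<And>x. x \<in> space M \<Longrightarrow> f x \<noteq> 0"
  shows "(\<lambda>x. to_proj (f x)) \<in> borel_measurable M"
proof (rule borel_measurableI)
  fix S :: "'b proj_space set" assume "open S"
  then have "f -` {x. x \<noteq> 0 \<and> to_proj x \<in> S} \<inter> space M \<in> sets M"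
    unfolding open_proj_iff by (intro measurable_sets[OF f] borel_open)
  moreover have "(\<lambda>x. to_proj (f x)) -` S \<inter> space M = f -` {x. x \<noteq> 0 \<and> to_proj x \<in> S} \<inter> space M"
    using nz by auto
  ultimately show "(\<lambda>x. to_proj (f x)) -` S \<inter> space M \<in> sets M" by simp
qed

text \<open>The entries of the orthogonal projection onto the line: these depend on the line only, whereas
  \<open>unit_rep\<close> is an arbitrary choice of signs and need not be a measurable function.\<close>

definition proj_coord :: "'d \<Rightarrow> 'd \<Rightarrow> 'd::finite proj_space \<Rightarrow> real" where
  "proj_coord k l q = unit_rep q $ k * unit_rep q $ l"

lemma proj_coord_to_proj:
  assumes "x \<noteq> 0" shows "proj_coord k l (to_proj x) = x $ k * x $ l / (x \<bullet> x)"
proof -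
  have "to_proj (x /\<^sub>R norm x) = to_proj (unit_rep (to_proj x))"
    using assms by (simp add: to_proj_scaleR)
  then have "unit_rep (to_proj x) = x /\<^sub>R norm x \<or> unit_rep (to_proj x) = - (x /\<^sub>R norm x)"
    by (rule unit_vectors_same_line) (use assms unit_rep(1) in auto)
  then show ?thesis
    by (auto simp: proj_coord_def dot_square_norm power2_eq_square divide_simps)
qed

lemma proj_coord_measurable [measurable]: "proj_coord k l \<in> borel_measurable borel"
  by (rule borel_measurable_continuous_onI, rule continuous_on_proj_space[where h="\<lambda>x. x $ k * x $ l / (x \<bullet> x)"])
    (auto intro!: continuous_intros simp: proj_coord_to_proj)

text \<open>The pivot is a function of the finite set of nonzero coordinates and therefore Borel measurable.
  Normalising the pivot coordinate to be positive gives a Borel measurable choice of unit vectors.\<close>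

definition pivot :: "'d::finite proj_space \<Rightarrow> 'd" where
  "pivot q = (SOME k. k \<in> {k. proj_coord k k q \<noteq> 0})"

definition proj_section :: "'d::finite proj_space \<Rightarrow> real^'d" where
  "proj_section q = (\<Sum>l\<in>UNIV. (proj_coord (pivot q) l q / sqrt (proj_coord (pivot q) (pivot q) q)) *\<^sub>R axis l 1)"

lemma pivot_nonzero: "unit_rep q $ pivot q \<noteq> 0"
proof -
  obtain k where "unit_rep q $ k \<noteq> 0" using unit_rep_nonzero[of q] by (auto simp: vec_eq_iff)
  then have "k \<in> {k. proj_coord k k q \<noteq> 0}" by (simp add: proj_coord_def)
  then have "pivot q \<in> {k. proj_coord k k q \<noteq> 0}" unfolding pivot_def by (rule someI)
  then show ?thesis by (simp add: proj_coord_def)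
qed

lemma proj_section_cases: "proj_section q = unit_rep q \<or> proj_section q = - unit_rep q"
proof -
  let ?x = "unit_rep q" let ?k = "pivot q"
  have "proj_section q $ l = (?x $ ?k / \<bar>?x $ ?k\<bar>) * ?x $ l" for l
    by (simp add: proj_section_def proj_coord_def axis_def if_distrib cong: if_cong)
  then show ?thesis using pivot_nonzero[of q] by (cases "?x $ ?k > 0") (auto simp: vec_eq_iff)
qed

lemma norm_proj_section [simp]: "norm (proj_section q) = 1"
  using proj_section_cases[of q] unit_rep(1)[of q] by auto

lemma proj_section_nonzero [simp]: "proj_section q \<noteq> 0"
  using norm_proj_section[of q] by (metis norm_zero zero_neq_one)

lemma to_proj_section [simp]: "to_proj (proj_section q) = q"
  using proj_section_cases[of q] to_proj_scaleR[of "-1" "unit_rep q"] by auto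

lemma pivot_measurable [measurable]: "pivot \<in> measurable borel (count_space UNIV)"
proof -
  have "(\<lambda>q::'a proj_space. {k. proj_coord k k q \<noteq> 0}) \<in> measurable borel (count_space UNIV)"
  proof (subst measurable_count_space_eq2, simp, intro conjI ballI)
    fix J :: "'a set"
    have "(\<lambda>q. {k. proj_coord k k q \<noteq> 0}) -` {J} \<inter> space borel
        = {q \<in> space borel. \<forall>k\<in>UNIV. (proj_coord k k q \<noteq> 0) = (k \<in> J)}" by auto
    also have "\<dots> \<in> sets borel" by measurable
    finally show "(\<lambda>q. {k. proj_coord k k q \<noteq> 0}) -` {J} \<inter> space borel \<in> sets borel" .
  qed auto
  from measurable_compose[OF this, of "\<lambda>J. SOME k. k \<in> J"]
  show ?thesis unfolding pivot_def by simp
qed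

lemma proj_section_measurable [measurable]: "proj_section \<in> borel_measurable borel"
  unfolding proj_section_def
  by (rule measurable_compose_countable'[where I=UNIV and g=pivot and
        f="\<lambda>k q. \<Sum>l\<in>UNIV. (proj_coord k l q / sqrt (proj_coord k k q)) *\<^sub>R axis l 1"])
    (auto intro: countable_finite)

lemma proj_flow_to_proj:
  assumes "x \<noteq> 0" shows "proj_flow B t (to_proj x) = to_proj (mat_exp (t *\<^sub>R B) *v x)"
proof -
  have "(*v) (mat_exp (t *\<^sub>R B)) ` span {x} = span {mat_exp (t *\<^sub>R B) *v x}"
    using linear_span_image[OF matrix_vector_mul_linear, of "mat_exp (t *\<^sub>R B)" "{x}"] by simp
  then show ?thesis using assms by (simp add: proj_flow_def proj_act_def Rep_to_proj to_proj_def[of "_ *v _"])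
qed

lemma proj_flow_section: "proj_flow B t q = to_proj (mat_exp (t *\<^sub>R B) *v proj_section q)"
  using proj_flow_to_proj[of "proj_section q" B t] by simp

lemma measurable_mat_exp_mult [measurable (raw)]:
  assumes "f \<in> borel_measurable M" "g \<in> borel_measurable M"
  shows "(\<lambda>x. mat_exp (f x *\<^sub>R B) *v g x) \<in> borel_measurable M"
  using borel_measurable_continuous_on[OF continuous_on_mat_exp_mult[of B] borel_measurable_Pair[OF assms]] by simp

lemma measurable_proj_flow [measurable (raw)]:
  assumes "f \<in> borel_measurable M" "g \<in> borel_measurable M"
  shows "(\<lambda>x. proj_flow B (f x) (g x)) \<in> borel_measurable M"
  unfolding proj_flow_section by (rule measurable_to_proj) (use assms in auto)

definition log_growth :: "real^'d^'d \<Rightarrow> real \<Rightarrow> 'd::finite proj_space \<Rightarrow> real" where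
  "log_growth B t q = ln (norm (mat_exp (t *\<^sub>R B) *v proj_section q))"

lemma measurable_log_growth [measurable (raw)]:
  assumes "f \<in> borel_measurable M" "g \<in> borel_measurable M"
  shows "(\<lambda>x. log_growth B (f x) (g x)) \<in> borel_measurable M"
  unfolding log_growth_def using assms by measurable

lemma abs_log_growth_le:
  assumes "onorm ((*v) B) \<le> K" shows "\<bar>log_growth B t q\<bar> \<le> K * \<bar>t\<bar>"
proof -
  let ?n = "norm (mat_exp (t *\<^sub>R B) *v proj_section q)"
  have p: "?n > 0" by simp
  have "exp (- (K * \<bar>t\<bar>)) \<le> ?n" "?n \<le> exp (K * \<bar>t\<bar>)"
    using norm_mat_exp_bounds[OF assms, of t "proj_section q"] by auto
  then have "- (K * \<bar>t\<bar>) \<le> ln ?n" "ln ?n \<le> K * \<bar>t\<bar>"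
    using p ln_le_cancel_iff[of ?n "exp (K * \<bar>t\<bar>)"] by (auto simp: ln_ge_iff)
  then show ?thesis unfolding log_growth_def by linarith
qed

text \<open>By homogeneity all vectors of a line are stretched by the same factor.\<close>

lemma log_norm_mat_exp:
  assumes "x \<noteq> 0"
  shows "ln (norm (mat_exp (t *\<^sub>R B) *v x)) = log_growth B t (to_proj x) + ln (norm x)"
proof -
  obtain c where c: "c \<noteq> 0" "x = c *\<^sub>R proj_section (to_proj x)"
    using to_proj_eq_iff[of "proj_section (to_proj x)" x] assms by auto
  then have n: "norm x = \<bar>c\<bar>" by (metis norm_scaleR norm_proj_section mult.right_neutral)
  have "norm (mat_exp (t *\<^sub>R B) *v x) = \<bar>c\<bar> * norm (mat_exp (t *\<^sub>R B) *v proj_section (to_proj x))"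
    by (subst c(2)) (simp add: matrix_vector_mult_scaleR)
  then show ?thesis using c n by (simp add: log_growth_def ln_mult)
qed

text \<open>The open null sets cover \<open>V\<close>; their lifts to the vector space have a countable subcover by the
  Lindelof property there.\<close>

lemma measure_zero_off_support:
  fixes m :: "('d::finite proj_space \<times> 'e::finite) measure"
  assumes s: "sets m = sets state_space" and V: "open V"
    and d: "\<And>q. q \<in> V \<Longrightarrow> (q, i) \<notin> measure_support m"
  shows "emeasure m (V \<times> {i}) = 0"
proof -
  define \<V> where "\<V> = {W::'d proj_space set. open W \<and> emeasure m (W \<times> {i}) = 0}"
  define lift where "lift W = {x::real^'d. x \<noteq> 0 \<and> to_proj x \<in> W}" for W
  have "V \<subseteq> \<Union>\<V>"
  proof
    fix q assume "q \<in> V"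
    then obtain W where "open W" "q \<in> W" "\<not> emeasure m (W \<times> {i}) > 0"
      using d unfolding measure_support_def by blast
    then show "q \<in> \<Union>\<V>" unfolding \<V>_def by auto
  qed
  have "\<And>S. S \<in> lift ` \<V> \<Longrightarrow> open S" unfolding \<V>_def lift_def by (auto simp: open_proj_iff)
  then obtain F where F: "F \<subseteq> lift ` \<V>" "countable F" "\<Union>F = \<Union>(lift ` \<V>)"
    using Lindelof by metis
  then obtain \<W> where W: "countable \<W>" "\<W> \<subseteq> \<V>" "F = lift ` \<W>"
    using countable_subset_image[of F lift \<V>] by metis
  have "\<Union>\<V> \<subseteq> \<Union>\<W>"
  proof
    fix q assume "q \<in> \<Union>\<V>"
    then have "proj_section q \<in> \<Union>(lift ` \<V>)" by (auto simp: lift_def)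
    then have "proj_section q \<in> \<Union>(lift ` \<W>)" using F W by simp
    then show "q \<in> \<Union>\<W>" by (auto simp: lift_def)
  qed
  with \<open>V \<subseteq> \<Union>\<V>\<close> have "V \<subseteq> \<Union>\<W>" by (rule order_trans)
  then have sub: "V \<times> {i} \<subseteq> (\<Union>W\<in>\<W>. W \<times> {i})" by auto
  have m: "open W \<Longrightarrow> W \<times> {i} \<in> sets m" for W :: "'d proj_space set" unfolding s by auto
  have "(\<Union>W\<in>\<W>. W \<times> {i}) \<in> null_sets m"
    using W by (intro null_sets_UN') (auto simp: \<V>_def m intro!: null_setsI)
  then have "V \<times> {i} \<in> null_sets m" using m[OF V] sub by (rule null_sets_subset)
  then show ?thesis by (rule null_setsD1)
qed

section \<open>Irreducibility from the Lie algebra rank condition\<close>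

text \<open>Lie brackets are formed with \<open>frechet_derivative\<close>, which carries no information at points where a
  field is not differentiable.  So a class of fields is needed that contains the fields induced by matrices, is
  differentiable off the origin and is closed under brackets: the fields whose components are
  polynomials in the coordinates and in the inverse of \<open>x \<bullet> x\<close>.\<close>

inductive rational_fun :: "(real^'d::finite \<Rightarrow> real) \<Rightarrow> bool" where
  const: "rational_fun (\<lambda>x. c)"
| coord: "rational_fun (\<lambda>x. x $ k)"
| inv: "rational_fun (\<lambda>x. inverse (x \<bullet> x))"
| add: "rational_fun f \<Longrightarrow> rational_fun g \<Longrightarrow> rational_fun (\<lambda>x. f x + g x)"
| mult: "rational_fun f \<Longrightarrow> rational_fun g \<Longrightarrow> rational_fun (\<lambda>x. f x * g x)"

lemma rational_fun_sum: "finite S \<Longrightarrow> (\<And>k. k \<in> S \<Longrightarrow> rational_fun (f k)) \<Longrightarrow> rational_fun (\<lambda>x. \<Sum>k\<in>S. f k x)"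
  by (induction S rule: finite_induct) (auto intro: rational_fun.intros)

lemma rational_fun_diff: "rational_fun f \<Longrightarrow> rational_fun g \<Longrightarrow> rational_fun (\<lambda>x. f x - g x)"
  using rational_fun.add[of f "\<lambda>x. (-1) * g x"] rational_fun.mult[OF rational_fun.const[of "-1"], of g] by simp

lemma rational_fun_derivative:
  fixes f :: "real^'d::finite \<Rightarrow> real"
  assumes "rational_fun f"
  shows "\<exists>D. (\<forall>k. rational_fun (D k)) \<and> (\<forall>x. x \<noteq> 0 \<longrightarrow> (f has_derivative (\<lambda>h. \<Sum>k\<in>UNIV. h $ k * D k x)) (at x))"
  using assms
proof induction
  case (const c)
  show ?case by (intro exI[of _ "\<lambda>k x. 0"]) (auto intro: rational_fun.const)
next
  case (coord l)
  show ?case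
    by (intro exI[of _ "\<lambda>k x. if k = l then 1 else 0"] conjI allI impI rational_fun.const)
      (simp add: if_distrib bounded_linear_imp_has_derivative bounded_linear_vec_nth cong: if_cong)
next
  case inv
  have "((\<lambda>x. inverse (x \<bullet> x)) has_derivative
      (\<lambda>h. \<Sum>k\<in>UNIV. h $ k * (- 2 * (x $ k * (inverse (x \<bullet> x) * inverse (x \<bullet> x)))))) (at x)"
    if "x \<noteq> 0" for x :: "real^'d"
  proof -
    have "((\<lambda>x. inverse (x \<bullet> x)) has_derivative
      (\<lambda>h. - (inverse (x \<bullet> x) * (x \<bullet> h + h \<bullet> x) * inverse (x \<bullet> x)))) (at x)"
      using that by (auto intro!: derivative_eq_intros)
    moreover have "- (inverse (x \<bullet> x) * (x \<bullet> h + h \<bullet> x) * inverse (x \<bullet> x)) =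
      (\<Sum>k\<in>UNIV. h $ k * (- 2 * (x $ k * (inverse (x \<bullet> x) * inverse (x \<bullet> x)))))" for h
    proof -
      have "- (inverse (x \<bullet> x) * (x \<bullet> h + h \<bullet> x) * inverse (x \<bullet> x)) = (h \<bullet> x) * (- 2 * (inverse (x \<bullet> x) * inverse (x \<bullet> x)))"
        by (simp add: inner_commute[of x h])
      also have "\<dots> = (\<Sum>k\<in>UNIV. h $ k * (- 2 * (x $ k * (inverse (x \<bullet> x) * inverse (x \<bullet> x)))))"
        unfolding inner_vec_def[of h x] sum_distrib_right by (simp add: mult_ac)
      finally show ?thesis .
    qed
    ultimately show ?thesis by simp
  qed
  moreover have "rational_fun (\<lambda>x::real^'d. - 2 * (x $ k * (inverse (x \<bullet> x) * inverse (x \<bullet> x))))" for k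
    by (rule rational_fun.mult[OF rational_fun.const rational_fun.mult[OF rational_fun.coord
          rational_fun.mult[OF rational_fun.inv rational_fun.inv]]])
  ultimately show ?case
    by (intro exI[of _ "\<lambda>k x. - 2 * (x $ k * (inverse (x \<bullet> x) * inverse (x \<bullet> x)))"] conjI allI impI)
next
  case (add f g)
  then obtain D1 D2 where D: "\<And>k. rational_fun (D1 k)" "\<And>k. rational_fun (D2 k)"
    "\<And>x. x \<noteq> 0 \<Longrightarrow> (f has_derivative (\<lambda>h. \<Sum>k\<in>UNIV. h $ k * D1 k x)) (at x)"
    "\<And>x. x \<noteq> 0 \<Longrightarrow> (g has_derivative (\<lambda>h. \<Sum>k\<in>UNIV. h $ k * D2 k x)) (at x)" by blast
  show ?case
  proof (intro exI[of _ "\<lambda>k x. D1 k x + D2 k x"] conjI allI impI)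
    fix x :: "real^'d" assume "x \<noteq> 0"
    from has_derivative_add[OF D(3,4)[OF this]]
    show "((\<lambda>x. f x + g x) has_derivative (\<lambda>h. \<Sum>k\<in>UNIV. h $ k * (D1 k x + D2 k x))) (at x)"
      by (simp add: distrib_left sum.distrib)
  qed (intro rational_fun.add D)
next
  case (mult f g)
  then obtain D1 D2 where D: "\<And>k. rational_fun (D1 k)" "\<And>k. rational_fun (D2 k)"
    "\<And>x. x \<noteq> 0 \<Longrightarrow> (f has_derivative (\<lambda>h. \<Sum>k\<in>UNIV. h $ k * D1 k x)) (at x)"
    "\<And>x. x \<noteq> 0 \<Longrightarrow> (g has_derivative (\<lambda>h. \<Sum>k\<in>UNIV. h $ k * D2 k x)) (at x)" by blast
  show ?case
  proof (intro exI[of _ "\<lambda>k x. f x * D2 k x + D1 k x * g x"] conjI allI impI)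
    fix x :: "real^'d" assume "x \<noteq> 0"
    from has_derivative_mult[OF D(3,4)[OF this]]
    show "((\<lambda>x. f x * g x) has_derivative (\<lambda>h. \<Sum>k\<in>UNIV. h $ k * (f x * D2 k x + D1 k x * g x))) (at x)"
      by (simp add: distrib_left sum.distrib sum_distrib_left sum_distrib_right mult_ac)
  qed (intro rational_fun.add rational_fun.mult D mult)
qed

definition rational_field :: "(real^'d::finite \<Rightarrow> real^'d) \<Rightarrow> bool" where
  "rational_field X \<longleftrightarrow> (\<exists>r. (\<forall>l. rational_fun (r l)) \<and> (\<forall>l x. x \<noteq> 0 \<longrightarrow> X x $ l = r l x))"

lemma rational_fieldI:
  "(\<And>l. rational_fun (r l)) \<Longrightarrow> (\<And>l x. x \<noteq> 0 \<Longrightarrow> X x $ l = r l x) \<Longrightarrow> rational_field X"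
  unfolding rational_field_def by (intro exI[of _ r]) simp

lemma rational_field_derivative:
  assumes "rational_field X"
  shows "\<exists>D. (\<forall>k l. rational_fun (D k l)) \<and>
    (\<forall>x. x \<noteq> 0 \<longrightarrow> (X has_derivative (\<lambda>h. \<chi> l. \<Sum>k\<in>UNIV. h $ k * D k l x)) (at x))"
proof -
  obtain r where r: "\<And>l. rational_fun (r l)" "\<And>l x. x \<noteq> 0 \<Longrightarrow> X x $ l = r l x"
    using assms unfolding rational_field_def by blast
  have "\<forall>l. \<exists>D. (\<forall>k. rational_fun (D k)) \<and> (\<forall>x. x \<noteq> 0 \<longrightarrow> (r l has_derivative (\<lambda>h. \<Sum>k\<in>UNIV. h $ k * D k x)) (at x))"
    using rational_fun_derivative r(1) by blast
  from choice[OF this] obtain D where D: "\<And>k l. rational_fun (D l k)"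
    "\<And>x l. x \<noteq> 0 \<Longrightarrow> (r l has_derivative (\<lambda>h. \<Sum>k\<in>UNIV. h $ k * D l k x)) (at x)"
    by blast
  have "(X has_derivative (\<lambda>h. \<chi> l. \<Sum>k\<in>UNIV. h $ k * D l k x)) (at x)" if "x \<noteq> 0" for x
  proof (rule has_derivative_transform_within_open[where f="\<lambda>x. \<chi> l. r l x"])
    show "((\<lambda>x. \<chi> l. r l x) has_derivative (\<lambda>h. \<chi> l. \<Sum>k\<in>UNIV. h $ k * D l k x)) (at x)"
      unfolding has_derivative_componentwise_within[where f="\<lambda>x. \<chi> l. r l x"]
      using D(2)[OF that] by (auto simp: Basis_vec_def inner_axis)
    show "open (- {0 :: real^'a})" by (simp add: open_Compl)
    show "x \<in> - {0}" using that by simp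
    show "\<And>x. x \<in> - {0} \<Longrightarrow> (\<chi> l. r l x) = X x" using r(2) by (simp add: vec_eq_iff)
  qed
  then show ?thesis using D(1) by (intro exI[of _ "\<lambda>k l. D l k"] conjI allI impI)
qed

lemma lie_bracket_rational_field:
  assumes X: "rational_field X" and Y: "rational_field Y"
  shows "rational_field (lie_bracket X Y)"
proof -
  obtain DX where DX: "\<And>k l. rational_fun (DX k l)"
    "\<And>x. x \<noteq> 0 \<Longrightarrow> (X has_derivative (\<lambda>h. \<chi> l. \<Sum>k\<in>UNIV. h $ k * DX k l x)) (at x)"
    using rational_field_derivative[OF X] by blast
  obtain DY where DY: "\<And>k l. rational_fun (DY k l)"
    "\<And>x. x \<noteq> 0 \<Longrightarrow> (Y has_derivative (\<lambda>h. \<chi> l. \<Sum>k\<in>UNIV. h $ k * DY k l x)) (at x)"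
    using rational_field_derivative[OF Y] by blast
  obtain rX where rX: "\<And>l. rational_fun (rX l)" "\<And>l x. x \<noteq> 0 \<Longrightarrow> X x $ l = rX l x"
    using X unfolding rational_field_def by blast
  obtain rY where rY: "\<And>l. rational_fun (rY l)" "\<And>l x. x \<noteq> 0 \<Longrightarrow> Y x $ l = rY l x"
    using Y unfolding rational_field_def by blast
  show ?thesis
  proof (rule rational_fieldI)
    fix l
    show "rational_fun (\<lambda>x. (\<Sum>k\<in>UNIV. rX k x * DY k l x) - (\<Sum>k\<in>UNIV. rY k x * DX k l x))"
      by (intro rational_fun_diff rational_fun_sum rational_fun.mult DX DY rX rY) auto
    fix x :: "real^'a" assume x: "x \<noteq> 0"
    show "lie_bracket X Y x $ l = (\<Sum>k\<in>UNIV. rX k x * DY k l x) - (\<Sum>k\<in>UNIV. rY k x * DX k l x)"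
      unfolding lie_bracket_def
      using x rX rY by (simp flip: frechet_derivative_at[OF DX(2)[OF x]] frechet_derivative_at[OF DY(2)[OF x]])
  qed
qed

lemma lie_algebra_rational_field:
  assumes "X \<in> lie_algebra_generated (range (\<lambda>i. proj_field (A i)))"
  shows "rational_field X"
  using assms
proof induction
  case (base X)
  then obtain i where X: "X = proj_field (A i)" by auto
  have "rational_fun (\<lambda>x. (\<Sum>j\<in>UNIV. A i $ l $ j * x $ j) -
      ((\<Sum>k\<in>UNIV. x $ k * (\<Sum>j\<in>UNIV. A i $ k $ j * x $ j)) * inverse (x \<bullet> x)) * x $ l)" for l
    by (intro rational_fun_diff rational_fun_sum rational_fun.intros) auto
  then show ?case
    by (intro rational_fieldI) (assumption,
      auto simp: X proj_field_def matrix_vector_mult_def inner_vec_def[of _ "\<chi> i. _ i"] divide_inverse)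
next
  case zero
  show ?case by (rule rational_fieldI[of "\<lambda>l x. 0"]) (auto intro: rational_fun.const)
next
  case (add X Y)
  then obtain rX rY where "\<And>l. rational_fun (rX l)" "\<And>l x. x \<noteq> 0 \<Longrightarrow> X x $ l = rX l x"
    "\<And>l. rational_fun (rY l)" "\<And>l x. x \<noteq> 0 \<Longrightarrow> Y x $ l = rY l x"
    unfolding rational_field_def by blast
  then show ?case by (intro rational_fieldI[of "\<lambda>l x. rX l x + rY l x"] rational_fun.add) auto
next
  case (scale X c)
  then obtain rX where "\<And>l. rational_fun (rX l)" "\<And>l x. x \<noteq> 0 \<Longrightarrow> X x $ l = rX l x"
    unfolding rational_field_def by blast
  then show ?case
    by (intro rational_fieldI[of "\<lambda>l x. c * rX l x"] rational_fun.mult rational_fun.const) auto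
next
  case (bracket X Y)
  then show ?case using lie_bracket_rational_field by blast
qed

text \<open>The inner product of the curve with the component of \<open>v\<close> orthogonal to \<open>W\<close> vanishes near \<open>t\<close>; its
  derivative is the squared norm of that component.\<close>

lemma has_vector_derivative_in_subspace:
  fixes c :: "real \<Rightarrow> 'v::euclidean_space"
  assumes W: "subspace W" and c: "(c has_vector_derivative v) (at t)"
    and ev: "eventually (\<lambda>s. c s \<in> W) (nhds t)"
  shows "v \<in> W"
proof -
  obtain y z where yz: "v = y + z" "y \<in> span W" "\<And>w. w \<in> span W \<Longrightarrow> orthogonal z w"
    using orthogonal_subspace_decomp_exists by metis
  have "((\<lambda>s. z \<bullet> c s) has_real_derivative z \<bullet> v) (at t)"
    using bounded_linear.has_vector_derivative[OF bounded_linear_inner_right c]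
    by (simp add: has_real_derivative_iff_has_vector_derivative)
  moreover have "eventually (\<lambda>s. z \<bullet> c s = 0) (nhds t)"
    using ev by eventually_elim (use yz(3) in \<open>auto simp: orthogonal_def span_base\<close>)
  then have "((\<lambda>s. z \<bullet> c s) has_real_derivative z \<bullet> v) (at t) \<longleftrightarrow> ((\<lambda>s. 0) has_real_derivative z \<bullet> v) (at t)"
    by (intro DERIV_cong_ev) auto
  ultimately have "z \<bullet> v = 0" using DERIV_unique[OF _ DERIV_const] by blast
  moreover have "z \<bullet> y = 0" using yz by (auto simp: orthogonal_def)
  ultimately have "z = 0" using yz(1) by (simp add: inner_add_right)
  then show ?thesis using yz W by (simp add: span_eq_iff[THEN iffD2])
qed

text \<open>Two fields that map \<open>W\<close> into \<open>W\<close> have a bracket with this property, because the derivative of such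
  a field at a point of \<open>W\<close> in a direction of \<open>W\<close> lies in \<open>W\<close>.\<close>

lemma lie_algebra_tangent_invariant_subspace:
  assumes W: "subspace W" and A: "\<And>i x. x \<in> W \<Longrightarrow> A i *v x \<in> W"
    and X: "X \<in> lie_algebra_generated (range (\<lambda>i. proj_field (A i)))"
    and x: "x \<in> W" "x \<noteq> 0"
  shows "X x \<in> W"
  using X x
proof (induction arbitrary: x)
  case (base X)
  then show ?case by (auto simp: proj_field_def intro!: subspace_diff subspace_scale W A)
next
  case (bracket X Y)
  have *: "frechet_derivative Y (at x) v \<in> W"
    if Y: "Y \<in> lie_algebra_generated (range (\<lambda>i. proj_field (A i)))" "\<And>x. x \<in> W \<Longrightarrow> x \<noteq> 0 \<Longrightarrow> Y x \<in> W"
      and v: "v \<in> W" for Y v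
  proof -
    obtain Y' where Y': "(Y has_derivative Y') (at x)"
      using rational_field_derivative[OF lie_algebra_rational_field[OF Y(1)]] \<open>x \<noteq> 0\<close> by blast
    have "((\<lambda>s. x + s *\<^sub>R v) has_vector_derivative v) (at 0)"
      by (auto intro!: derivative_eq_intros)
    then have "((\<lambda>s. Y (x + s *\<^sub>R v)) has_vector_derivative Y' v) (at 0)"
      using vector_derivative_diff_chain_within[of "\<lambda>s. x + s *\<^sub>R v" v 0 UNIV Y Y'] Y'
      by (simp add: o_def has_derivative_at_withinI)
    moreover have "((\<lambda>s. x + s *\<^sub>R v) \<longlongrightarrow> x + 0 *\<^sub>R v) (nhds 0)"
      by (intro tendsto_intros) (auto simp: filterlim_ident)
    then have "eventually (\<lambda>s. x + s *\<^sub>R v \<noteq> 0) (nhds 0)"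
      using \<open>x \<noteq> 0\<close> tendsto_imp_eventually_ne[of "\<lambda>s. x + s *\<^sub>R v" x "nhds 0" 0] by simp
    then have "eventually (\<lambda>s. Y (x + s *\<^sub>R v) \<in> W) (nhds 0)"
      by eventually_elim (auto intro!: Y(2) subspace_add subspace_scale W v bracket.prems)
    ultimately have "Y' v \<in> W" using has_vector_derivative_in_subspace[OF W] by blast
    then show ?thesis using frechet_derivative_at[OF Y'] by simp
  qed
  show ?case unfolding lie_bracket_def
    using bracket by (intro subspace_diff W *) auto
qed (auto intro!: subspace_0 subspace_add subspace_scale W)

text \<open>The rank condition at a unit vector \<open>x\<close> of \<open>W\<close> puts the orthogonal complement of \<open>x\<close> into \<open>W\<close>.\<close>

lemma invariant_subspace_is_UNIV:
  assumes "lie_algebra_rank_condition A" and W: "subspace W" "W \<noteq> {0}"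
    and A: "\<And>i x. x \<in> W \<Longrightarrow> A i *v x \<in> W"
  shows "W = UNIV"
proof -
  obtain y where "y \<in> W" "y \<noteq> 0" using W subspace_0 by blast
  define x where "x = y /\<^sub>R norm y"
  have x: "x \<in> W" "norm x = 1" "x \<noteq> 0"
    using \<open>y \<in> W\<close> \<open>y \<noteq> 0\<close> W by (auto simp: x_def subspace_scale)
  have orth: "v \<in> W" if "v \<bullet> x = 0" for v
  proof -
    have "v \<in> {X x | X. X \<in> lie_algebra_generated (range (\<lambda>i. proj_field (A i)))}"
      using assms(1) x(2) that unfolding lie_algebra_rank_condition_def by blast
    then obtain X where X: "v = X x" "X \<in> lie_algebra_generated (range (\<lambda>i. proj_field (A i)))" by blast
    have "X x \<in> W" by (rule lie_algebra_tangent_invariant_subspace[OF W(1) A X(2) x(1,3)])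
    then show ?thesis using X(1) by simp
  qed
  have "v \<in> W" for v
  proof -
    have "v - (v \<bullet> x) *\<^sub>R x \<in> W" by (rule orth) (use x in \<open>simp add: inner_diff_left dot_square_norm\<close>)
    then have "(v - (v \<bullet> x) *\<^sub>R x) + (v \<bullet> x) *\<^sub>R x \<in> W" by (intro subspace_add subspace_scale W x)
    then show ?thesis by simp
  qed
  then show ?thesis by auto
qed

section \<open>The support of an invariant measure\<close>

lemma state_space_sets [simp]:
  fixes m :: "('d::finite proj_space \<times> 'e::finite) measure"
  assumes "sets m = sets state_space"
  shows "space m = UNIV" "open V \<Longrightarrow> V \<times> {i} \<in> sets m"
  using sets_eq_imp_space_eq[OF assms] unfolding assms by (auto simp: space_pair_measure)

lemma invariant_measureD:
  assumes "invariant_measure A P lam \<tau> \<mu>"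
  shows "prob_space \<mu>" "sets \<mu> = sets state_space"
    "B \<in> sets state_space \<Longrightarrow> emeasure \<mu> B = (\<integral>\<^sup>+ z. transition_prob A P lam \<tau> z B \<partial>\<mu>)"
  using assms unfolding invariant_measure_def by auto

lemma switching_matrixD:
  assumes "switching_matrix P"
  shows "(\<Sum>j\<in>UNIV. P i j) = 1" "P i i = 0" "i \<noteq> j \<Longrightarrow> P i j > 0" "P i j \<ge> 0" "P i j \<le> 1"
proof -
  show *: "(\<Sum>j\<in>UNIV. P i j) = 1" "P i i = 0" "i \<noteq> j \<Longrightarrow> P i j > 0" for i j
    using assms by (auto simp: switching_matrix_def)
  have nn: "P i j \<ge> 0" for i j using *(2)[of i] *(3)[of i j] by (cases "i = j") auto
  then show "P i j \<ge> 0" .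
  show "P i j \<le> 1" using *(1)[of i] member_le_sum[of j UNIV "P i"] nn by simp
qed

lemma exists_other_mode:
  fixes i :: "'e::finite"
  assumes "CARD('e) \<ge> 2"
  shows "\<exists>j. i \<noteq> j"
proof (rule ccontr)
  assume "\<not> (\<exists>j. i \<noteq> j)"
  then have "(UNIV :: 'e set) \<subseteq> {i}" by auto
  then have "CARD('e) \<le> card {i}" by (rule card_mono[rotated]) simp
  then show False using assms by simp
qed

text \<open>By continuity, lines near \<open>q\<close> flow into \<open>V\<close> during a time interval starting at \<open>t\<close>, on which the dwell
  density is bounded below; the next mode is \<open>j\<close> with positive probability.  Invariance bounds the mass
  of \<open>V\<close> in mode \<open>j\<close> from below by a multiple of the mass near \<open>q\<close> in mode \<open>i\<close>.\<close>

lemma support_flow_invariant: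
  assumes "lam > 0" and P: "switching_matrix P" and \<mu>: "invariant_measure A P lam \<tau> \<mu>"
    and q: "(q, i) \<in> measure_support \<mu>" and t: "\<tau> \<le> t" and ij: "i \<noteq> j"
  shows "(proj_flow (A i) t q, j) \<in> measure_support \<mu>"
  unfolding measure_support_def
proof (clarify)
  fix V assume V: "open V" "proj_flow (A i) t q \<in> V"
  note [simp] = invariant_measureD(2)[OF \<mu>]
  let ?lift = "{x. x \<noteq> 0 \<and> to_proj x \<in> V}"
  let ?E = "\<lambda>(s, x). mat_exp (s *\<^sub>R A i) *v x"
  have "open (?E -` ?lift)"
    by (rule open_vimage[OF V(1)[unfolded open_proj_iff] continuous_on_mat_exp_mult])
  moreover have "(t, proj_section q) \<in> ?E -` ?lift" using V(2) by (simp add: proj_flow_section)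
  ultimately obtain S T where ST: "open S" "open T" "t \<in> S" "proj_section q \<in> T" "S \<times> T \<subseteq> ?E -` ?lift"
    by (auto elim!: open_prod_elim)
  obtain e where e: "e > 0" "cball t e \<subseteq> S" using ST(1,3) open_contains_cball by blast
  define N where "N = to_proj ` (T - {0})"
  have N: "open N" "q \<in> N"
    unfolding N_def using open_to_proj_image[OF ST(2)] ST(4)
    by (auto intro!: image_eqI[of _ _ "proj_section q"])
  have flow: "proj_flow (A i) s q' \<in> V" if q': "q' \<in> N" and s: "s \<in> {t..t+e}" for q' s
  proof -
    obtain y where y: "y \<in> T" "y \<noteq> 0" "q' = to_proj y" using q' unfolding N_def by auto
    have "(s, y) \<in> S \<times> T" using y e s by (auto simp: dist_real_def cball_def subset_iff)
    then show ?thesis using ST(5) y by (auto simp: proj_flow_to_proj)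
  qed
  define d where "d = lam * exp (- lam * (t + e - \<tau>))"
  have d: "d > 0" using \<open>lam > 0\<close> by (simp add: d_def)
  have dens: "dwell_density lam \<tau> s \<ge> d" if "s \<in> {t..t+e}" for s
    using that t \<open>lam > 0\<close> by (auto simp: dwell_density_def d_def)
  have "ennreal (P i j * (d * e)) * indicator (N \<times> {i}) z \<le> transition_prob A P lam \<tau> z (V \<times> {j})" for z
  proof (cases "z \<in> N \<times> {i}")
    case True
    then obtain q' where z: "z = (q', i)" "q' \<in> N" by auto
    have "ennreal (d * e) = (\<integral>\<^sup>+ s. ennreal d * indicator {t..t+e} s \<partial>lborel)"
      using e d by (simp add: nn_integral_cmult_indicator ennreal_mult)
    also have "\<dots> \<le> (\<integral>\<^sup>+ s. indicator (V \<times> {j}) (proj_flow (A i) s q', j) * ennreal (dwell_density lam \<tau> s) \<partial>lborel)"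
      using flow[OF z(2)] dens by (intro nn_integral_mono) (auto simp: indicator_def intro!: ennreal_leI)
    finally have "ennreal (P i j) * ennreal (d * e) \<le> ennreal (P i j) *
        (\<integral>\<^sup>+ s. indicator (V \<times> {j}) (proj_flow (A i) s q', j) * ennreal (dwell_density lam \<tau> s) \<partial>lborel)"
      by (rule mult_left_mono) simp
    also have "\<dots> \<le> transition_prob A P lam \<tau> z (V \<times> {j})"
      unfolding transition_prob_def z(1) prod.case
      by (intro member_le_sum[where f="\<lambda>j'. ennreal (P i j') * _ j'"]) auto
    finally show ?thesis using True switching_matrixD(4)[OF P] d e by (simp add: ennreal_mult)
  qed simp
  then have "(\<integral>\<^sup>+ z. ennreal (P i j * (d * e)) * indicator (N \<times> {i}) z \<partial>\<mu>) \<le> emeasure \<mu> (V \<times> {j})"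
    using invariant_measureD(3)[OF \<mu>, of "V \<times> {j}"] V(1) by (auto intro!: nn_integral_mono)
  then have "ennreal (P i j * (d * e)) * emeasure \<mu> (N \<times> {i}) \<le> emeasure \<mu> (V \<times> {j})"
    using N by (simp add: nn_integral_cmult_indicator)
  moreover have "emeasure \<mu> (N \<times> {i}) > 0" using q N unfolding measure_support_def by auto
  moreover have "ennreal (P i j * (d * e)) > 0" using switching_matrixD(3)[OF P ij] d e by simp
  ultimately show "emeasure \<mu> (V \<times> {j}) > 0"
    by (metis ennreal_zero_less_mult_iff less_le_trans)
qed

lemma support_nonempty:
  assumes "prob_space \<mu>" and s: "sets \<mu> = sets state_space"
  shows "measure_support \<mu> \<noteq> {}"
proof
  assume "measure_support \<mu> = {}"
  then have "emeasure \<mu> (UNIV \<times> {i}) = 0" for i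
    using measure_zero_off_support[OF s, of UNIV i] by simp
  then have "(\<Union>i. UNIV \<times> {i}) \<in> null_sets \<mu>"
    by (intro null_sets_UN' null_setsI) (auto simp: s intro: countable_finite)
  moreover have "(\<Union>i. UNIV \<times> {i}) = space \<mu>" using s by auto
  ultimately show False using prob_space.emeasure_space_1[OF assms(1)] by auto
qed

text \<open>Let \<open>W i\<close> be the span of the lines in the support with mode \<open>i\<close>.  For \<open>i \<noteq> j\<close> and \<open>t \<ge> \<tau>\<close>, the flow of
  mode \<open>i\<close> maps \<open>W i\<close> injectively into \<open>W j\<close>; since this holds in both directions, all dimensions
  agree and the image is \<open>W j\<close>.  Differentiating in \<open>t\<close> shows that \<open>W j\<close> is invariant under \<open>A i\<close>, hence
  under its flow, and \<open>W i = W j\<close> by injectivity.  This is the common invariant subspace to which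
  the rank condition applies.\<close>

lemma span_support_UNIV:
  assumes "lam > 0" "CARD('e) \<ge> 2" and P: "switching_matrix P"
    and larc: "lie_algebra_rank_condition (A :: 'e::finite \<Rightarrow> real^'d^'d::finite)"
    and \<mu>: "invariant_measure A P lam \<tau> \<mu>"
  shows "span {x. x \<noteq> 0 \<and> (to_proj x, i) \<in> measure_support \<mu>} = UNIV"
proof -
  define W where "W i = span {x. x \<noteq> 0 \<and> (to_proj x, i) \<in> measure_support \<mu>}" for i
  have sub: "subspace (W i)" for i by (simp add: W_def)
  have step: "mat_exp (t *\<^sub>R A i) *v x \<in> W j" if "\<tau> \<le> t" "i \<noteq> j" "x \<in> W i" for t i j x
  proof -
    have "(*v) (mat_exp (t *\<^sub>R A i)) ` {x. x \<noteq> 0 \<and> (to_proj x, i) \<in> measure_support \<mu>}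
        \<subseteq> {x. x \<noteq> 0 \<and> (to_proj x, j) \<in> measure_support \<mu>}"
      using support_flow_invariant[OF \<open>lam > 0\<close> P \<mu> _ that(1,2)] by (auto simp flip: proj_flow_to_proj)
    then have "span ((*v) (mat_exp (t *\<^sub>R A i)) ` {x. x \<noteq> 0 \<and> (to_proj x, i) \<in> measure_support \<mu>}) \<subseteq> W j"
      unfolding W_def by (rule span_mono)
    moreover have "span ((*v) (mat_exp (t *\<^sub>R A i)) ` {x. x \<noteq> 0 \<and> (to_proj x, i) \<in> measure_support \<mu>})
      = (*v) (mat_exp (t *\<^sub>R A i)) ` W i"
      unfolding W_def by (intro linear_span_image matrix_vector_mul_linear)
    ultimately show ?thesis using that(3) by auto
  qed
  have inj: "inj ((*v) (mat_exp (t *\<^sub>R A i)))" for t i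
    by (intro linear_injective_0[THEN iffD2] matrix_vector_mul_linear) auto
  have dim_im: "dim ((*v) (mat_exp (t *\<^sub>R A i)) ` S) = dim S" for t i and S :: "(real^'d) set"
    by (intro dim_image_eq matrix_vector_mul_linear inj_on_subset[OF inj]) auto
  have sub_im: "subspace ((*v) (mat_exp (t *\<^sub>R A i)) ` W j)" for t i j
    by (intro linear_subspace_image matrix_vector_mul_linear sub)
  have dim_le: "dim (W i) \<le> dim (W j)" for i j
  proof (cases "i = j")
    case False
    have "dim (W i) = dim ((*v) (mat_exp (\<tau> *\<^sub>R A i)) ` W i)" by (simp only: dim_im)
    also have "\<dots> \<le> dim (W j)" using step[OF order_refl False] by (intro dim_subset) auto
    finally show ?thesis .
  qed simp
  have image: "(*v) (mat_exp (t *\<^sub>R A i)) ` W i = W j" if "\<tau> \<le> t" "i \<noteq> j" for t i j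
    by (rule subspace_dim_equal[OF sub_im sub]) (use step[OF that] dim_le in \<open>auto simp: dim_im\<close>)
  have inv: "A i *v y \<in> W j" if ij: "i \<noteq> j" and y: "y \<in> W j" for i j y
  proof -
    obtain w where w: "w \<in> W i" "y = mat_exp ((\<tau> + 1) *\<^sub>R A i) *v w"
      using y image[of "\<tau> + 1" i j] ij by (auto simp: image_iff)
    have "eventually (\<lambda>s. s \<in> {\<tau><..}) (nhds (\<tau> + 1))" by (intro eventually_nhds_in_open) auto
    then have "eventually (\<lambda>s. mat_exp (s *\<^sub>R A i) *v w \<in> W j) (nhds (\<tau> + 1))"
      by eventually_elim (use step ij w in auto)
    from has_vector_derivative_in_subspace[OF sub mat_exp_has_vector_derivative this]
    show ?thesis using w by simp
  qed
  have eq: "W i = W j" if ij: "i \<noteq> j" for i j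
  proof -
    have "(*v) (mat_exp (\<tau> *\<^sub>R A i)) ` W j \<subseteq> W j"
      using mat_exp_mem_subspace[OF sub inv[OF ij]] by auto
    then have "(*v) (mat_exp (\<tau> *\<^sub>R A i)) ` W j = W j"
      by (intro subspace_dim_equal sub sub_im) (auto simp: dim_im)
    also have "\<dots> = (*v) (mat_exp (\<tau> *\<^sub>R A i)) ` W i" using image[of \<tau> i j] ij by simp
    finally show ?thesis using inj_image_eq_iff[OF inj] by blast
  qed
  have all_eq: "W i = W j" for i j using eq by (cases "i = j") auto
  have "A k *v y \<in> W i" if "y \<in> W i" for k y
  proof -
    obtain j where "k \<noteq> j" using exists_other_mode[OF \<open>CARD('e) \<ge> 2\<close>] by blast
    then show ?thesis using inv[of k j y] all_eq[of i j] that by simp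
  qed
  moreover have "W i \<noteq> {0}"
  proof -
    obtain q j where qj: "(q, j) \<in> measure_support \<mu>"
      using support_nonempty[OF invariant_measureD(1,2)[OF \<mu>]] by auto
    then have "proj_section q \<in> W j" unfolding W_def by (intro span_base) simp
    then show ?thesis using all_eq[of i j] proj_section_nonzero[of q] by auto
  qed
  ultimately have "W i = UNIV" using invariant_subspace_is_UNIV[OF larc sub] by blast
  then show ?thesis by (simp add: W_def)
qed

section \<open>The dwell-time distribution and the transition operator\<close>

lemma measurable_dwell_density [measurable]: "dwell_density lam \<tau> \<in> borel_measurable borel"
  unfolding dwell_density_def[abs_def] by measurable

text \<open>The exponential law with parameter \<open>lam\<close>, shifted by \<open>\<tau>\<close>.\<close>

definition dwell :: "real \<Rightarrow> real \<Rightarrow> real measure" where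
  "dwell lam \<tau> = density lborel (\<lambda>t. ennreal (dwell_density lam \<tau> t))"

lemma sets_dwell [measurable_cong, simp]: "sets (dwell lam \<tau>) = sets borel"
  by (simp add: dwell_def)

lemma space_dwell [simp]: "space (dwell lam \<tau>) = UNIV"
  by (simp add: dwell_def)

lemma AE_dwell: "AE t in dwell lam \<tau>. \<tau> \<le> t"
  unfolding dwell_def by (subst AE_density) (auto simp: dwell_density_def)

lemma dwell_moment:
  assumes "lam > 0"
  shows "(\<integral>\<^sup>+ t. ennreal ((t - \<tau>) ^ k) \<partial>dwell lam \<tau>) = ennreal (fact k / lam ^ k)"
proof -
  have "(\<integral>\<^sup>+ t. ennreal ((t - \<tau>) ^ k) \<partial>dwell lam \<tau>)
      = (\<integral>\<^sup>+ t. ennreal (dwell_density lam \<tau> t) * ennreal ((t - \<tau>) ^ k) \<partial>lborel)"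
    unfolding dwell_def by (rule nn_integral_density) auto
  also have "\<dots> = (\<integral>\<^sup>+ x. ennreal (dwell_density lam \<tau> (\<tau> + 1 * x)) * ennreal ((\<tau> + 1 * x - \<tau>) ^ k) \<partial>lborel)"
    by (subst nn_integral_real_affine[where c=1 and t=\<tau>]) auto
  also have "\<dots> = (\<integral>\<^sup>+ x. ennreal (erlang_density 0 lam x * x ^ k) \<partial>lborel)"
    using assms by (intro nn_integral_cong) (auto simp: dwell_density_def erlang_density_def ennreal_mult[symmetric])
  also have "\<dots> = ennreal (fact k / lam ^ k)"
    using nn_integral_erlang_ith_moment[OF assms, of 0 k] by simp
  finally show ?thesis .
qed

lemma prob_space_dwell: "lam > 0 \<Longrightarrow> prob_space (dwell lam \<tau>)"
  using dwell_moment[of lam \<tau> 0] by (intro prob_spaceI) simp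

lemma has_bochner_integral_dwell_moment:
  assumes "lam > 0"
  shows "has_bochner_integral (dwell lam \<tau>) (\<lambda>t. (t - \<tau>) ^ k) (fact k / lam ^ k)"
proof (rule has_bochner_integral_nn_integral)
  show "AE t in dwell lam \<tau>. 0 \<le> (t - \<tau>) ^ k" using AE_dwell by eventually_elim simp
qed (use assms dwell_moment[OF assms] in auto)

lemma integrable_dwell:
  assumes "lam > 0"
  shows "integrable (dwell lam \<tau>) (\<lambda>t. t)" "integrable (dwell lam \<tau>) (\<lambda>t. (1 + \<bar>t\<bar>)\<^sup>2)"
    "integrable (dwell lam \<tau>) (\<lambda>t. 1 + \<bar>t\<bar>)"
proof -
  interpret prob_space "dwell lam \<tau>" using prob_space_dwell[OF assms] .
  have 1: "integrable (dwell lam \<tau>) (\<lambda>t. t - \<tau>)"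
    using has_bochner_integral_dwell_moment[OF assms, of \<tau> 1] by (auto simp: has_bochner_integral_iff)
  from Bochner_Integration.integrable_add[OF 1 integrable_const[of \<tau>]]
  show i: "integrable (dwell lam \<tau>) (\<lambda>t. t)" by simp
  then show a: "integrable (dwell lam \<tau>) (\<lambda>t. 1 + \<bar>t\<bar>)" by auto
  have 2: "integrable (dwell lam \<tau>) (\<lambda>t. (t - \<tau>)\<^sup>2)"
    using has_bochner_integral_dwell_moment[OF assms, of \<tau> 2] by (auto simp: has_bochner_integral_iff)
  have "integrable (dwell lam \<tau>) (\<lambda>t. (t - \<tau>)\<^sup>2 + 2 * \<tau> * t + 2 * \<bar>t\<bar> + (1 - \<tau>\<^sup>2))"
    using 2 i by auto
  moreover have "(t - \<tau>)\<^sup>2 + 2 * \<tau> * t + 2 * \<bar>t\<bar> + (1 - \<tau>\<^sup>2) = (1 + \<bar>t\<bar>)\<^sup>2" for t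
    by (auto simp: power2_eq_square algebra_simps)
  ultimately show "integrable (dwell lam \<tau>) (\<lambda>t. (1 + \<bar>t\<bar>)\<^sup>2)" by simp
qed

lemma dwell_mean:
  assumes "lam > 0" shows "(\<integral>t. t \<partial>dwell lam \<tau>) = (\<tau> * lam + 1) / lam"
proof -
  interpret prob_space "dwell lam \<tau>" using prob_space_dwell[OF assms] .
  have "(\<integral>t. t - \<tau> \<partial>dwell lam \<tau>) = 1 / lam"
    using has_bochner_integral_dwell_moment[OF assms, of \<tau> 1] by (auto simp: has_bochner_integral_iff)
  then have "(\<integral>t. t \<partial>dwell lam \<tau>) = \<tau> + 1 / lam"
    using integrable_dwell(1)[OF assms] prob_space by simp
  then show ?thesis using assms by (simp add: field_simps)
qed

lemma measurable_proj_flow_mode [measurable (raw)]: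
  fixes f :: "'a \<Rightarrow> 'e::finite"
  assumes f: "f \<in> measurable M (count_space UNIV)" and "g \<in> borel_measurable M" "h \<in> borel_measurable M"
  shows "(\<lambda>x. proj_flow (A (f x)) (g x) (h x)) \<in> borel_measurable M"
  by (rule measurable_compose_countable'[OF _ f, of "\<lambda>i x. proj_flow (A i) (g x) (h x)"])
    (use assms in \<open>auto intro: countable_finite\<close>)

lemma measurable_log_growth_mode [measurable (raw)]:
  fixes f :: "'a \<Rightarrow> 'e::finite"
  assumes f: "f \<in> measurable M (count_space UNIV)" and "g \<in> borel_measurable M" "h \<in> borel_measurable M"
  shows "(\<lambda>x. log_growth (A (f x)) (g x) (h x)) \<in> borel_measurable M"
  by (rule measurable_compose_countable'[OF _ f, of "\<lambda>i x. log_growth (A i) (g x) (h x)"])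
    (use assms in \<open>auto intro: countable_finite\<close>)

text \<open>Conditional expectation of \<open>\<psi> (z, duration, next mode)\<close> given the current state \<open>z\<close>.\<close>

definition mean_step :: "('e::finite \<Rightarrow> 'e \<Rightarrow> real) \<Rightarrow> real \<Rightarrow> real
    \<Rightarrow> (('d::finite proj_space \<times> 'e) \<times> real \<times> 'e \<Rightarrow> real) \<Rightarrow> 'd proj_space \<times> 'e \<Rightarrow> real" where
  "mean_step P lam \<tau> \<psi> z = (\<Sum>j\<in>UNIV. P (snd z) j * (\<integral>t. \<psi> (z, t, j) \<partial>dwell lam \<tau>))"

abbreviation step_space :: "(('d::finite proj_space \<times> 'e::finite) \<times> real \<times> 'e) measure" where
  "step_space \<equiv> state_space \<Otimes>\<^sub>M (borel \<Otimes>\<^sub>M count_space UNIV)"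

definition next_state :: "('e::finite \<Rightarrow> real^'d^'d) \<Rightarrow> ('d::finite proj_space \<times> 'e) \<times> real \<times> 'e \<Rightarrow> 'd proj_space \<times> 'e" where
  "next_state A = (\<lambda>(z, t, j). (proj_flow (A (snd z)) t (fst z), j))"

lemma measurable_next_state [measurable]: "next_state A \<in> measurable step_space state_space"
  unfolding next_state_def by measurable

lemma measurable_mode_weight:
  fixes f g :: "'a \<Rightarrow> 'e::finite" and P :: "'e \<Rightarrow> 'e \<Rightarrow> real"
  assumes [measurable]: "f \<in> measurable M (count_space UNIV)" "g \<in> measurable M (count_space UNIV)"
  shows "(\<lambda>x. P (f x) (g x)) \<in> borel_measurable M"
proof -
  have "(\<lambda>x. P i (g x)) \<in> borel_measurable M" for i
    by (rule measurable_compose_countable'[OF _ assms(2), of "\<lambda>j x. P i j"]) (auto intro: countable_finite)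
  then show ?thesis
    by (intro measurable_compose_countable'[OF _ assms(1), of "\<lambda>i x. P i (g x)"]) (auto intro: countable_finite)
qed

lemma measurable_mean_step [measurable]:
  assumes "lam > 0" and [measurable]: "\<psi> \<in> borel_measurable step_space"
  shows "mean_step P lam \<tau> \<psi> \<in> borel_measurable state_space"
proof -
  interpret prob_space "dwell lam \<tau>" using prob_space_dwell[OF assms(1)] .
  note [measurable (raw)] = measurable_mode_weight[where P=P]
  show ?thesis unfolding mean_step_def[abs_def] by measurable
qed

context
  fixes A :: "'e::finite \<Rightarrow> real^'d^'d::finite" and P :: "'e \<Rightarrow> 'e \<Rightarrow> real" and lam \<tau> :: real
    and \<mu> :: "('d proj_space \<times> 'e) measure"
  assumes lam: "lam > 0" and P: "switching_matrix P" and \<mu>: "invariant_measure A P lam \<tau> \<mu>"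
begin

lemmas [measurable (raw)] = measurable_mode_weight[where P=P]

text \<open>Invariance as an identity between \<open>\<mu>\<close> and an image measure: this form passes from sets to
  integrals of functions.\<close>

lemma invariant_measure_distr:
  "\<mu> = distr (density (\<mu> \<Otimes>\<^sub>M (dwell lam \<tau> \<Otimes>\<^sub>M count_space UNIV)) (\<lambda>x. ennreal (P (snd (fst x)) (snd (snd x)))))
      state_space (next_state A)"
proof (rule measure_eqI)
  note [measurable_cong, simp] = invariant_measureD(2)[OF \<mu>]
  interpret d: prob_space "dwell lam \<tau>" using prob_space_dwell[OF lam] .
  interpret c: sigma_finite_measure "count_space (UNIV :: 'e set)"
    by (rule sigma_finite_measure_count_space_finite) simp
  interpret dc: pair_sigma_finite "dwell lam \<tau>" "count_space (UNIV :: 'e set)" ..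
  fix B assume "B \<in> sets \<mu>"
  then have B [measurable]: "B \<in> sets state_space" by simp
  have "emeasure \<mu> B = (\<integral>\<^sup>+ z. transition_prob A P lam \<tau> z B \<partial>\<mu>)" by (rule invariant_measureD(3)[OF \<mu> B])
  also have "\<dots> = (\<integral>\<^sup>+ z. \<integral>\<^sup>+ y. ennreal (P (snd z) (snd y)) * indicator B (next_state A (z, y))
      \<partial>(dwell lam \<tau> \<Otimes>\<^sub>M count_space UNIV) \<partial>\<mu>)"
  proof (intro nn_integral_cong)
    fix z
    have "transition_prob A P lam \<tau> z B = (\<Sum>j\<in>UNIV. ennreal (P (snd z) j) *
        (\<integral>\<^sup>+ t. indicator B (next_state A (z, t, j)) \<partial>dwell lam \<tau>))"
      unfolding transition_prob_def dwell_def next_state_def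
      by (auto simp: nn_integral_density case_prod_beta mult.commute)
    also have "\<dots> = (\<integral>\<^sup>+ j. \<integral>\<^sup>+ t. ennreal (P (snd z) j) * indicator B (next_state A (z, t, j)) \<partial>dwell lam \<tau> \<partial>count_space UNIV)"
      by (simp add: nn_integral_count_space_finite nn_integral_cmult)
    also have "\<dots> = (\<integral>\<^sup>+ y. ennreal (P (snd z) (snd y)) * indicator B (next_state A (z, y)) \<partial>(dwell lam \<tau> \<Otimes>\<^sub>M count_space UNIV))"
      by (subst dc.nn_integral_snd[symmetric]) (auto simp: case_prod_beta)
    finally show "transition_prob A P lam \<tau> z B = \<dots>" .
  qed
  also have "\<dots> = (\<integral>\<^sup>+ x. ennreal (P (snd (fst x)) (snd (snd x))) * indicator B (next_state A x)
      \<partial>(\<mu> \<Otimes>\<^sub>M (dwell lam \<tau> \<Otimes>\<^sub>M count_space UNIV)))"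
    by (subst dc.nn_integral_fst[symmetric]) auto
  also have "\<dots> = (\<integral>\<^sup>+ y. indicator B y \<partial>distr (density (\<mu> \<Otimes>\<^sub>M (dwell lam \<tau> \<Otimes>\<^sub>M count_space UNIV))
      (\<lambda>x. ennreal (P (snd (fst x)) (snd (snd x))))) state_space (next_state A))"
    by (subst nn_integral_distr, simp, simp, subst nn_integral_density) simp_all
  also have "\<dots> = emeasure (distr (density (\<mu> \<Otimes>\<^sub>M (dwell lam \<tau> \<Otimes>\<^sub>M count_space UNIV))
      (\<lambda>x. ennreal (P (snd (fst x)) (snd (snd x))))) state_space (next_state A)) B"
    by (rule nn_integral_indicator) simp
  finally show "emeasure \<mu> B = \<dots>" .
qed (simp add: invariant_measureD(2)[OF \<mu>])

lemma integral_mean_step: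
  assumes [measurable]: "\<phi> \<in> borel_measurable state_space" and b: "\<And>z. \<bar>\<phi> z\<bar> \<le> C"
  shows "(\<integral>z. mean_step P lam \<tau> (\<lambda>x. \<phi> (next_state A x)) z \<partial>\<mu>) = (\<integral>z. \<phi> z \<partial>\<mu>)"
proof -
  note [measurable_cong, simp] = invariant_measureD(2)[OF \<mu>]
  interpret m: prob_space \<mu> using invariant_measureD(1)[OF \<mu>] .
  interpret d: prob_space "dwell lam \<tau>" using prob_space_dwell[OF lam] .
  interpret c: finite_measure "count_space (UNIV :: 'e set)"
    by (rule finite_measure_count_space) simp
  interpret dc: pair_sigma_finite "dwell lam \<tau>" "count_space (UNIV :: 'e set)" ..
  interpret dcf: finite_measure "dwell lam \<tau> \<Otimes>\<^sub>M count_space (UNIV :: 'e set)"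
    by (intro finite_measure_pair_measure) unfold_locales
  interpret mdc: pair_sigma_finite \<mu> "dwell lam \<tau> \<Otimes>\<^sub>M count_space (UNIV :: 'e set)" ..
  interpret mdcf: finite_measure "\<mu> \<Otimes>\<^sub>M (dwell lam \<tau> \<Otimes>\<^sub>M count_space (UNIV :: 'e set))"
    by (intro finite_measure_pair_measure) unfold_locales
  have Pb: "\<bar>P i j * \<phi> z\<bar> \<le> C" for i j z
  proof -
    have "\<bar>P i j * \<phi> z\<bar> \<le> 1 * C"
      unfolding abs_mult using switching_matrixD(4,5)[OF P] b by (intro mult_mono) auto
    then show ?thesis by simp
  qed
  have "(\<integral>z. \<phi> z \<partial>\<mu>) = (\<integral>x. P (snd (fst x)) (snd (snd x)) * \<phi> (next_state A x)
      \<partial>(\<mu> \<Otimes>\<^sub>M (dwell lam \<tau> \<Otimes>\<^sub>M count_space UNIV)))"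
    by (subst invariant_measure_distr) (simp add: integral_distr integral_density case_prod_beta switching_matrixD(4)[OF P])
  also have "\<dots> = (\<integral>z. \<integral>y. P (snd z) (snd y) * \<phi> (next_state A (z, y)) \<partial>(dwell lam \<tau> \<Otimes>\<^sub>M count_space UNIV) \<partial>\<mu>)"
    by (subst mdc.integral_fst'[symmetric]) (auto intro!: mdcf.integrable_const_bound[where B=C] Pb)
  also have "\<dots> = (\<integral>z. mean_step P lam \<tau> (\<lambda>x. \<phi> (next_state A x)) z \<partial>\<mu>)"
  proof (intro Bochner_Integration.integral_cong refl)
    fix z :: "'d proj_space \<times> 'e"
    have i: "integrable (dwell lam \<tau>) (\<lambda>t. \<phi> (next_state A (z, t, j)))" for j
      by (intro d.integrable_const_bound[where B=C]) (auto simp: b)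
    have "(\<integral>y. P (snd z) (snd y) * \<phi> (next_state A (z, y)) \<partial>(dwell lam \<tau> \<Otimes>\<^sub>M count_space UNIV))
      = (\<integral>j. \<integral>t. P (snd z) j * \<phi> (next_state A (z, t, j)) \<partial>dwell lam \<tau> \<partial>count_space UNIV)"
      using dc.integral_snd[of "\<lambda>t j. P (snd z) j * \<phi> (next_state A (z, t, j))"]
      by (simp add: case_prod_unfold dcf.integrable_const_bound[where B=C] Pb)
    then show "(\<integral>y. P (snd z) (snd y) * \<phi> (next_state A (z, y)) \<partial>(dwell lam \<tau> \<Otimes>\<^sub>M count_space UNIV))
      = mean_step P lam \<tau> (\<lambda>x. \<phi> (next_state A x)) z"
      by (simp add: lebesgue_integral_count_space_finite mean_step_def)
  qed
  finally show ?thesis ..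
qed

end

lemma mean_step_bounded:
  fixes \<psi> :: "('d::finite proj_space \<times> 'e::finite) \<times> real \<times> 'e \<Rightarrow> real"
  assumes lam: "lam > 0" and P: "switching_matrix P"
    and b: "\<And>x. 0 \<le> \<psi> x" "\<And>x. \<psi> x \<le> 1"
  shows "0 \<le> mean_step P lam \<tau> \<psi> z" "mean_step P lam \<tau> \<psi> z \<le> 1"
proof -
  interpret d: prob_space "dwell lam \<tau>" using prob_space_dwell[OF lam] .
  show "0 \<le> mean_step P lam \<tau> \<psi> z"
    unfolding mean_step_def using switching_matrixD(4)[OF P] b by (intro sum_nonneg mult_nonneg_nonneg Bochner_Integration.integral_nonneg) auto
  have *: "(\<integral>t. \<psi> (z, t, j) \<partial>dwell lam \<tau>) \<le> 1" for j
  proof (cases "integrable (dwell lam \<tau>) (\<lambda>t. \<psi> (z, t, j))")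
    case True
    then have "(\<integral>t. \<psi> (z, t, j) \<partial>dwell lam \<tau>) \<le> (\<integral>t. 1 \<partial>dwell lam \<tau>)"
      by (intro integral_mono) (auto simp: b)
    then show ?thesis using d.prob_space by simp
  qed (simp add: not_integrable_integral_eq)
  have "mean_step P lam \<tau> \<psi> z \<le> (\<Sum>j\<in>UNIV. P (snd z) j * 1)"
    unfolding mean_step_def using * switching_matrixD(4)[OF P] by (intro sum_mono mult_left_mono) auto
  then show "mean_step P lam \<tau> \<psi> z \<le> 1" using switching_matrixD(1)[OF P] by simp
qed

section \<open>The Markov property of the switching process\<close>

locale standard_switching_process = switching_process M A P lam \<tau> U Q L
  for M :: "'w measure"
    and A :: "'e::finite \<Rightarrow> real^'d^'d::finite" and P :: "'e \<Rightarrow> 'e \<Rightarrow> real" and lam \<tau> :: real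
    and U :: "nat \<Rightarrow> 'w \<Rightarrow> real" and Q :: "nat \<Rightarrow> 'w \<Rightarrow> 'd proj_space" and L :: "nat \<Rightarrow> 'w \<Rightarrow> 'e" +
  assumes lam_pos: "lam > 0" and switching: "switching_matrix P"
begin

sublocale dwell: prob_space "dwell lam \<tau>"
  by (rule prob_space_dwell[OF lam_pos])

declare One_nat_def [simp del]

lemmas [measurable (raw)] = measurable_mode_weight[where P=P]

lemma measurable_mode [measurable]: "L n \<in> measurable M (count_space UNIV)"
  by (rule modes_measurable)

lemma measurable_duration: "n \<ge> 1 \<Longrightarrow> U n \<in> borel_measurable M"
  using distributed_measurable[OF durations_density[of n]] by simp

lemma measurable_duration_Suc [measurable]: "U (Suc n) \<in> borel_measurable M"
  by (rule measurable_duration) simp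

lemma distr_duration: "distr M borel (U (Suc n)) = dwell lam \<tau>"
proof -
  have "distr M borel (U (Suc n)) = distr M lborel (U (Suc n))" by (rule distr_cong) auto
  then show ?thesis using distributed_distr_eq_density[OF durations_density[of "Suc n"]] by (simp add: dwell_def)
qed

definition durations :: "'w \<Rightarrow> nat \<Rightarrow> real" where
  "durations = (\<lambda>\<omega>. \<lambda>k\<in>{1..}. U k \<omega>)"

lemma measurable_durations [measurable]: "durations \<in> measurable M (PiM {1..} (\<lambda>_. borel))"
  unfolding durations_def by (intro measurable_restrict) (auto intro: measurable_duration)

definition past_space :: "nat \<Rightarrow> ((nat \<Rightarrow> 'e) \<times> (nat \<Rightarrow> real)) measure" where
  "past_space n = PiM {..n} (\<lambda>_. count_space UNIV) \<Otimes>\<^sub>M PiM {1..n} (\<lambda>_. borel)"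

definition past :: "nat \<Rightarrow> 'w \<Rightarrow> (nat \<Rightarrow> 'e) \<times> (nat \<Rightarrow> real)" where
  "past n \<omega> = (\<lambda>i\<in>{..n}. L i \<omega>, \<lambda>i\<in>{1..n}. U i \<omega>)"

lemma measurable_past [measurable]: "past n \<in> measurable M (past_space n)"
  unfolding past_def past_space_def
  by (intro measurable_Pair measurable_restrict) (auto intro: measurable_duration)

abbreviation history :: "nat \<Rightarrow> 'w measure" where
  "history n \<equiv> vimage_algebra (space M)
          (\<lambda>\<omega>. (Q 0 \<omega>, (\<lambda>k\<in>{..n}. L k \<omega>), (\<lambda>k\<in>{1..}. U k \<omega>)))
          (borel \<Otimes>\<^sub>M PiM {..n} (\<lambda>_. count_space UNIV) \<Otimes>\<^sub>M PiM {1..} (\<lambda>_. borel))"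

lemma measurable_history_map:
  "(\<lambda>\<omega>. (Q 0 \<omega>, (\<lambda>k\<in>{..n}. L k \<omega>), (\<lambda>k\<in>{1..}. U k \<omega>))) \<in>
    measurable M (borel \<Otimes>\<^sub>M PiM {..n} (\<lambda>_. count_space UNIV) \<Otimes>\<^sub>M PiM {1..} (\<lambda>_. borel))"
proof -
  have "Q 0 \<in> borel_measurable M"
    using measurable_compose[OF initial_measurable measurable_fst] by simp
  then show ?thesis
    by (intro measurable_Pair measurable_durations[unfolded durations_def] measurable_restrict) auto
qed

lemma measurable_history:
  assumes "h \<in> measurable (borel \<Otimes>\<^sub>M PiM {..n} (\<lambda>_. count_space UNIV) \<Otimes>\<^sub>M PiM {1..} (\<lambda>_. borel)) N"
  shows "(\<lambda>\<omega>. h (Q 0 \<omega>, (\<lambda>k\<in>{..n}. L k \<omega>), (\<lambda>k\<in>{1..}. U k \<omega>))) \<in> measurable (history n) N"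
proof -
  have "(\<lambda>\<omega>. (Q 0 \<omega>, (\<lambda>k\<in>{..n}. L k \<omega>), (\<lambda>k\<in>{1..}. U k \<omega>))) \<in> space M \<rightarrow>
      space (borel \<Otimes>\<^sub>M PiM {..n} (\<lambda>_. count_space UNIV) \<Otimes>\<^sub>M PiM {1..} (\<lambda>_. borel))"
    using measurable_space[OF measurable_history_map] by auto
  from measurable_compose[OF measurable_vimage_algebra1[OF this] assms] show ?thesis .
qed

text \<open>The defining property of the conditional expectation, for test functions of the history.\<close>

lemma integral_next_mode:
  assumes f: "f \<in> borel_measurable (history n)" and int: "integrable M f"
  shows "(\<integral>\<omega>. f \<omega> * indicator {\<omega> \<in> space M. L (Suc n) \<omega> = j} \<omega> \<partial>M) = (\<integral>\<omega>. f \<omega> * P (L n \<omega>) j \<partial>M)"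
proof -
  interpret sub: finite_measure_subalgebra M "history n"
  proof
    have map: "(\<lambda>\<omega>. (Q 0 \<omega>, (\<lambda>k\<in>{..n}. L k \<omega>), (\<lambda>k\<in>{1..}. U k \<omega>))) \<in> space M \<rightarrow>
        space (borel \<Otimes>\<^sub>M PiM {..n} (\<lambda>_. count_space UNIV) \<Otimes>\<^sub>M PiM {1..} (\<lambda>_. borel))"
      using measurable_space[OF measurable_history_map] by blast
    show "subalgebra M (history n)"
      unfolding subalgebra_def
    proof
      show "sets (history n) \<subseteq> events"
        unfolding sets_vimage_algebra2[OF map] using measurable_sets[OF measurable_history_map] by blast
    qed simp
  qed
  have fM [measurable]: "f \<in> borel_measurable M" by (rule measurable_from_subalg[OF sub.subalg f])
  have ind [measurable]: "indicator {\<omega> \<in> space M. L (Suc n) \<omega> = j} \<in> borel_measurable M" by measurable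
  have "(\<integral>\<omega>. f \<omega> * indicator {\<omega> \<in> space M. L (Suc n) \<omega> = j} \<omega> \<partial>M) =
      (\<integral>\<omega>. f \<omega> * real_cond_exp M (history n) (indicator {\<omega> \<in> space M. L (Suc n) \<omega> = j}) \<omega> \<partial>M)"
    by (rule sub.real_cond_exp_intg(2)[symmetric])
      (use f ind integrable_real_mult_indicator[OF _ int, of "{\<omega> \<in> space M. L (Suc n) \<omega> = j}"] in auto)
  also have "\<dots> = (\<integral>\<omega>. f \<omega> * P (L n \<omega>) j \<partial>M)"
    using modes_transition[of n j] by (intro integral_cong_AE) auto
  finally show ?thesis .
qed

definition mode_path :: "nat \<Rightarrow> (nat \<Rightarrow> 'e) \<Rightarrow> 'w set" where
  "mode_path n w = {\<omega> \<in> space M. \<forall>i\<in>{..n}. L i \<omega> = w i}"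

lemma mode_path_sets [measurable]: "mode_path n w \<in> sets M"
  unfolding mode_path_def by measurable

text \<open>The path of modes is independent of all durations: the initial mode is, and each further mode
  multiplies the probability of an event about the past and the durations by the same number \<open>P i j\<close>.\<close>

lemma prob_mode_path_durations:
  assumes D [measurable]: "D \<in> sets (PiM {1..} (\<lambda>_. borel))"
  shows "prob (mode_path n w \<inter> durations -` D \<inter> space M)
    = prob (mode_path n w) * prob (durations -` D \<inter> space M)"
  using D
proof (induction n arbitrary: D)
  case 0
  let ?S = "(\<lambda>\<omega>. (Q 0 \<omega>, L 0 \<omega>)) -` (UNIV \<times> {w 0}) \<inter> space M"
  have "?S \<in> sets (vimage_algebra (space M) (\<lambda>\<omega>. (Q 0 \<omega>, L 0 \<omega>)) state_space)"
    by (rule in_vimage_algebra) auto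
  moreover have "durations -` D \<inter> space M \<in>
      sets (vimage_algebra (space M) (\<lambda>\<omega>. \<lambda>k\<in>{1..}. U k \<omega>) (PiM {1..} (\<lambda>_. borel)))"
    unfolding durations_def by (rule in_vimage_algebra) (rule 0)
  ultimately have "prob (?S \<inter> (durations -` D \<inter> space M)) =
      prob ?S * prob (durations -` D \<inter> space M)"
    unfolding durations_def by (rule indep_setD[OF initial_indep])
  moreover have "?S = mode_path 0 w" by (auto simp: mode_path_def)
  ultimately show ?case by (simp add: Int_assoc)
next
  case (Suc n)
  have step: "prob (mode_path (Suc n) w \<inter> durations -` D \<inter> space M)
      = P (w n) (w (Suc n)) * prob (mode_path n w \<inter> durations -` D \<inter> space M)"
    if D [measurable]: "D \<in> sets (PiM {1..} (\<lambda>_. borel))" for D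
  proof -
    define E where "E = mode_path n w \<inter> durations -` D \<inter> space M"
    define J where "J = {\<omega> \<in> space M. L (Suc n) \<omega> = w (Suc n)}"
    have E: "E \<in> sets M" unfolding E_def by measurable
    have J: "J \<in> sets M" unfolding J_def by measurable
    define W where "W = {l \<in> space (PiM {..n} (\<lambda>_. count_space UNIV)). \<forall>i\<in>{..n}. l i = w i}"
    have W [measurable]: "W \<in> sets (PiM {..n} (\<lambda>_. count_space UNIV))" unfolding W_def by measurable
    have hm: "(\<lambda>x. indicator W (fst (snd x)) * indicator D (snd (snd x)) :: real) \<in> borel_measurable
        (borel \<Otimes>\<^sub>M PiM {..n} (\<lambda>_. count_space UNIV) \<Otimes>\<^sub>M PiM {1..} (\<lambda>_. borel))"
      by measurable
    have "(\<lambda>\<omega>. indicator W (\<lambda>k\<in>{..n}. L k \<omega>) * indicator D (durations \<omega>) :: real) \<in> borel_measurable (history n)"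
      using measurable_history[OF hm] by (simp add: durations_def)
    moreover have "indicator W (\<lambda>k\<in>{..n}. L k \<omega>) * indicator D (durations \<omega>) = (indicator E \<omega> :: real)"
      if "\<omega> \<in> space (history n)" for \<omega>
      using that by (simp add: E_def W_def mode_path_def indicator_def space_PiM)
    ultimately have f: "(indicator E :: 'w \<Rightarrow> real) \<in> borel_measurable (history n)"
      using measurable_cong[of "history n" "\<lambda>\<omega>. indicator W (\<lambda>k\<in>{..n}. L k \<omega>) * indicator D (durations \<omega>)" "indicator E"]
      by blast
    have "(\<integral>\<omega>. indicator E \<omega> * indicator J \<omega> \<partial>M) = (\<integral>\<omega>. indicator E \<omega> * P (L n \<omega>) (w (Suc n)) \<partial>M)"
      unfolding J_def by (rule integral_next_mode[OF f])
        (use E in \<open>auto intro!: integrable_const_bound[where B=1] simp: indicator_def\<close>)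
    moreover have "(\<lambda>\<omega>. indicator E \<omega> * P (L n \<omega>) (w (Suc n))) = (\<lambda>\<omega>. P (w n) (w (Suc n)) * indicator E \<omega>)"
    proof
      fix \<omega> show "indicator E \<omega> * P (L n \<omega>) (w (Suc n)) = P (w n) (w (Suc n)) * indicator E \<omega>"
        by (cases "\<omega> \<in> E") (simp_all add: E_def mode_path_def)
    qed
    moreover have "(\<lambda>\<omega>. indicator E \<omega> * indicator J \<omega> :: real) = indicator (E \<inter> J)"
      by (simp add: fun_eq_iff indicator_inter_arith)
    ultimately have "prob (E \<inter> J) = P (w n) (w (Suc n)) * prob E"
      using E J by simp
    moreover have "E \<inter> J = mode_path (Suc n) w \<inter> durations -` D \<inter> space M"
      unfolding E_def J_def mode_path_def atMost_Suc by blast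
    ultimately show ?thesis unfolding E_def by simp
  qed
  have "space (PiM {1..} (\<lambda>_. borel :: real measure)) \<in> sets (PiM {1..} (\<lambda>_. borel))" by simp
  moreover have "mode_path k w \<inter> durations -` space (PiM {1..} (\<lambda>_. borel)) \<inter> space M = mode_path k w" for k
  proof -
    have "\<omega> \<in> durations -` space (PiM {1..} (\<lambda>_. borel))" if "\<omega> \<in> space M" for \<omega>
      using measurable_space[OF measurable_durations that] by simp
    then show ?thesis unfolding mode_path_def by blast
  qed
  ultimately have "prob (mode_path (Suc n) w) = P (w n) (w (Suc n)) * prob (mode_path n w)"
    using step by metis
  then show ?case using step[OF Suc.prems] Suc.IH[OF Suc.prems] by simp
qed

lemma nn_integral_mode_path_durations:
  assumes h [measurable]: "h \<in> borel_measurable (PiM {1..} (\<lambda>_. borel))"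
  shows "(\<integral>\<^sup>+ \<omega>. indicator (mode_path n w) \<omega> * h (durations \<omega>) \<partial>M)
    = ennreal (prob (mode_path n w)) * (\<integral>\<^sup>+ \<omega>. h (durations \<omega>) \<partial>M)"
proof -
  let ?S = "PiM {1..} (\<lambda>_. borel :: real measure)"
  have "distr (density M (indicator (mode_path n w))) ?S durations
      = scale_measure (ennreal (prob (mode_path n w))) (distr M ?S durations)"
  proof (rule measure_eqI)
    fix D assume "D \<in> sets (distr (density M (indicator (mode_path n w))) ?S durations)"
    then have D [measurable]: "D \<in> sets ?S" by simp
    have m: "durations -` D \<inter> space M \<in> sets M" by measurable
    have "emeasure (distr (density M (indicator (mode_path n w))) ?S durations) D
        = emeasure M (mode_path n w \<inter> (durations -` D \<inter> space M))"
      using m by (subst emeasure_distr) (auto intro!: emeasure_restricted)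
    also have "\<dots> = ennreal (prob (mode_path n w)) * emeasure M (durations -` D \<inter> space M)"
      using prob_mode_path_durations[OF D] by (simp add: emeasure_eq_measure ennreal_mult Int_assoc)
    finally show "emeasure (distr (density M (indicator (mode_path n w))) ?S durations) D
        = emeasure (scale_measure (ennreal (prob (mode_path n w))) (distr M ?S durations)) D"
      by (simp add: emeasure_distr)
  qed simp
  from arg_cong[OF this, of "\<lambda>m. \<integral>\<^sup>+ u. h u \<partial>m"] show ?thesis
    by (simp add: nn_integral_distr nn_integral_density nn_integral_scale_measure)
qed

lemma nn_integral_next_duration:
  assumes [measurable]: "h \<in> borel_measurable (PiM {1..n} (\<lambda>_. borel) \<Otimes>\<^sub>M borel)"
  shows "(\<integral>\<^sup>+ \<omega>. h (\<lambda>i\<in>{1..n}. U i \<omega>, U (Suc n) \<omega>) \<partial>M)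
    = (\<integral>\<^sup>+ \<omega>. \<integral>\<^sup>+ t. h (\<lambda>i\<in>{1..n}. U i \<omega>, t) \<partial>dwell lam \<tau> \<partial>M)"
proof -
  have [measurable]: "(\<lambda>\<omega>. \<lambda>i\<in>{1..n}. U i \<omega>) \<in> measurable M (PiM {1..n} (\<lambda>_. borel))"
    by (intro measurable_restrict) (auto intro: measurable_duration)
  let ?X = "\<lambda>\<omega>. \<lambda>i\<in>{1..n}. U i \<omega>" and ?SX = "PiM {1..n} (\<lambda>_. borel) :: (nat \<Rightarrow> real) measure"
  let ?Y = "\<lambda>\<omega>. \<lambda>i\<in>{Suc n}. U i \<omega>" and ?SY = "PiM {Suc n} (\<lambda>_. borel) :: (nat \<Rightarrow> real) measure"
  have [measurable]: "?Y \<in> measurable M ?SY"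
    by (intro measurable_restrict) (auto intro: measurable_duration)
  have c [measurable]: "(\<lambda>y. y (Suc n)) \<in> measurable ?SY borel"
    by (rule measurable_component_singleton) simp
  have h' [measurable]: "(\<lambda>p. h (fst p, snd p (Suc n))) \<in> borel_measurable (?SX \<Otimes>\<^sub>M ?SY)" by measurable
  have h'' [measurable]: "(\<lambda>x. h (x, U (Suc n) \<omega>)) \<in> borel_measurable ?SX" for \<omega> by measurable
  have h3: "(\<lambda>t. h (x, t)) \<in> borel_measurable borel" if "x \<in> space ?SX" for x using that by measurable
  have h4: "(\<lambda>y. h (x, y (Suc n))) \<in> borel_measurable ?SY" if "x \<in> space ?SX" for x using that by measurable
  interpret Y: prob_space "distr M ?SY ?Y" by (rule prob_space_distr) measurable
  have "indep_var ?SX ?X ?SY ?Y"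
    by (rule indep_var_restrict[OF durations_indep]) auto
  then have joint: "distr M (?SX \<Otimes>\<^sub>M ?SY) (\<lambda>\<omega>. (?X \<omega>, ?Y \<omega>)) = distr M ?SX ?X \<Otimes>\<^sub>M distr M ?SY ?Y"
    unfolding indep_var_distribution_eq by simp
  have "(\<integral>\<^sup>+ \<omega>. h (?X \<omega>, U (Suc n) \<omega>) \<partial>M) = (\<integral>\<^sup>+ p. h (fst p, snd p (Suc n)) \<partial>distr M (?SX \<Otimes>\<^sub>M ?SY) (\<lambda>\<omega>. (?X \<omega>, ?Y \<omega>)))"
    by (subst nn_integral_distr) auto
  also have "\<dots> = (\<integral>\<^sup>+ x. \<integral>\<^sup>+ y. h (x, y (Suc n)) \<partial>distr M ?SY ?Y \<partial>distr M ?SX ?X)"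
    unfolding joint by (subst Y.nn_integral_fst[symmetric]) (use h' in \<open>auto cong: measurable_cong_sets sets_pair_measure_cong\<close>)
  also have "\<dots> = (\<integral>\<^sup>+ x. \<integral>\<^sup>+ t. h (x, t) \<partial>dwell lam \<tau> \<partial>distr M ?SX ?X)"
  proof (intro nn_integral_cong)
    fix x assume "x \<in> space (distr M ?SX ?X)"
    then have x: "x \<in> space ?SX" by simp
    have "(\<integral>\<^sup>+ y. h (x, y (Suc n)) \<partial>distr M ?SY ?Y) = (\<integral>\<^sup>+ \<omega>. h (x, U (Suc n) \<omega>) \<partial>M)"
      by (subst nn_integral_distr) (use h4[OF x] in auto)
    also have "\<dots> = (\<integral>\<^sup>+ t. h (x, t) \<partial>distr M borel (U (Suc n)))"
      by (subst nn_integral_distr) (use h3[OF x] in auto)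
    finally show "(\<integral>\<^sup>+ y. h (x, y (Suc n)) \<partial>distr M ?SY ?Y) = (\<integral>\<^sup>+ t. h (x, t) \<partial>dwell lam \<tau>)"
      by (simp add: distr_duration)
  qed
  also have "\<dots> = (\<integral>\<^sup>+ \<omega>. \<integral>\<^sup>+ t. h (?X \<omega>, t) \<partial>dwell lam \<tau> \<partial>M)"
    by (subst nn_integral_distr) auto
  finally show ?thesis .
qed

text \<open>There are finitely many mode paths up to time \<open>n\<close>; on each of them the durations may be integrated as
  if the path were deterministic.\<close>

lemma nn_integral_past_next_duration:
  assumes F [measurable]: "F \<in> borel_measurable (past_space n \<Otimes>\<^sub>M borel)"
  shows "(\<integral>\<^sup>+ \<omega>. F (past n \<omega>, U (Suc n) \<omega>) \<partial>M) = (\<integral>\<^sup>+ \<omega>. \<integral>\<^sup>+ t. F (past n \<omega>, t) \<partial>dwell lam \<tau> \<partial>M)"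
proof -
  let ?W = "PiE {..n} (\<lambda>_. UNIV :: 'e set)"
  have fin: "finite ?W" by (intro finite_PiE) auto
  \<comment> \<open>Decomposition of an expectation according to the mode path.\<close>
  have split: "(\<integral>\<^sup>+ \<omega>. g (past n \<omega>) \<omega> \<partial>M) = (\<Sum>w\<in>?W. \<integral>\<^sup>+ \<omega>. indicator (mode_path n w) \<omega> * g (w, \<lambda>i\<in>{1..n}. U i \<omega>) \<omega> \<partial>M)"
    if [measurable]: "\<And>w. w \<in> ?W \<Longrightarrow> (\<lambda>\<omega>. g (w, \<lambda>i\<in>{1..n}. U i \<omega>) \<omega>) \<in> borel_measurable M" for g :: "_ \<Rightarrow> 'w \<Rightarrow> ennreal"
  proof -
    have "g (past n \<omega>) \<omega> = (\<Sum>w\<in>?W. indicator (mode_path n w) \<omega> * g (w, \<lambda>i\<in>{1..n}. U i \<omega>) \<omega>)" if "\<omega> \<in> space M" for \<omega>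
    proof -
      have "indicator (mode_path n w) \<omega> = (if w = (\<lambda>i\<in>{..n}. L i \<omega>) then 1 else 0 :: ennreal)" if "w \<in> ?W" for w
      proof -
        have "w = (\<lambda>i\<in>{..n}. L i \<omega>)" if "\<forall>i\<in>{..n}. L i \<omega> = w i"
          using PiE_restrict[OF \<open>w \<in> ?W\<close>] that by (metis restrict_ext)
        then have "(\<forall>i\<in>{..n}. L i \<omega> = w i) \<longleftrightarrow> w = (\<lambda>i\<in>{..n}. L i \<omega>)" by auto
        then show ?thesis using \<open>\<omega> \<in> space M\<close> by (simp add: mode_path_def indicator_def)
      qed
      then have "(\<Sum>w\<in>?W. indicator (mode_path n w) \<omega> * g (w, \<lambda>i\<in>{1..n}. U i \<omega>) \<omega>)
          = (\<Sum>w\<in>?W. if w = (\<lambda>i\<in>{..n}. L i \<omega>) then g (w, \<lambda>i\<in>{1..n}. U i \<omega>) \<omega> else 0)"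
        by (intro sum.cong) auto
      also have "\<dots> = g (past n \<omega>) \<omega>" using fin by (simp add: sum.delta' past_def)
      finally show ?thesis ..
    qed
    then have "(\<integral>\<^sup>+ \<omega>. g (past n \<omega>) \<omega> \<partial>M) = (\<integral>\<^sup>+ \<omega>. (\<Sum>w\<in>?W. indicator (mode_path n w) \<omega> * g (w, \<lambda>i\<in>{1..n}. U i \<omega>) \<omega>) \<partial>M)"
      by (intro nn_integral_cong) auto
    also have "\<dots> = (\<Sum>w\<in>?W. \<integral>\<^sup>+ \<omega>. indicator (mode_path n w) \<omega> * g (w, \<lambda>i\<in>{1..n}. U i \<omega>) \<omega> \<partial>M)"
      by (intro nn_integral_sum) measurable
    finally show ?thesis .
  qed
  have Fw [measurable]: "(\<lambda>x. F ((w, fst x), snd x)) \<in> borel_measurable (PiM {1..n} (\<lambda>_. borel) \<Otimes>\<^sub>M borel)" if "w \<in> ?W" for w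
  proof -
    have "w \<in> space (PiM {..n} (\<lambda>_. count_space UNIV))" using that by (simp add: space_PiM)
    then have "(\<lambda>x. ((w, fst x), snd x)) \<in> measurable (PiM {1..n} (\<lambda>_. borel) \<Otimes>\<^sub>M borel) (past_space n \<Otimes>\<^sub>M borel)"
      unfolding past_space_def by measurable
    from measurable_compose[OF this F] show ?thesis .
  qed
  have dm [measurable]: "(\<lambda>\<omega>. \<lambda>i\<in>{1..n}. U i \<omega>) \<in> measurable M (PiM {1..n} (\<lambda>_. borel))"
    by (intro measurable_restrict) (auto intro: measurable_duration)
  have rm [measurable]: "(\<lambda>u. restrict u {1..n}) \<in> measurable (PiM {1..} (\<lambda>_. borel)) (PiM {1..n} (\<lambda>_. borel))"
    by (intro measurable_restrict_subset) auto
  have rr: "restrict (durations \<omega>) {1..n} = (\<lambda>i\<in>{1..n}. U i \<omega>)" "durations \<omega> (Suc n) = U (Suc n) \<omega>" for \<omega>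
    by (auto simp: fun_eq_iff restrict_def durations_def)
  have word: "(\<integral>\<^sup>+ \<omega>. indicator (mode_path n w) \<omega> * F ((w, \<lambda>i\<in>{1..n}. U i \<omega>), U (Suc n) \<omega>) \<partial>M)
      = (\<integral>\<^sup>+ \<omega>. indicator (mode_path n w) \<omega> * (\<integral>\<^sup>+ t. F ((w, \<lambda>i\<in>{1..n}. U i \<omega>), t) \<partial>dwell lam \<tau>) \<partial>M)"
    if w: "w \<in> ?W" for w
  proof -
    note [measurable] = Fw[OF w]
    have 1: "(\<lambda>u. F ((w, restrict u {1..n}), u (Suc n))) \<in> borel_measurable (PiM {1..} (\<lambda>_. borel))"
    proof -
      have "(\<lambda>u. (restrict u {1..n}, u (Suc n))) \<in> measurable (PiM {1..} (\<lambda>_. borel)) (PiM {1..n} (\<lambda>_. borel) \<Otimes>\<^sub>M borel)"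
        by measurable
      from measurable_compose[OF this Fw[OF w]] show ?thesis by simp
    qed
    have 2: "(\<lambda>u. \<integral>\<^sup>+ t. F ((w, restrict u {1..n}), t) \<partial>dwell lam \<tau>) \<in> borel_measurable (PiM {1..} (\<lambda>_. borel))"
    proof -
      have "(\<lambda>v. \<integral>\<^sup>+ t. F ((w, v), t) \<partial>dwell lam \<tau>) \<in> borel_measurable (PiM {1..n} (\<lambda>_. borel))"
        using dwell.borel_measurable_nn_integral[of "\<lambda>v t. F ((w, v), t)"] Fw[OF w] by (simp add: case_prod_beta)
      from measurable_compose[OF rm this] show ?thesis .
    qed
    show ?thesis
      using nn_integral_mode_path_durations[OF 1, of n w] nn_integral_mode_path_durations[OF 2, of n w]
        nn_integral_next_duration[OF Fw[OF w]]
      by (simp add: rr)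
  qed
  have "(\<integral>\<^sup>+ \<omega>. F (past n \<omega>, U (Suc n) \<omega>) \<partial>M) =
      (\<Sum>w\<in>?W. \<integral>\<^sup>+ \<omega>. indicator (mode_path n w) \<omega> * F ((w, \<lambda>i\<in>{1..n}. U i \<omega>), U (Suc n) \<omega>) \<partial>M)"
  proof (rule split)
    fix w assume "w \<in> ?W"
    from measurable_compose[OF measurable_Pair[OF dm measurable_duration_Suc] Fw[OF this]]
    show "(\<lambda>\<omega>. F ((w, \<lambda>i\<in>{1..n}. U i \<omega>), U (Suc n) \<omega>)) \<in> borel_measurable M" by simp
  qed
  also have "\<dots> = (\<Sum>w\<in>?W. \<integral>\<^sup>+ \<omega>. indicator (mode_path n w) \<omega> * (\<integral>\<^sup>+ t. F ((w, \<lambda>i\<in>{1..n}. U i \<omega>), t) \<partial>dwell lam \<tau>) \<partial>M)"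
    by (intro sum.cong word) auto
  also have "\<dots> = (\<integral>\<^sup>+ \<omega>. \<integral>\<^sup>+ t. F (past n \<omega>, t) \<partial>dwell lam \<tau> \<partial>M)"
  proof (rule split[symmetric])
    fix w assume w: "w \<in> ?W"
    have "(\<lambda>v. \<integral>\<^sup>+ t. F ((w, v), t) \<partial>dwell lam \<tau>) \<in> borel_measurable (PiM {1..n} (\<lambda>_. borel))"
      using dwell.borel_measurable_nn_integral[of "\<lambda>v t. F ((w, v), t)"] Fw[OF w] by (simp add: case_prod_beta)
    from measurable_compose[OF dm this]
    show "(\<lambda>\<omega>. \<integral>\<^sup>+ t. F ((w, \<lambda>i\<in>{1..n}. U i \<omega>), t) \<partial>dwell lam \<tau>) \<in> borel_measurable M" .
  qed
  finally show ?thesis .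
qed

lemma distr_past_next_duration:
  "distr M (past_space n \<Otimes>\<^sub>M borel) (\<lambda>\<omega>. (past n \<omega>, U (Suc n) \<omega>)) = distr M (past_space n) (past n) \<Otimes>\<^sub>M dwell lam \<tau>"
proof (rule measure_eqI)
  show s: "sets (distr M (past_space n \<Otimes>\<^sub>M borel) (\<lambda>\<omega>. (past n \<omega>, U (Suc n) \<omega>)))
      = sets (distr M (past_space n) (past n) \<Otimes>\<^sub>M dwell lam \<tau>)"
    by (simp cong: sets_pair_measure_cong)
  fix B assume "B \<in> sets (distr M (past_space n \<Otimes>\<^sub>M borel) (\<lambda>\<omega>. (past n \<omega>, U (Suc n) \<omega>)))"
  then have B [measurable]: "B \<in> sets (past_space n \<Otimes>\<^sub>M borel)" by simp
  have B': "B \<in> sets (distr M (past_space n) (past n) \<Otimes>\<^sub>M dwell lam \<tau>)" using B s by simp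
  have "emeasure (distr M (past_space n \<Otimes>\<^sub>M borel) (\<lambda>\<omega>. (past n \<omega>, U (Suc n) \<omega>))) B
      = (\<integral>\<^sup>+ x. indicator B x \<partial>distr M (past_space n \<Otimes>\<^sub>M borel) (\<lambda>\<omega>. (past n \<omega>, U (Suc n) \<omega>)))"
    by simp
  also have "\<dots> = (\<integral>\<^sup>+ \<omega>. indicator B (past n \<omega>, U (Suc n) \<omega>) \<partial>M)"
    by (rule nn_integral_distr) measurable
  also have "\<dots> = (\<integral>\<^sup>+ \<omega>. \<integral>\<^sup>+ t. indicator B (past n \<omega>, t) \<partial>dwell lam \<tau> \<partial>M)"
    by (rule nn_integral_past_next_duration) measurable
  also have "\<dots> = (\<integral>\<^sup>+ x. \<integral>\<^sup>+ t. indicator B (x, t) \<partial>dwell lam \<tau> \<partial>distr M (past_space n) (past n))"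
    by (subst nn_integral_distr) auto
  also have "\<dots> = emeasure (distr M (past_space n) (past n) \<Otimes>\<^sub>M dwell lam \<tau>) B"
    by (rule dwell.emeasure_pair_measure[symmetric, OF B'])
  finally show "emeasure (distr M (past_space n \<Otimes>\<^sub>M borel) (\<lambda>\<omega>. (past n \<omega>, U (Suc n) \<omega>))) B
      = emeasure (distr M (past_space n) (past n) \<Otimes>\<^sub>M dwell lam \<tau>) B" .
qed

end

section \<open>Orbits and sums of increments\<close>

primrec orbit :: "('e \<Rightarrow> real^'d^'d) \<Rightarrow> (nat \<Rightarrow> 'e) \<Rightarrow> (nat \<Rightarrow> real) \<Rightarrow> 'd::finite proj_space \<Rightarrow> nat \<Rightarrow> 'd proj_space" where
  "orbit A l u q 0 = q"
| "orbit A l u q (Suc n) = proj_flow (A (l n)) (u (Suc n)) (orbit A l u q n)"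

lemma orbit_cong:
  "(\<And>i. i < n \<Longrightarrow> l i = l' i) \<Longrightarrow> (\<And>i. i \<in> {1..n} \<Longrightarrow> u i = u' i) \<Longrightarrow> orbit A l u q n = orbit A l' u' q n"
  by (induction n) auto

lemma measurable_orbit:
  fixes l :: "'a \<Rightarrow> nat \<Rightarrow> 'e::finite"
  assumes "q \<in> borel_measurable M" "\<And>i. i < n \<Longrightarrow> (\<lambda>x. l x i) \<in> measurable M (count_space UNIV)"
    "\<And>i. i \<in> {1..n} \<Longrightarrow> (\<lambda>x. u x i) \<in> borel_measurable M"
  shows "(\<lambda>x. orbit A (l x) (u x) (q x) n) \<in> borel_measurable M"
  using assms(2,3)
proof (induction n)
  case (Suc n)
  then have "(\<lambda>x. orbit A (l x) (u x) (q x) n) \<in> borel_measurable M" by simp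
  then show ?case by (auto intro!: measurable_proj_flow_mode Suc.prems)
qed (use assms(1) in simp)

lemma abs_mult_le_sum_squares: "\<bar>a * b\<bar> \<le> a\<^sup>2 + b\<^sup>2" for a b :: real
proof -
  have "2 * \<bar>a\<bar> * \<bar>b\<bar> \<le> a\<^sup>2 + b\<^sup>2" using sum_squares_bound[of "\<bar>a\<bar>" "\<bar>b\<bar>"] by simp
  moreover have "0 \<le> \<bar>a\<bar> * \<bar>b\<bar>" by simp
  ultimately show ?thesis unfolding abs_mult by linarith
qed

context standard_switching_process
begin

lemma measurable_past_mode: "i \<le> n \<Longrightarrow> (\<lambda>x. fst x i) \<in> measurable (past_space n) (count_space UNIV)"
  unfolding past_space_def by (rule measurable_compose[OF measurable_fst measurable_component_singleton]) simp

lemma measurable_past_duration: "i \<in> {1..n} \<Longrightarrow> (\<lambda>x. snd x i) \<in> borel_measurable (past_space n)"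
  unfolding past_space_def by (rule measurable_compose[OF measurable_snd measurable_component_singleton]) simp

lemma past_mode [simp]: "i \<le> n \<Longrightarrow> fst (past n \<omega>) i = L i \<omega>"
  and past_duration [simp]: "i \<in> {1..n} \<Longrightarrow> snd (past n \<omega>) i = U i \<omega>"
  by (auto simp: past_def)

text \<open>Conditioning on the past, the next duration and the next mode may be averaged out in one step.\<close>

lemma markov_step:
  assumes H [measurable]: "H \<in> borel_measurable (past_space n)"
    and psi [measurable]: "\<psi> \<in> borel_measurable step_space"
    and z [measurable]: "z \<in> measurable (past_space n) state_space" and zn: "\<And>x. snd (z x) = fst x n"
    and int: "\<And>j. integrable M (\<lambda>\<omega>. H (past n \<omega>) * \<psi> (z (past n \<omega>), U (Suc n) \<omega>, j))"
  shows "(\<integral>\<omega>. H (past n \<omega>) * \<psi> (z (past n \<omega>), U (Suc n) \<omega>, L (Suc n) \<omega>) \<partial>M)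
    = (\<integral>\<omega>. H (past n \<omega>) * mean_step P lam \<tau> \<psi> (z (past n \<omega>)) \<partial>M)"
proof -
  define F where "F j = (\<lambda>p. H (fst p) * \<psi> (z (fst p), snd p, j))" for j
  define J where "J j = {\<omega> \<in> space M. L (Suc n) \<omega> = j}" for j
  have J [measurable]: "J j \<in> sets M" for j unfolding J_def by measurable
  have Fm [measurable]: "F j \<in> borel_measurable (past_space n \<Otimes>\<^sub>M borel)" for j unfolding F_def by measurable
  have F: "H (past n \<omega>) * \<psi> (z (past n \<omega>), U (Suc n) \<omega>, j) = F j (past n \<omega>, U (Suc n) \<omega>)" for j \<omega>
    by (simp add: F_def)
  interpret p: prob_space "distr M (past_space n) (past n)" by (rule prob_space_distr) measurable
  interpret pd: pair_sigma_finite "distr M (past_space n) (past n)" "dwell lam \<tau>" ..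
  have Pm [measurable]: "(\<lambda>x. P (fst x n) j) \<in> borel_measurable (past_space n)" for j
    using measurable_mode_weight[of "\<lambda>x. fst x n" "past_space n" "\<lambda>_. j" P] measurable_past_mode[of n n] by simp
  have FH: "(\<lambda>\<omega>. F j (past n \<omega>, U (Suc n) \<omega>)) \<in> borel_measurable (history n)" for j
  proof -
    let ?h = "\<lambda>x. ((fst (snd x), restrict (snd (snd x)) {1..n}), snd (snd x) (Suc n))"
    have [measurable]: "(\<lambda>u. restrict u {1..n}) \<in> measurable (PiM {1..} (\<lambda>_. borel)) (PiM {1..n} (\<lambda>_. borel :: real measure))"
      by (intro measurable_restrict_subset) auto
    have [measurable]: "(\<lambda>u. u (Suc n)) \<in> measurable (PiM {1..} (\<lambda>_. borel)) (borel :: real measure)"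
      by (rule measurable_component_singleton) simp
    have "?h \<in> measurable (borel \<Otimes>\<^sub>M PiM {..n} (\<lambda>_. count_space UNIV) \<Otimes>\<^sub>M PiM {1..} (\<lambda>_. borel)) (past_space n \<Otimes>\<^sub>M borel)"
      unfolding past_space_def by measurable
    from measurable_history[OF measurable_compose[OF this Fm[of j]]]
    have "(\<lambda>\<omega>. F j (((\<lambda>k\<in>{..n}. L k \<omega>), restrict (durations \<omega>) {1..n}), durations \<omega> (Suc n))) \<in> borel_measurable (history n)"
      by (simp add: durations_def)
    moreover have "restrict (durations \<omega>) {1..n} = (\<lambda>i\<in>{1..n}. U i \<omega>)" "durations \<omega> (Suc n) = U (Suc n) \<omega>" for \<omega>
      by (auto simp: fun_eq_iff restrict_def durations_def)
    ultimately show ?thesis by (simp add: past_def)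
  qed
  have intF: "integrable M (\<lambda>\<omega>. F j (past n \<omega>, U (Suc n) \<omega>))" for j using int[of j] by (simp add: F)
  have intFP: "integrable M (\<lambda>\<omega>. F j (past n \<omega>, U (Suc n) \<omega>) * P (fst (past n \<omega>) n) j)" for j
    by (rule Bochner_Integration.integrable_bound[OF intF[of j]])
      (auto simp: abs_mult switching_matrixD(4,5)[OF switching] intro!: mult_left_le)
  have prod_int: "integrable (distr M (past_space n) (past n) \<Otimes>\<^sub>M dwell lam \<tau>) (\<lambda>p. F j p * P (fst (fst p) n) j)" for j
    unfolding distr_past_next_duration[symmetric] using intFP[of j] by (subst integrable_distr_eq) auto
  have inner: "(\<integral>t. F j (x, t) * P (fst x n) j \<partial>dwell lam \<tau>) = H x * (P (fst x n) j * (\<integral>t. \<psi> (z x, t, j) \<partial>dwell lam \<tau>))" for j x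
    by (simp add: F_def mult.commute mult.left_commute)
  have ij: "integrable M (\<lambda>\<omega>. H (past n \<omega>) * (P (fst (past n \<omega>) n) j * (\<integral>t. \<psi> (z (past n \<omega>), t, j) \<partial>dwell lam \<tau>)))" for j
  proof -
    have "integrable (distr M (past_space n) (past n)) (\<lambda>x. \<integral>t. F j (x, t) * P (fst x n) j \<partial>dwell lam \<tau>)"
      using pd.integrable_fst'[OF prod_int[of j]] by simp
    then have "integrable (distr M (past_space n) (past n)) (\<lambda>x. H x * (P (fst x n) j * (\<integral>t. \<psi> (z x, t, j) \<partial>dwell lam \<tau>)))"
      unfolding inner .
    then show ?thesis by (rule integrable_distr[rotated]) measurable
  qed
  have each: "(\<integral>\<omega>. F j (past n \<omega>, U (Suc n) \<omega>) * indicator (J j) \<omega> \<partial>M)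
      = (\<integral>\<omega>. H (past n \<omega>) * (P (fst (past n \<omega>) n) j * (\<integral>t. \<psi> (z (past n \<omega>), t, j) \<partial>dwell lam \<tau>)) \<partial>M)" for j
  proof -
    have "(\<integral>\<omega>. F j (past n \<omega>, U (Suc n) \<omega>) * indicator (J j) \<omega> \<partial>M)
        = (\<integral>\<omega>. F j (past n \<omega>, U (Suc n) \<omega>) * P (L n \<omega>) j \<partial>M)"
      unfolding J_def by (rule integral_next_mode[OF FH intF])
    also have "\<dots> = (\<integral>p. F j p * P (fst (fst p) n) j \<partial>distr M (past_space n \<Otimes>\<^sub>M borel) (\<lambda>\<omega>. (past n \<omega>, U (Suc n) \<omega>)))"
      by (subst integral_distr) auto
    also have "\<dots> = (\<integral>x. \<integral>t. F j (x, t) * P (fst x n) j \<partial>dwell lam \<tau> \<partial>distr M (past_space n) (past n))"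
      unfolding distr_past_next_duration using pd.integral_fst'[OF prod_int[of j]] by simp
    also have "\<dots> = (\<integral>\<omega>. H (past n \<omega>) * (P (fst (past n \<omega>) n) j * (\<integral>t. \<psi> (z (past n \<omega>), t, j) \<partial>dwell lam \<tau>)) \<partial>M)"
      unfolding inner by (rule integral_distr) measurable
    finally show ?thesis .
  qed
  have "(\<integral>\<omega>. H (past n \<omega>) * \<psi> (z (past n \<omega>), U (Suc n) \<omega>, L (Suc n) \<omega>) \<partial>M)
      = (\<integral>\<omega>. (\<Sum>j\<in>UNIV. F j (past n \<omega>, U (Suc n) \<omega>) * indicator (J j) \<omega>) \<partial>M)"
    by (intro Bochner_Integration.integral_cong) (auto simp: F J_def indicator_def if_distrib cong: if_cong)
  also have "\<dots> = (\<Sum>j\<in>UNIV. \<integral>\<omega>. F j (past n \<omega>, U (Suc n) \<omega>) * indicator (J j) \<omega> \<partial>M)"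
    by (intro Bochner_Integration.integral_sum integrable_real_mult_indicator intF J)
  also have "\<dots> = (\<Sum>j\<in>UNIV. \<integral>\<omega>. H (past n \<omega>) * (P (fst (past n \<omega>) n) j * (\<integral>t. \<psi> (z (past n \<omega>), t, j) \<partial>dwell lam \<tau>)) \<partial>M)"
    by (simp only: each)
  also have "\<dots> = (\<integral>\<omega>. (\<Sum>j\<in>UNIV. H (past n \<omega>) * (P (fst (past n \<omega>) n) j * (\<integral>t. \<psi> (z (past n \<omega>), t, j) \<partial>dwell lam \<tau>))) \<partial>M)"
    by (intro Bochner_Integration.integral_sum[symmetric] ij)
  also have "\<dots> = (\<integral>\<omega>. H (past n \<omega>) * mean_step P lam \<tau> \<psi> (z (past n \<omega>)) \<partial>M)"
    by (simp add: mean_step_def zn sum_distrib_left)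
  finally show ?thesis .
qed

definition state :: "'d proj_space \<Rightarrow> nat \<Rightarrow> 'w \<Rightarrow> 'd proj_space \<times> 'e" where
  "state q n \<omega> = (orbit A (\<lambda>i. L i \<omega>) (\<lambda>i. U i \<omega>) q n, L n \<omega>)"

text \<open>The state as a function of the past, to which the one-step averaging applies.\<close>

definition past_state :: "'d proj_space \<Rightarrow> nat \<Rightarrow> (nat \<Rightarrow> 'e) \<times> (nat \<Rightarrow> real) \<Rightarrow> 'd proj_space \<times> 'e" where
  "past_state q n x = (orbit A (fst x) (snd x) q n, fst x n)"

lemma state_Suc: "state q (Suc n) \<omega> = next_state A (state q n \<omega>, U (Suc n) \<omega>, L (Suc n) \<omega>)"
  by (simp add: state_def next_state_def)

lemma past_state_past [simp]: "k \<le> n \<Longrightarrow> past_state q k (past n \<omega>) = state q k \<omega>"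
  unfolding past_state_def state_def by (auto intro!: orbit_cong)

lemma measurable_past_state: "k \<le> n \<Longrightarrow> past_state q k \<in> measurable (past_space n) state_space"
  unfolding past_state_def
  by (intro measurable_Pair measurable_orbit measurable_past_mode measurable_past_duration) auto

lemma measurable_state [measurable]: "(\<lambda>x. state (fst x) n (snd x)) \<in> measurable (borel \<Otimes>\<^sub>M M) state_space"
  unfolding state_def
proof (intro measurable_Pair measurable_orbit)
  fix i assume "i \<in> {1..n}"
  then show "(\<lambda>x. U i (snd x)) \<in> borel_measurable (borel \<Otimes>\<^sub>M M)"
    by (intro measurable_compose[OF measurable_snd measurable_duration]) auto
qed measurable

lemma measurable_state' [measurable (raw)]:
  assumes "f \<in> borel_measurable N" "g \<in> measurable N M"
  shows "(\<lambda>x. state (f x) n (g x)) \<in> measurable N state_space"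
  using measurable_compose[OF measurable_Pair[OF assms] measurable_state] by simp

lemma integrable_duration_square: "integrable M (\<lambda>\<omega>. (1 + \<bar>U (Suc n) \<omega>\<bar>)\<^sup>2)"
  and integral_duration_square: "(\<integral>\<omega>. (1 + \<bar>U (Suc n) \<omega>\<bar>)\<^sup>2 \<partial>M) = (\<integral>t. (1 + \<bar>t\<bar>)\<^sup>2 \<partial>dwell lam \<tau>)"
proof -
  have "integrable (distr M borel (U (Suc n))) (\<lambda>t. (1 + \<bar>t\<bar>)\<^sup>2)"
    unfolding distr_duration by (rule integrable_dwell[OF lam_pos])
  then show "integrable M (\<lambda>\<omega>. (1 + \<bar>U (Suc n) \<omega>\<bar>)\<^sup>2)" by (rule integrable_distr[rotated]) measurable
  show "(\<integral>\<omega>. (1 + \<bar>U (Suc n) \<omega>\<bar>)\<^sup>2 \<partial>M) = (\<integral>t. (1 + \<bar>t\<bar>)\<^sup>2 \<partial>dwell lam \<tau>)"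
    unfolding distr_duration[of n, symmetric] by (rule integral_distr[symmetric]) auto
qed

definition path_sum :: "(('d proj_space \<times> 'e) \<times> real \<times> 'e \<Rightarrow> real) \<Rightarrow> 'd proj_space \<Rightarrow> nat \<Rightarrow> 'w \<Rightarrow> real" where
  "path_sum \<psi> q n \<omega> = (\<Sum>k<n. \<psi> (state q k \<omega>, U (Suc k) \<omega>, L (Suc k) \<omega>))"

lemma measurable_path_sum [measurable (raw)]:
  assumes [measurable]: "\<psi> \<in> borel_measurable step_space" "f \<in> borel_measurable N" "g \<in> measurable N M"
  shows "(\<lambda>x. path_sum \<psi> (f x) n (g x)) \<in> borel_measurable N"
  unfolding path_sum_def by measurable

text \<open>Centred increments are orthogonal in \<open>L\<^sup>2\<close>, so that the second moment of their sum grows linearly,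
  uniformly in the starting point.\<close>

lemma path_sum_second_moment:
  assumes psi [measurable]: "\<psi> \<in> borel_measurable step_space"
    and b: "\<And>z t j. \<bar>\<psi> (z, t, j)\<bar> \<le> K * (1 + \<bar>t\<bar>)"
    and centred: "\<And>z. mean_step P lam \<tau> \<psi> z = 0"
  shows "integrable M (\<lambda>\<omega>. (path_sum \<psi> q n \<omega>)\<^sup>2) \<and>
    (\<integral>\<omega>. (path_sum \<psi> q n \<omega>)\<^sup>2 \<partial>M) \<le> n * (K\<^sup>2 * (\<integral>t. (1 + \<bar>t\<bar>)\<^sup>2 \<partial>dwell lam \<tau>))"
proof (induction n)
  case 0
  show ?case by (simp add: path_sum_def)
next
  case (Suc n)
  let ?S = "path_sum \<psi> q n" and ?C = "\<integral>t. (1 + \<bar>t\<bar>)\<^sup>2 \<partial>dwell lam \<tau>"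
  let ?p = "\<lambda>\<omega>. \<psi> (state q n \<omega>, U (Suc n) \<omega>, L (Suc n) \<omega>)"
  have S2: "integrable M (\<lambda>\<omega>. (?S \<omega>)\<^sup>2)" using Suc by simp
  have U2: "integrable M (\<lambda>\<omega>. K\<^sup>2 * (1 + \<bar>U (Suc n) \<omega>\<bar>)\<^sup>2)" using integrable_duration_square by simp
  have p2: "(\<psi> (z, t, j))\<^sup>2 \<le> K\<^sup>2 * (1 + \<bar>t\<bar>)\<^sup>2" for z t j
    using power_mono[OF b abs_ge_zero, of z t j 2] by (simp add: power_mult_distrib)
  have ip2: "integrable M (\<lambda>\<omega>. (?p \<omega>)\<^sup>2)"
    by (rule Bochner_Integration.integrable_bound[OF U2]) (auto intro!: p2)
  have isp: "integrable M (\<lambda>\<omega>. ?S \<omega> * \<psi> (state q n \<omega>, U (Suc n) \<omega>, j))" for j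
  proof (rule Bochner_Integration.integrable_bound[OF Bochner_Integration.integrable_add[OF S2 U2]])
    show "AE \<omega> in M. norm (?S \<omega> * \<psi> (state q n \<omega>, U (Suc n) \<omega>, j)) \<le> norm ((?S \<omega>)\<^sup>2 + K\<^sup>2 * (1 + \<bar>U (Suc n) \<omega>\<bar>)\<^sup>2)"
    proof (rule AE_I2)
      fix \<omega>
      have "\<bar>?S \<omega> * \<psi> (state q n \<omega>, U (Suc n) \<omega>, j)\<bar> \<le> (?S \<omega>)\<^sup>2 + (\<psi> (state q n \<omega>, U (Suc n) \<omega>, j))\<^sup>2"
        by (rule abs_mult_le_sum_squares)
      also have "(?S \<omega>)\<^sup>2 + (\<psi> (state q n \<omega>, U (Suc n) \<omega>, j))\<^sup>2 \<le> (?S \<omega>)\<^sup>2 + K\<^sup>2 * (1 + \<bar>U (Suc n) \<omega>\<bar>)\<^sup>2"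
        using p2 by simp
      finally show "norm (?S \<omega> * \<psi> (state q n \<omega>, U (Suc n) \<omega>, j)) \<le> norm ((?S \<omega>)\<^sup>2 + K\<^sup>2 * (1 + \<bar>U (Suc n) \<omega>\<bar>)\<^sup>2)"
        by simp
    qed
  qed measurable
  have isp': "integrable M (\<lambda>\<omega>. ?S \<omega> * ?p \<omega>)"
  proof (rule Bochner_Integration.integrable_bound[OF Bochner_Integration.integrable_add[OF S2 ip2]])
    show "AE \<omega> in M. norm (?S \<omega> * ?p \<omega>) \<le> norm ((?S \<omega>)\<^sup>2 + (?p \<omega>)\<^sup>2)"
    proof (rule AE_I2)
      fix \<omega>
      from abs_mult_le_sum_squares[of "?S \<omega>" "?p \<omega>"] show "norm (?S \<omega> * ?p \<omega>) \<le> norm ((?S \<omega>)\<^sup>2 + (?p \<omega>)\<^sup>2)" by simp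
    qed
  qed measurable
  define H where "H x = (\<Sum>k<n. \<psi> (past_state q k x, snd x (Suc k), fst x (Suc k)))" for x
  have Hm: "H \<in> borel_measurable (past_space n)"
    unfolding H_def
  proof (intro borel_measurable_sum measurable_compose[OF _ psi] measurable_Pair)
    fix k assume "k \<in> {..<n}"
    then show "past_state q k \<in> measurable (past_space n) state_space"
      "(\<lambda>x. snd x (Suc k)) \<in> borel_measurable (past_space n)"
      "(\<lambda>x. fst x (Suc k)) \<in> measurable (past_space n) (count_space UNIV)"
      by (auto intro: measurable_past_state measurable_past_mode measurable_past_duration)
  qed
  have HS: "H (past n \<omega>) = ?S \<omega>" for \<omega> by (simp add: H_def path_sum_def)
  have "(\<integral>\<omega>. H (past n \<omega>) * \<psi> (past_state q n (past n \<omega>), U (Suc n) \<omega>, L (Suc n) \<omega>) \<partial>M)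
      = (\<integral>\<omega>. H (past n \<omega>) * mean_step P lam \<tau> \<psi> (past_state q n (past n \<omega>)) \<partial>M)"
  proof (rule markov_step[OF Hm psi measurable_past_state[OF order_refl]])
    show "snd (past_state q n x) = fst x n" for x by (simp add: past_state_def)
    show "integrable M (\<lambda>\<omega>. H (past n \<omega>) * \<psi> (past_state q n (past n \<omega>), U (Suc n) \<omega>, j))" for j
      using isp[of j] by (simp add: HS)
  qed
  then have cross: "(\<integral>\<omega>. ?S \<omega> * ?p \<omega> \<partial>M) = 0" by (simp add: HS centred)
  have "(\<lambda>\<omega>. (path_sum \<psi> q (Suc n) \<omega>)\<^sup>2) = (\<lambda>\<omega>. (?S \<omega>)\<^sup>2 + 2 * (?S \<omega> * ?p \<omega>) + (?p \<omega>)\<^sup>2)"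
    by (auto simp: path_sum_def power2_eq_square algebra_simps)
  moreover have "integrable M (\<lambda>\<omega>. (?S \<omega>)\<^sup>2 + 2 * (?S \<omega> * ?p \<omega>) + (?p \<omega>)\<^sup>2)"
    using S2 isp' ip2 by simp
  moreover have "(\<integral>\<omega>. (?S \<omega>)\<^sup>2 + 2 * (?S \<omega> * ?p \<omega>) + (?p \<omega>)\<^sup>2 \<partial>M) = (\<integral>\<omega>. (?S \<omega>)\<^sup>2 \<partial>M) + (\<integral>\<omega>. (?p \<omega>)\<^sup>2 \<partial>M)"
    using S2 isp' ip2 cross by simp
  moreover have "(\<integral>\<omega>. (?p \<omega>)\<^sup>2 \<partial>M) \<le> (\<integral>\<omega>. K\<^sup>2 * (1 + \<bar>U (Suc n) \<omega>\<bar>)\<^sup>2 \<partial>M)"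
    by (intro integral_mono ip2 U2 p2)
  then have "(\<integral>\<omega>. (?p \<omega>)\<^sup>2 \<partial>M) \<le> K\<^sup>2 * ?C" by (simp add: integral_duration_square)
  ultimately show ?case using Suc by (simp add: algebra_simps)
qed

text \<open>Each use of the Markov property replaces the test function by its image under the transition operator.\<close>

lemma integral_state:
  assumes "\<phi> \<in> borel_measurable state_space" and "\<And>z. 0 \<le> \<phi> z" "\<And>z. \<phi> z \<le> 1"
  shows "(\<integral>\<omega>. indicator {i} (L 0 \<omega>) * \<phi> (state q n \<omega>) \<partial>M)
    = prob {\<omega> \<in> space M. L 0 \<omega> = i} * ((\<lambda>\<phi>. mean_step P lam \<tau> (\<lambda>x. \<phi> (next_state A x))) ^^ n) \<phi> (q, i)"
  using assms
proof (induction n arbitrary: \<phi>)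
  case 0
  have "(\<integral>\<omega>. indicator {i} (L 0 \<omega>) * \<phi> (state q 0 \<omega>) \<partial>M) = (\<integral>\<omega>. \<phi> (q, i) * indicator {\<omega> \<in> space M. L 0 \<omega> = i} \<omega> \<partial>M)"
    by (intro Bochner_Integration.integral_cong) (auto simp: indicator_def state_def)
  then show ?case by simp
next
  case (Suc n)
  note [measurable] = Suc.prems(1)
  let ?T = "\<lambda>\<phi>. mean_step P lam \<tau> (\<lambda>x. \<phi> (next_state A x))"
  have "(\<integral>\<omega>. indicator {i} (L 0 \<omega>) * \<phi> (state q (Suc n) \<omega>) \<partial>M) =
     (\<integral>\<omega>. indicator {i} (fst (past n \<omega>) 0) * \<phi> (next_state A (past_state q n (past n \<omega>), U (Suc n) \<omega>, L (Suc n) \<omega>)) \<partial>M)"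
    by (simp add: state_Suc)
  also have "\<dots> = (\<integral>\<omega>. indicator {i} (fst (past n \<omega>) 0) * ?T \<phi> (past_state q n (past n \<omega>)) \<partial>M)"
  proof (rule markov_step)
    show "(\<lambda>x. indicator {i} (fst x 0) :: real) \<in> borel_measurable (past_space n)"
      by (rule measurable_compose[OF measurable_past_mode]) auto
    show "past_state q n \<in> measurable (past_space n) state_space" by (rule measurable_past_state) simp
    show "snd (past_state q n x) = fst x n" for x by (simp add: past_state_def)
    show "integrable M (\<lambda>\<omega>. indicator {i} (fst (past n \<omega>) 0) * \<phi> (next_state A (past_state q n (past n \<omega>), U (Suc n) \<omega>, j)))" for j
      by (rule integrable_const_bound[where B=1])
        (use Suc.prems in \<open>auto simp: indicator_def\<close>)
  qed measurable
  also have "\<dots> = (\<integral>\<omega>. indicator {i} (L 0 \<omega>) * ?T \<phi> (state q n \<omega>) \<partial>M)" by simp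
  also have "\<dots> = prob {\<omega> \<in> space M. L 0 \<omega> = i} * (?T ^^ n) (?T \<phi>) (q, i)"
  proof (rule Suc.IH)
    show "?T \<phi> \<in> borel_measurable state_space" by (intro measurable_mean_step lam_pos) measurable
    show "0 \<le> ?T \<phi> z" "?T \<phi> z \<le> 1" for z
      by (intro mean_step_bounded lam_pos switching Suc.prems)+
  qed
  finally show ?case by (simp add: funpow_Suc_right del: funpow.simps)
qed

end

section \<open>Limits of dominated averages\<close>

text \<open>By the Tychonoff theorem, a pointwise bounded sequence of functions on an arbitrary set has a cluster
  point in the product topology; convergence to it takes place along a filter finer than
  \<open>sequentially\<close>.\<close>

lemma pointwise_cluster_filter:
  fixes F :: "nat \<Rightarrow> 'a \<Rightarrow> real"
  assumes bound: "\<And>n a. \<bar>F n a\<bar> \<le> K a"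
  obtains G \<Lambda> where "G \<noteq> bot" "G \<le> sequentially" "\<And>a. ((\<lambda>n. F n a) \<longlongrightarrow> \<Lambda> a) G"
proof -
  define S where "S = PiE UNIV (\<lambda>a. {- K a..K a})"
  have "compactin (product_topology (\<lambda>_. euclidean) UNIV) S"
    unfolding S_def by (subst compactin_PiE) auto
  then have "compact S" by (simp add: euclidean_product_topology)
  moreover have ev: "eventually (\<lambda>x. x \<in> S) (filtermap F sequentially)"
    using bound by (auto simp: S_def eventually_filtermap abs_le_iff minus_le_iff PiE_UNIV_domain Pi_iff)
  moreover have "filtermap F sequentially \<noteq> bot" by (simp add: filtermap_bot_iff)
  ultimately obtain \<Lambda> where L: "inf (nhds \<Lambda>) (filtermap F sequentially) \<noteq> bot"
    unfolding compact_filter by blast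
  define G where "G = inf (filtercomap F (nhds \<Lambda>)) sequentially"
  have "G \<noteq> bot"
  proof
    assume "G = bot"
    then have "eventually (\<lambda>_. False) G" by simp
    then obtain Q R where QR: "eventually Q (filtercomap F (nhds \<Lambda>))" "eventually R sequentially"
      "\<And>n. Q n \<Longrightarrow> R n \<Longrightarrow> False"
      unfolding G_def eventually_inf by auto
    then obtain X where X: "eventually X (nhds \<Lambda>)" "\<And>n. X (F n) \<Longrightarrow> Q n"
      unfolding eventually_filtercomap by auto
    have "eventually (\<lambda>y. \<not> X y) (filtermap F sequentially)"
      unfolding eventually_filtermap using QR(2) by eventually_elim (use X QR(3) in blast)
    then have "eventually (\<lambda>_. False) (inf (nhds \<Lambda>) (filtermap F sequentially))"
      unfolding eventually_inf using X(1) by blast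
    then show False using L by (simp add: trivial_limit_def)
  qed
  moreover have "G \<le> sequentially" by (simp add: G_def)
  moreover have "((\<lambda>n. F n a) \<longlongrightarrow> \<Lambda> a) G" for a
  proof -
    have "filtermap F G \<le> filtermap F (filtercomap F (nhds \<Lambda>))" unfolding G_def by (intro filtermap_mono) simp
    also have "\<dots> \<le> nhds \<Lambda>" by (rule filtermap_filtercomap)
    finally have "filterlim F (nhds \<Lambda>) G" by (simp add: filterlim_def)
    then show ?thesis
      using continuous_on_tendsto_compose[OF continuous_on_product_coordinates, of F \<Lambda> G a] by simp
  qed
  ultimately show ?thesis using that by blast
qed

text \<open>Domination by \<open>\<mu>\<close> makes a positive linear functional countably additive: the value at the tail of
  a disjoint union is at most the \<open>\<mu>\<close>-mass of the tail.  Limits of averages along a filter, which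
  are merely linear a priori, become integrals in this way.\<close>

lemma dominated_functional_representation:
  fixes \<Lambda> :: "('a \<Rightarrow> real) \<Rightarrow> real"
  assumes "finite_measure \<mu>"
    and add: "\<And>f g. integrable \<mu> f \<Longrightarrow> integrable \<mu> g \<Longrightarrow> \<Lambda> (\<lambda>x. f x + g x) = \<Lambda> f + \<Lambda> g"
    and scale: "\<And>f c. integrable \<mu> f \<Longrightarrow> \<Lambda> (\<lambda>x. c * f x) = c * \<Lambda> f"
    and nonneg: "\<And>f. integrable \<mu> f \<Longrightarrow> (\<And>x. 0 \<le> f x) \<Longrightarrow> 0 \<le> \<Lambda> f"
    and bound: "\<And>f. integrable \<mu> f \<Longrightarrow> \<bar>\<Lambda> f\<bar> \<le> (\<integral>x. \<bar>f x\<bar> \<partial>\<mu>)"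
  obtains \<nu> where "sets \<nu> = sets \<mu>" "\<And>B. B \<in> sets \<mu> \<Longrightarrow> emeasure \<nu> B \<le> emeasure \<mu> B"
    "\<And>f. integrable \<mu> f \<Longrightarrow> \<Lambda> f = (\<integral>x. f x \<partial>\<nu>)"
proof -
  interpret finite_measure \<mu> by fact
  have diff: "\<Lambda> f - \<Lambda> g = \<Lambda> (\<lambda>x. f x - g x)" if "integrable \<mu> f" "integrable \<mu> g" for f g
    using add[of f "\<lambda>x. (-1) * g x"] scale[of g "-1"] that by simp
  have ind: "integrable \<mu> (indicator B :: 'a \<Rightarrow> real)" if "B \<in> sets \<mu>" for B
    using that by (simp add: emeasure_eq_measure)
  have ind_bound: "\<bar>\<Lambda> (indicator B)\<bar> \<le> measure \<mu> B" if "B \<in> sets \<mu>" for B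
    using bound[OF ind[OF that]] that sets.sets_into_space[OF that] by (simp add: Int_absorb2)
  have zero: "\<Lambda> (\<lambda>_. 0) = 0" using scale[of "\<lambda>_. 0" 0] by simp
  define \<nu> where "\<nu> = measure_of (space \<mu>) (sets \<mu>) (\<lambda>B. ennreal (\<Lambda> (indicator B)))"
  have em: "emeasure \<nu> B = ennreal (\<Lambda> (indicator B))" if "B \<in> sets \<mu>" for B
    unfolding \<nu>_def
  proof (rule emeasure_measure_of_sigma)
    show "sigma_algebra (space \<mu>) (sets \<mu>)" ..
    show "positive (sets \<mu>) (\<lambda>B. ennreal (\<Lambda> (indicator B)))"
      using ind_bound[of "{}"] by (simp add: positive_def)
    show "countably_additive (sets \<mu>) (\<lambda>B. ennreal (\<Lambda> (indicator B)))"
    proof (rule countably_additiveI)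
      fix A :: "nat \<Rightarrow> 'a set" assume A: "range A \<subseteq> sets \<mu>" "disjoint_family A" "\<Union>(range A) \<in> sets \<mu>"
      define V where "V n = (\<Union>i<n. A i)" for n
      have V: "V n \<in> sets \<mu>" for n using A(1) by (auto simp: V_def)
      have "A i \<inter> A n = {}" if "i < n" for i n using disjoint_family_onD[OF A(2), of i n] that by simp
      then have VA: "V n \<inter> A n = {}" for n unfolding V_def by blast
      have sumV: "(\<Sum>i<n. \<Lambda> (indicator (A i))) = \<Lambda> (indicator (V n))" for n
      proof (induction n)
        case 0
        show ?case using zero by (simp add: V_def indicator_def)
      next
        case (Suc n)
        have "V (Suc n) = V n \<union> A n" by (auto simp: V_def lessThan_Suc)
        then have "(indicator (V (Suc n)) :: 'a \<Rightarrow> real) = (\<lambda>x. indicator (V n) x + indicator (A n) x)"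
          using VA[of n] by (auto simp: fun_eq_iff indicator_def)
        then show ?case using Suc add[OF ind[OF V] ind, of "A n" n] A(1) by auto
      qed
      have "(\<lambda>n. \<Lambda> (indicator (V n))) \<longlonglongrightarrow> \<Lambda> (indicator (\<Union>(range A)))"
      proof (rule LIM_zero_cancel, rule Lim_null_comparison)
        have "norm (\<Lambda> (indicator (V n)) - \<Lambda> (indicator (\<Union>(range A)))) \<le> measure \<mu> (\<Union>(range A)) - measure \<mu> (V n)" for n
        proof -
          have sub: "V n \<subseteq> \<Union>(range A)" by (auto simp: V_def)
          have "\<Lambda> (indicator (\<Union>(range A))) - \<Lambda> (indicator (V n)) = \<Lambda> (\<lambda>x. indicator (\<Union>(range A)) x - indicator (V n) x)"
            by (rule diff[OF ind[OF A(3)] ind[OF V]])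
          also have "(\<lambda>x. indicator (\<Union>(range A)) x - indicator (V n) x :: real) = indicator (\<Union>(range A) - V n)"
            using sub by (auto simp: indicator_def fun_eq_iff)
          finally show ?thesis
            using ind_bound[OF sets.Diff[OF A(3) V[of n]]] finite_measure_Diff[OF A(3) V sub] by (simp add: abs_minus_commute)
        qed
        then show "\<forall>\<^sub>F n in sequentially. norm (\<Lambda> (indicator (V n)) - \<Lambda> (indicator (\<Union>(range A))))
            \<le> measure \<mu> (\<Union>(range A)) - measure \<mu> (V n)" by simp
        have "(\<lambda>n. measure \<mu> (V n)) \<longlonglongrightarrow> measure \<mu> (\<Union>n. V n)"
        proof (intro finite_Lim_measure_incseq)
          show "incseq V" unfolding incseq_def V_def by (intro allI impI UN_mono) auto
        qed (use V in auto)
        moreover have "(\<Union>n. V n) = \<Union>(range A)" by (auto simp: V_def)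
        ultimately show "(\<lambda>n. measure \<mu> (\<Union>(range A)) - measure \<mu> (V n)) \<longlonglongrightarrow> 0"
          using tendsto_diff[OF tendsto_const, of "\<lambda>n. measure \<mu> (V n)" "measure \<mu> (\<Union>(range A))" sequentially "measure \<mu> (\<Union>(range A))"] by simp
      qed
      then have "(\<lambda>i. \<Lambda> (indicator (A i))) sums \<Lambda> (indicator (\<Union>(range A)))"
        unfolding sums_def sumV .
      then show "(\<Sum>i. ennreal (\<Lambda> (indicator (A i)))) = ennreal (\<Lambda> (indicator (\<Union>(range A))))"
        using A(1) by (intro suminf_ennreal_eq nonneg ind) auto
    qed
  qed (rule that)
  have sets [measurable_cong]: "sets \<nu> = sets \<mu>" unfolding \<nu>_def by simp
  have le: "emeasure \<nu> B \<le> emeasure \<mu> B" if "B \<in> sets \<mu>" for B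
    using ind_bound[OF that] em[OF that] by (simp add: emeasure_eq_measure ennreal_leI)
  have int: "integrable \<nu> f" if "integrable \<mu> f" for f :: "'a \<Rightarrow> real"
  proof -
    have "(\<integral>\<^sup>+x. ennreal (norm (f x)) \<partial>\<nu>) \<le> (\<integral>\<^sup>+x. ennreal (norm (f x)) \<partial>\<mu>)"
      by (rule nn_integral_mono_measure) (use sets le in \<open>auto simp: le_measure\<close>)
    also have "\<dots> < \<infinity>" using that by (simp add: integrable_iff_bounded)
    finally show ?thesis using that sets by (auto simp: integrable_iff_bounded cong: measurable_cong_sets)
  qed
  have "\<Lambda> f = (\<integral>x. f x \<partial>\<nu>)" if "integrable \<mu> f" for f
    using that
  proof (induction rule: integrable_induct)
    case (base B c)
    have "\<Lambda> (indicator B) = measure \<nu> B"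
      using em[OF base(1)] nonneg[OF ind[OF base(1)]] by (simp add: measure_def)
    moreover have "B \<inter> space \<nu> = B"
      using sets.sets_into_space[OF base(1)] sets_eq_imp_space_eq[OF sets] by (simp add: Int_absorb2)
    ultimately show ?case using scale[OF ind[OF base(1)], of c] by (simp add: mult.commute)
  next
    case (add f g)
    then show ?case using assms(2) int by simp
  next
    case (lim f s)
    have b: "integrable \<mu> (\<lambda>x. 2 * norm (f x))" using lim(4) by simp
    have "(\<lambda>i. \<integral>x. s i x \<partial>\<nu>) \<longlonglongrightarrow> (\<integral>x. f x \<partial>\<nu>)"
    proof (rule integral_dominated_convergence[OF _ _ int[OF b]])
      show "f \<in> borel_measurable \<nu>" "s i \<in> borel_measurable \<nu>" for i using int lim by auto
    qed (use lim sets_eq_imp_space_eq[OF sets] in auto)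
    moreover have "(\<lambda>i. \<Lambda> (s i)) \<longlonglongrightarrow> \<Lambda> f"
    proof (rule LIM_zero_cancel, rule Lim_null_comparison)
      have "norm (\<Lambda> (s i) - \<Lambda> f) \<le> (\<integral>x. \<bar>s i x - f x\<bar> \<partial>\<mu>)" for i
        unfolding diff[OF lim(1,4)] using bound[of "\<lambda>x. s i x - f x"] lim(1,4) by simp
      then show "\<forall>\<^sub>F i in sequentially. norm (\<Lambda> (s i) - \<Lambda> f) \<le> (\<integral>x. \<bar>s i x - f x\<bar> \<partial>\<mu>)"
        by simp
      have "(\<lambda>i. \<integral>x. \<bar>s i x - f x\<bar> \<partial>\<mu>) \<longlonglongrightarrow> (\<integral>x. 0 \<partial>\<mu>)"
      proof (rule integral_dominated_convergence[where w="\<lambda>x. 3 * norm (f x)"])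
        show "AE x in \<mu>. (\<lambda>i. \<bar>s i x - f x\<bar>) \<longlonglongrightarrow> 0"
          using lim(2) by (intro AE_I2 tendsto_rabs_zero LIM_zero) auto
        show "AE x in \<mu>. norm \<bar>s i x - f x\<bar> \<le> 3 * norm (f x)" for i
        proof (rule AE_I2)
          fix x assume "x \<in> space \<mu>"
          from lim(3)[OF this, of i] show "norm \<bar>s i x - f x\<bar> \<le> 3 * norm (f x)" by simp
        qed
      qed (use lim in auto)
      then show "(\<lambda>i. \<integral>x. \<bar>s i x - f x\<bar> \<partial>\<mu>) \<longlonglongrightarrow> 0" by simp
    qed
    ultimately show ?case using lim(5) LIMSEQ_unique by auto
  qed
  then show ?thesis using that sets le by blast
qed

lemma nn_integral_diff_measure:
  assumes fin: "finite_measure \<mu>" "finite_measure \<nu>" and sets [measurable_cong]: "sets \<mu> = sets \<nu>"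
    and le: "\<And>B. B \<in> sets \<mu> \<Longrightarrow> emeasure \<nu> B \<le> emeasure \<mu> B"
    and f: "f \<in> borel_measurable \<mu>"
  shows "(\<integral>\<^sup>+x. f x \<partial>\<mu>) = (\<integral>\<^sup>+x. f x \<partial>\<nu>) + (\<integral>\<^sup>+x. f x \<partial>diff_measure \<mu> \<nu>)"
  using f
proof (induction rule: borel_measurable_induct)
  case (cong f g)
  have "integral\<^sup>N m f = integral\<^sup>N m g" if "space m = space \<mu>" for m
    using cong(3) that by (intro nn_integral_cong) simp
  moreover have "space \<nu> = space \<mu>" using sets_eq_imp_space_eq[OF sets] by simp
  ultimately show ?case using cong.IH by simp
next
  case (set B)
  have "emeasure (diff_measure \<mu> \<nu>) B = emeasure \<mu> B - emeasure \<nu> B"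
    by (rule emeasure_diff_measure[OF fin sets le set])
  moreover have "B \<in> sets \<nu>" "B \<in> sets (diff_measure \<mu> \<nu>)" using set sets by auto
  ultimately show ?case
    using add_diff_inverse_ennreal[OF le[OF set]] by (simp only: nn_integral_indicator set)
next
  case (mult u c)
  then have "u \<in> borel_measurable \<nu>" "u \<in> borel_measurable (diff_measure \<mu> \<nu>)" by (auto cong: measurable_cong_sets)
  then show ?case using mult by (simp add: nn_integral_cmult distrib_left)
next
  case (add u v)
  then have "u \<in> borel_measurable \<nu>" "u \<in> borel_measurable (diff_measure \<mu> \<nu>)"
    "v \<in> borel_measurable \<nu>" "v \<in> borel_measurable (diff_measure \<mu> \<nu>)" by (auto cong: measurable_cong_sets)
  then show ?case using add by (simp add: nn_integral_add algebra_simps)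
next
  case (seq u)
  then have m: "\<And>i. u i \<in> borel_measurable \<nu>" "\<And>i. u i \<in> borel_measurable (diff_measure \<mu> \<nu>)"
    by (auto cong: measurable_cong_sets)
  have inc: "incseq (\<lambda>i. \<integral>\<^sup>+x. u i x \<partial>m)" for m
    using seq(3) by (auto simp: incseq_def le_fun_def intro!: nn_integral_mono)
  have "(\<integral>\<^sup>+x. (SUP i. u i) x \<partial>m) = (SUP i. \<integral>\<^sup>+x. u i x \<partial>m)" if "\<And>i. u i \<in> borel_measurable m" for m
    using nn_integral_monotone_convergence_SUP[OF seq(3), of m] that by (simp add: image_comp)
  then show ?case using seq m by (simp add: ennreal_SUP_add[OF inc inc] seq.IH image_comp)
qed

lemma transition_prob_eq_mean_step:
  fixes A :: "'e::finite \<Rightarrow> real^'d^'d::finite"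
  assumes lam: "lam > 0" and P: "switching_matrix P" and B [measurable]: "B \<in> sets state_space"
  shows "transition_prob A P lam \<tau> z B = ennreal (mean_step P lam \<tau> (\<lambda>x. indicator B (next_state A x)) z)"
proof -
  interpret d: prob_space "dwell lam \<tau>" using prob_space_dwell[OF lam] .
  have "(\<integral>\<^sup>+ t. indicator B (next_state A (z, t, j)) \<partial>dwell lam \<tau>) = ennreal (\<integral>t. indicator B (next_state A (z, t, j)) \<partial>dwell lam \<tau>)" for j
  proof -
    have "ennreal (\<integral>t. indicator B (next_state A (z, t, j)) \<partial>dwell lam \<tau>)
        = (\<integral>\<^sup>+ t. ennreal (indicator B (next_state A (z, t, j))) \<partial>dwell lam \<tau>)"
      by (rule nn_integral_eq_integral[symmetric])
        (auto intro!: d.integrable_const_bound[where B=1] simp: indicator_def)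
    then show ?thesis by (simp add: ennreal_indicator)
  qed
  moreover have "transition_prob A P lam \<tau> z B = (\<Sum>j\<in>UNIV. ennreal (P (snd z) j) *
      (\<integral>\<^sup>+ t. indicator B (next_state A (z, t, j)) \<partial>dwell lam \<tau>))"
    unfolding transition_prob_def dwell_def next_state_def
    by (auto simp: nn_integral_density case_prod_beta mult.commute)
  ultimately show ?thesis
    unfolding mean_step_def using switching_matrixD(4)[OF P]
    by (simp add: ennreal_mult sum_ennreal[symmetric] sum_nonneg Bochner_Integration.integral_nonneg)
qed

text \<open>If \<open>\<nu>\<close> has mass \<open>c\<close> strictly between 0 and 1, then \<open>\<mu>\<close> is the convex combination of the normalisations of
  \<open>\<nu>\<close> and of \<open>\<mu> - \<nu>\<close>, both invariant, and extremality of \<open>\<mu>\<close> identifies them.\<close>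

lemma dominated_invariant_multiple:
  fixes A :: "'e::finite \<Rightarrow> real^'d^'d::finite"
  assumes lam: "lam > 0" and P: "switching_matrix P"
    and erg: "ergodic_invariant_measure A P lam \<tau> \<mu>"
    and sets: "sets \<nu> = sets \<mu>" and le: "\<And>B. B \<in> sets \<mu> \<Longrightarrow> emeasure \<nu> B \<le> emeasure \<mu> B"
    and inv: "\<And>B. B \<in> sets \<mu> \<Longrightarrow> emeasure \<nu> B = (\<integral>\<^sup>+ z. transition_prob A P lam \<tau> z B \<partial>\<nu>)"
    and B: "B \<in> sets \<mu>"
  shows "measure \<nu> B = measure \<nu> UNIV * measure \<mu> B"
proof -
  have \<mu>: "invariant_measure A P lam \<tau> \<mu>" using erg by (simp add: ergodic_invariant_measure_def)
  interpret m: prob_space \<mu> using invariant_measureD(1)[OF \<mu>] .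
  have sm: "sets \<mu> = sets state_space" by (rule invariant_measureD(2)[OF \<mu>])
  note [measurable_cong] = sm
  have sp: "space \<mu> = UNIV" "space \<nu> = UNIV" using state_space_sets[of \<mu>] state_space_sets[of \<nu>] sm sets by auto
  have U: "UNIV \<in> sets \<mu>" using sets.top[of \<mu>] sp by simp
  have fin: "finite_measure \<nu>"
    using le[OF U] by (intro finite_measureI) (auto simp: sp m.emeasure_eq_measure top_unique)
  interpret n: finite_measure \<nu> by fact
  have mle: "measure \<nu> C \<le> measure \<mu> C" if "C \<in> sets \<mu>" for C
    using le[OF that] by (simp add: m.emeasure_eq_measure n.emeasure_eq_measure)
  define c where "c = measure \<nu> UNIV"
  have c: "0 \<le> c" "c \<le> 1" using mle[OF U] m.prob_space sp by (auto simp: c_def)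
  have mc: "measure \<nu> C \<le> c" if "C \<in> sets \<mu>" for C
    unfolding c_def using n.finite_measure_mono[of C UNIV] U sets by simp
  consider "c = 0" | "c = 1" | "0 < c" "c < 1" using c by linarith
  then show ?thesis
  proof cases
    case 1
    then show ?thesis using mc[OF B] measure_nonneg[of \<nu> B] by (simp add: c_def)
  next
    case 2
    have "measure \<nu> (UNIV - B) \<le> measure \<mu> (UNIV - B)" by (intro mle sets.Diff U B)
    moreover have "measure \<nu> (UNIV - B) = c - measure \<nu> B" "measure \<mu> (UNIV - B) = 1 - measure \<mu> B"
      using n.finite_measure_compl[of B] m.prob_compl[of B] B sets sp by (auto simp: c_def)
    ultimately have "measure \<nu> B = measure \<mu> B" using 2 mle[OF B] by simp
    then show ?thesis using 2 by (simp add: c_def)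
  next
    case 3
    have tm: "(\<lambda>z. transition_prob A P lam \<tau> z C) \<in> borel_measurable \<mu>" if "C \<in> sets \<mu>" for C
    proof -
      have [measurable]: "C \<in> sets state_space" using that sm by simp
      have "mean_step P lam \<tau> (\<lambda>x. indicator C (next_state A x)) \<in> borel_measurable state_space"
        by (intro measurable_mean_step lam) measurable
      then show ?thesis using transition_prob_eq_mean_step[OF lam P, of C A \<tau>] that sm by simp
    qed
    define \<mu>1 where "\<mu>1 = scale_measure (ennreal (1 / c)) \<nu>"
    define \<mu>2 where "\<mu>2 = scale_measure (ennreal (1 / (1 - c))) (diff_measure \<mu> \<nu>)"
    have e1: "emeasure \<mu>1 C = ennreal (measure \<nu> C / c)" for C
      using c by (simp add: \<mu>1_def n.emeasure_eq_measure ennreal_mult[symmetric])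
    have ed: "emeasure (diff_measure \<mu> \<nu>) C = ennreal (measure \<mu> C - measure \<nu> C)" if "C \<in> sets \<mu>" for C
      using emeasure_diff_measure[OF m.finite_measure_axioms fin sets[symmetric] le that]
      by (simp add: m.emeasure_eq_measure n.emeasure_eq_measure ennreal_minus)
    have e2: "emeasure \<mu>2 C = ennreal ((measure \<mu> C - measure \<nu> C) / (1 - c))" if "C \<in> sets \<mu>" for C
      using ed[OF that] 3 by (simp add: \<mu>2_def ennreal_mult[symmetric] mle[OF that])
    have "invariant_measure A P lam \<tau> \<mu>1"
      unfolding invariant_measure_def
    proof (intro conjI ballI)
      show "prob_space \<mu>1" using 3 e1[of UNIV] sp by (intro prob_spaceI) (simp add: \<mu>1_def space_scale_measure c_def[symmetric])
      show "sets \<mu>1 = sets state_space" using sets sm by (simp add: \<mu>1_def)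
      fix C :: "('d proj_space \<times> 'e) set" assume "C \<in> sets state_space"
      then have C: "C \<in> sets \<mu>" using sm by simp
      show "emeasure \<mu>1 C = (\<integral>\<^sup>+ z. transition_prob A P lam \<tau> z C \<partial>\<mu>1)"
        unfolding \<mu>1_def using inv[OF C] tm[OF C] sets
        by (subst nn_integral_scale_measure) (auto cong: measurable_cong_sets)
    qed
    moreover have "invariant_measure A P lam \<tau> \<mu>2"
      unfolding invariant_measure_def
    proof (intro conjI ballI)
      show "prob_space \<mu>2" using 3 e2[OF U] sp m.prob_space
        by (intro prob_spaceI) (simp add: \<mu>2_def space_scale_measure c_def[symmetric])
      show "sets \<mu>2 = sets state_space" using sm by (simp add: \<mu>2_def)
      fix C :: "('d proj_space \<times> 'e) set" assume "C \<in> sets state_space"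
      then have C: "C \<in> sets \<mu>" using sm by simp
      have "emeasure \<nu> C + (\<integral>\<^sup>+ z. transition_prob A P lam \<tau> z C \<partial>diff_measure \<mu> \<nu>)
          = emeasure \<mu> C"
        using nn_integral_diff_measure[OF m.finite_measure_axioms fin sets[symmetric] le tm[OF C]]
          inv[OF C] invariant_measureD(3)[OF \<mu>, of C] C sm by simp
      also have "\<dots> = emeasure \<nu> C + emeasure (diff_measure \<mu> \<nu>) C"
        using ed[OF C] mle[OF C] by (simp add: m.emeasure_eq_measure n.emeasure_eq_measure ennreal_plus[symmetric] del: ennreal_plus)
      finally have "(\<integral>\<^sup>+ z. transition_prob A P lam \<tau> z C \<partial>diff_measure \<mu> \<nu>) = emeasure (diff_measure \<mu> \<nu>) C"
        by (simp add: n.emeasure_eq_measure ennreal_add_left_cancel)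
      then show "emeasure \<mu>2 C = (\<integral>\<^sup>+ z. transition_prob A P lam \<tau> z C \<partial>\<mu>2)"
        unfolding \<mu>2_def using tm[OF C]
        by (subst nn_integral_scale_measure) (auto cong: measurable_cong_sets)
    qed
    moreover have "\<forall>C\<in>sets state_space. measure \<mu> C = c * measure \<mu>1 C + (1 - c) * measure \<mu>2 C"
    proof
      fix C :: "('d proj_space \<times> 'e) set" assume "C \<in> sets state_space"
      then have C: "C \<in> sets \<mu>" using sm by simp
      have "measure \<mu>1 C = measure \<nu> C / c" using e1[of C] c by (simp add: measure_def)
      moreover have "measure \<mu>2 C = (measure \<mu> C - measure \<nu> C) / (1 - c)"
        using e2[OF C] 3 mle[OF C] by (simp add: measure_def[of \<mu>2])
      ultimately show "measure \<mu> C = c * measure \<mu>1 C + (1 - c) * measure \<mu>2 C" using 3 by simp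
    qed
    ultimately have "\<mu>1 = \<mu>2" using erg 3 unfolding ergodic_invariant_measure_def by blast
    then have "ennreal (measure \<nu> B / c) = ennreal ((measure \<mu> B - measure \<nu> B) / (1 - c))"
      using e1[of B] e2[OF B] by simp
    then have "measure \<nu> B / c = (measure \<mu> B - measure \<nu> B) / (1 - c)"
      using 3 mle[OF B] by (subst (asm) ennreal_inj) auto
    then have "measure \<nu> B = c * measure \<mu> B" using 3 by (simp add: field_simps)
    then show ?thesis by (simp add: c_def)
  qed
qed

section \<open>Time averages along the process\<close>

context standard_switching_process
begin

context
  fixes \<mu> :: "('d proj_space \<times> 'e) measure" and i :: 'e
  assumes \<mu>: "invariant_measure A P lam \<tau> \<mu>"
begin

interpretation m: prob_space \<mu>
  by (rule invariant_measureD(1)[OF \<mu>])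

interpretation N: pair_prob_space \<mu> M ..

lemma sets_invariant [measurable_cong]: "sets \<mu> = sets state_space"
  by (rule invariant_measureD(2)[OF \<mu>])

lemma space_invariant: "space \<mu> = UNIV"
  by (rule state_space_sets(1)[OF sets_invariant])

text \<open>Points are pairs of a state \<open>z\<close> drawn from \<open>\<mu>\<close> and an outcome of the process, which are independent.
  On this event the mode of \<open>z\<close> is the initial mode of the process, so the process may be regarded as
  started at \<open>z\<close>; the mode is fixed because the law of \<open>L 0\<close> is arbitrary.\<close>

definition same_mode :: "(('d proj_space \<times> 'e) \<times> 'w) set" where
  "same_mode = {x \<in> space (\<mu> \<Otimes>\<^sub>M M). snd (fst x) = i \<and> L 0 (snd x) = i}"

lemma same_mode_sets [measurable]: "same_mode \<in> sets (\<mu> \<Otimes>\<^sub>M M)"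
  unfolding same_mode_def by measurable

text \<open>Up to the probability of \<open>L 0 = i\<close>, the law of the state is that of the chain started from the part of
  \<open>\<mu>\<close> in mode \<open>i\<close>, which is below the chain started from the invariant measure \<open>\<mu>\<close>.\<close>

lemma state_law_dominated:
  assumes B [measurable]: "B \<in> sets state_space"
  shows "measure (\<mu> \<Otimes>\<^sub>M M) {x \<in> same_mode. state (fst (fst x)) n (snd x) \<in> B} \<le> measure \<mu> B"
proof -
  let ?T = "\<lambda>\<phi>. mean_step P lam \<tau> (\<lambda>x. \<phi> (next_state A x))"
  have T: "(?T ^^ n) (indicator B) \<in> borel_measurable state_space \<and>
      (\<forall>z. 0 \<le> (?T ^^ n) (indicator B) z \<and> (?T ^^ n) (indicator B) z \<le> 1) \<and>
      (\<integral>z. (?T ^^ n) (indicator B) z \<partial>\<mu>) = measure \<mu> B" for n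
  proof (induction n)
    case 0
    then show ?case using B sets_invariant by (simp add: indicator_def[abs_def] space_invariant)
        (simp flip: indicator_def add: space_invariant)
  next
    case (Suc n)
    let ?\<phi> = "(?T ^^ n) (indicator B)"
    have [measurable]: "?\<phi> \<in> borel_measurable state_space" using Suc by blast
    have ph: "0 \<le> ?\<phi> z" "?\<phi> z \<le> 1" for z using Suc by blast+
    have "?T ?\<phi> \<in> borel_measurable state_space" by (intro measurable_mean_step lam_pos) measurable
    moreover have "0 \<le> ?T ?\<phi> z" "?T ?\<phi> z \<le> 1" for z
      by (intro mean_step_bounded lam_pos switching ph)+
    moreover have "(\<integral>z. ?T ?\<phi> z \<partial>\<mu>) = (\<integral>z. ?\<phi> z \<partial>\<mu>)"
    proof (rule integral_mean_step[OF lam_pos switching \<mu>])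
      show "\<bar>?\<phi> z\<bar> \<le> 1" for z using ph[of z] by simp
    qed measurable
    ultimately show ?case using Suc by simp
  qed
  let ?R = "{x \<in> same_mode. state (fst (fst x)) n (snd x) \<in> B}"
  have R [measurable]: "?R \<in> sets (\<mu> \<Otimes>\<^sub>M M)"
  proof -
    have "?R = {x \<in> space (\<mu> \<Otimes>\<^sub>M M). x \<in> same_mode \<and> state (fst (fst x)) n (snd x) \<in> B}"
      using sets.sets_into_space[OF same_mode_sets] by auto
    also have "\<dots> \<in> sets (\<mu> \<Otimes>\<^sub>M M)" by measurable
    finally show ?thesis .
  qed
  have "measure (\<mu> \<Otimes>\<^sub>M M) ?R = (\<integral>x. indicator ?R x \<partial>(\<mu> \<Otimes>\<^sub>M M))"
    using R sets.sets_into_space[OF R] by (simp add: Int_absorb2)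
  also have "\<dots> = (\<integral>z. \<integral>\<omega>. indicator ?R (z, \<omega>) \<partial>M \<partial>\<mu>)"
    by (subst N.integral_fst'[symmetric]) (auto intro!: N.P.integrable_const_bound[where B=1] simp: indicator_def)
  also have "\<dots> = (\<integral>z. indicator {i} (snd z) * (prob {\<omega> \<in> space M. L 0 \<omega> = i} * (?T ^^ n) (indicator B) z) \<partial>\<mu>)"
  proof (intro Bochner_Integration.integral_cong refl)
    fix z
    have "(\<integral>\<omega>. indicator ?R (z, \<omega>) \<partial>M) = (\<integral>\<omega>. (indicator {i} (snd z) :: real) * (indicator {i} (L 0 \<omega>) * indicator B (state (fst z) n \<omega>)) \<partial>M)"
      by (intro Bochner_Integration.integral_cong) (auto simp: indicator_def same_mode_def space_pair_measure space_invariant)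
    also have "\<dots> = indicator {i} (snd z) * (prob {\<omega> \<in> space M. L 0 \<omega> = i} * (?T ^^ n) (indicator B) (fst z, i))"
      by (subst Bochner_Integration.integral_mult_right_zero) (use integral_state[of "indicator B" i "fst z" n] in simp)
    also have "\<dots> = indicator {i} (snd z) * (prob {\<omega> \<in> space M. L 0 \<omega> = i} * (?T ^^ n) (indicator B) z)"
      by (cases "snd z = i") (auto simp: indicator_def)
    finally show "(\<integral>\<omega>. indicator ?R (z, \<omega>) \<partial>M) = indicator {i} (snd z) * (prob {\<omega> \<in> space M. L 0 \<omega> = i} * (?T ^^ n) (indicator B) z)" .
  qed
  also have "\<dots> \<le> (\<integral>z. (?T ^^ n) (indicator B) z \<partial>\<mu>)"
  proof (rule integral_mono)
    have [measurable]: "(?T ^^ n) (indicator B) \<in> borel_measurable state_space" using T by blast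
    have Tz: "0 \<le> (?T ^^ n) (indicator B) z" "(?T ^^ n) (indicator B) z \<le> 1" for z using T by blast+
    have b: "prob {\<omega> \<in> space M. L 0 \<omega> = i} * (?T ^^ n) (indicator B) z \<le> (?T ^^ n) (indicator B) z" for z
      by (intro mult_left_le_one_le Tz) auto
    show le: "indicator {i} (snd z) * (prob {\<omega> \<in> space M. L 0 \<omega> = i} * (?T ^^ n) (indicator B) z) \<le> (?T ^^ n) (indicator B) z" for z
      using b[of z] Tz(1)[of z] by (simp add: indicator_def)
    show i1: "integrable \<mu> ((?T ^^ n) (indicator B))"
      by (intro m.integrable_const_bound[where B=1] AE_I2) (use Tz in \<open>simp, measurable\<close>)
    show "integrable \<mu> (\<lambda>z. indicator {i} (snd z) * (prob {\<omega> \<in> space M. L 0 \<omega> = i} * (?T ^^ n) (indicator B) z))"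
    proof (rule Bochner_Integration.integrable_bound[OF i1 _ AE_I2])
      show "norm (indicator {i} (snd z) * (prob {\<omega> \<in> space M. L 0 \<omega> = i} * (?T ^^ n) (indicator B) z))
          \<le> norm ((?T ^^ n) (indicator B) z)" for z
        using le[of z] Tz(1)[of z] by (simp add: zero_le_mult_iff)
    qed measurable
  qed
  also have "\<dots> = measure \<mu> B" using T by blast
  finally show ?thesis .
qed

lemma nn_integral_state_dominated:
  assumes phi [measurable]: "\<phi> \<in> borel_measurable state_space"
  shows "(\<integral>\<^sup>+x. indicator same_mode x * \<phi> (state (fst (fst x)) n (snd x)) \<partial>(\<mu> \<Otimes>\<^sub>M M)) \<le> (\<integral>\<^sup>+z. \<phi> z \<partial>\<mu>)"
proof -
  let ?s = "\<lambda>x. state (fst (fst x)) n (snd x)"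
  define \<rho> where "\<rho> = distr (density (\<mu> \<Otimes>\<^sub>M M) (indicator same_mode)) \<mu> ?s"
  have s [measurable]: "?s \<in> measurable (\<mu> \<Otimes>\<^sub>M M) \<mu>" by measurable
  have "emeasure \<rho> B \<le> emeasure \<mu> B" if B: "B \<in> sets \<mu>" for B
  proof -
    have "emeasure \<rho> B = emeasure (\<mu> \<Otimes>\<^sub>M M) (same_mode \<inter> (?s -` B \<inter> space (\<mu> \<Otimes>\<^sub>M M)))"
      unfolding \<rho>_def using measurable_sets[OF s B]
      by (subst emeasure_distr) (auto simp: B intro!: emeasure_restricted)
    also have "same_mode \<inter> (?s -` B \<inter> space (\<mu> \<Otimes>\<^sub>M M)) = {x \<in> same_mode. ?s x \<in> B}"
      using sets.sets_into_space[OF same_mode_sets] by auto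
    finally show ?thesis
      using state_law_dominated[of B n] B sets_invariant by (simp add: m.emeasure_eq_measure N.P.emeasure_eq_measure)
  qed
  then have "(\<integral>\<^sup>+z. \<phi> z \<partial>\<rho>) \<le> (\<integral>\<^sup>+z. \<phi> z \<partial>\<mu>)"
    by (intro nn_integral_mono_measure) (auto simp: \<rho>_def le_measure)
  moreover have "(\<integral>\<^sup>+z. \<phi> z \<partial>\<rho>) = (\<integral>\<^sup>+x. indicator same_mode x * \<phi> (?s x) \<partial>(\<mu> \<Otimes>\<^sub>M M))"
    unfolding \<rho>_def by (subst nn_integral_distr) (auto simp: nn_integral_density)
  ultimately show ?thesis by simp
qed

lemma integrable_state:
  fixes \<phi> :: "'d proj_space \<times> 'e \<Rightarrow> real"
  assumes phi: "integrable \<mu> \<phi>" and E [measurable]: "E \<in> sets (\<mu> \<Otimes>\<^sub>M M)" "E \<subseteq> same_mode"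
  shows "integrable (\<mu> \<Otimes>\<^sub>M M) (\<lambda>x. indicator E x * \<phi> (state (fst (fst x)) n (snd x)))"
    and "\<bar>\<integral>x. indicator E x * \<phi> (state (fst (fst x)) n (snd x)) \<partial>(\<mu> \<Otimes>\<^sub>M M)\<bar> \<le> (\<integral>z. \<bar>\<phi> z\<bar> \<partial>\<mu>)"
proof -
  have [measurable]: "\<phi> \<in> borel_measurable state_space"
    using borel_measurable_integrable[OF phi] sets_invariant by (simp cong: measurable_cong_sets)
  let ?f = "\<lambda>x. indicator E x * \<phi> (state (fst (fst x)) n (snd x))"
  have "(\<integral>\<^sup>+x. ennreal (norm (?f x)) \<partial>(\<mu> \<Otimes>\<^sub>M M))
      \<le> (\<integral>\<^sup>+x. indicator same_mode x * ennreal \<bar>\<phi> (state (fst (fst x)) n (snd x))\<bar> \<partial>(\<mu> \<Otimes>\<^sub>M M))"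
    using E(2) by (intro nn_integral_mono) (auto simp: indicator_def)
  also have "\<dots> \<le> (\<integral>\<^sup>+z. ennreal \<bar>\<phi> z\<bar> \<partial>\<mu>)" by (rule nn_integral_state_dominated) measurable
  also have "\<dots> = ennreal (\<integral>z. \<bar>\<phi> z\<bar> \<partial>\<mu>)" using phi by (intro nn_integral_eq_integral) auto
  finally have b: "(\<integral>\<^sup>+x. ennreal (norm (?f x)) \<partial>(\<mu> \<Otimes>\<^sub>M M)) \<le> ennreal (\<integral>z. \<bar>\<phi> z\<bar> \<partial>\<mu>)" .
  show i: "integrable (\<mu> \<Otimes>\<^sub>M M) ?f"
    using b by (intro integrableI_bounded) (auto simp: le_less_trans)
  have "ennreal (norm (integral\<^sup>L (\<mu> \<Otimes>\<^sub>M M) ?f)) \<le> (\<integral>\<^sup>+x. ennreal (norm (?f x)) \<partial>(\<mu> \<Otimes>\<^sub>M M))"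
    by (rule integral_norm_bound_ennreal[OF i])
  also note b
  finally show "\<bar>integral\<^sup>L (\<mu> \<Otimes>\<^sub>M M) ?f\<bar> \<le> (\<integral>z. \<bar>\<phi> z\<bar> \<partial>\<mu>)"
    by (subst (asm) ennreal_le_iff) (auto intro: Bochner_Integration.integral_nonneg)
qed

text \<open>By the second moment bound the first absolute moment of the sum of \<open>n\<close> centred increments has order
  \<open>\<surd>n\<close>, and restriction to events does not increase it.\<close>

lemma centred_average:
  assumes psi [measurable]: "\<psi> \<in> borel_measurable step_space"
    and b: "\<And>z t j. \<bar>\<psi> (z, t, j)\<bar> \<le> K * (1 + \<bar>t\<bar>)"
    and centred: "\<And>z. mean_step P lam \<tau> \<psi> z = 0"
    and E [measurable]: "\<And>n. E n \<in> sets (\<mu> \<Otimes>\<^sub>M M)"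
  shows "\<And>n. integrable (\<mu> \<Otimes>\<^sub>M M) (\<lambda>x. indicator (E n) x * path_sum \<psi> (fst (fst x)) n (snd x))"
    and "(\<lambda>n. (1 / real n) * (\<integral>x. indicator (E n) x * path_sum \<psi> (fst (fst x)) n (snd x) \<partial>(\<mu> \<Otimes>\<^sub>M M))) \<longlonglongrightarrow> 0"
proof -
  define C where "C = K\<^sup>2 * (\<integral>t. (1 + \<bar>t\<bar>)\<^sup>2 \<partial>dwell lam \<tau>)"
  let ?f = "\<lambda>n x. indicator (E n) x * path_sum \<psi> (fst (fst x)) n (snd x)"
  have C: "C \<ge> 0" unfolding C_def by (intro mult_nonneg_nonneg Bochner_Integration.integral_nonneg) auto
  have one: "(\<integral>\<^sup>+\<omega>. ennreal \<bar>path_sum \<psi> q n \<omega>\<bar> \<partial>M) \<le> ennreal (sqrt n * (C + 1))" for q n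
  proof (cases "n = 0")
    case False
    have sq: "integrable M (\<lambda>\<omega>. (path_sum \<psi> q n \<omega>)\<^sup>2)" "(\<integral>\<omega>. (path_sum \<psi> q n \<omega>)\<^sup>2 \<partial>M) \<le> n * C"
      using path_sum_second_moment[OF psi b centred, of q n] by (auto simp: C_def)
    have pw: "\<bar>path_sum \<psi> q n \<omega>\<bar> \<le> (path_sum \<psi> q n \<omega>)\<^sup>2 / sqrt n + sqrt n" for \<omega>
    proof -
      have "2 * (\<bar>path_sum \<psi> q n \<omega>\<bar> * sqrt n) \<le> (path_sum \<psi> q n \<omega>)\<^sup>2 + sqrt n * sqrt n"
        using sum_squares_bound[of "\<bar>path_sum \<psi> q n \<omega>\<bar>" "sqrt n"] by (simp add: mult.assoc)
      moreover have "0 \<le> \<bar>path_sum \<psi> q n \<omega>\<bar> * sqrt n" by simp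
      ultimately have "\<bar>path_sum \<psi> q n \<omega>\<bar> * sqrt n \<le> (path_sum \<psi> q n \<omega>)\<^sup>2 + sqrt n * sqrt n"
        by linarith
      then show ?thesis using False by (simp add: field_simps)
    qed
    have "(\<integral>\<^sup>+\<omega>. ennreal \<bar>path_sum \<psi> q n \<omega>\<bar> \<partial>M) \<le> (\<integral>\<^sup>+\<omega>. ennreal ((path_sum \<psi> q n \<omega>)\<^sup>2 / sqrt n + sqrt n) \<partial>M)"
      by (intro nn_integral_mono ennreal_leI pw)
    also have "\<dots> = ennreal (\<integral>\<omega>. (path_sum \<psi> q n \<omega>)\<^sup>2 / sqrt n + sqrt n \<partial>M)"
      using sq by (intro nn_integral_eq_integral) auto
    also have "(\<integral>\<omega>. (path_sum \<psi> q n \<omega>)\<^sup>2 / sqrt n + sqrt n \<partial>M) = (\<integral>\<omega>. (path_sum \<psi> q n \<omega>)\<^sup>2 \<partial>M) / sqrt n + sqrt n"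
      using sq(1) prob_space by simp
    also have "ennreal \<dots> \<le> ennreal (sqrt n * (C + 1))"
    proof (rule ennreal_leI)
      have "(\<integral>\<omega>. (path_sum \<psi> q n \<omega>)\<^sup>2 \<partial>M) / sqrt n \<le> (n * C) / sqrt n" using sq by (intro divide_right_mono) auto
      also have "\<dots> = sqrt n * C" by (simp add: real_div_sqrt flip: times_divide_eq_left)
      finally show "(\<integral>\<omega>. (path_sum \<psi> q n \<omega>)\<^sup>2 \<partial>M) / sqrt n + sqrt n \<le> sqrt n * (C + 1)" by (simp add: algebra_simps)
    qed
    finally show ?thesis .
  qed (simp add: path_sum_def)
  have bound: "(\<integral>\<^sup>+x. ennreal (norm (?f n x)) \<partial>(\<mu> \<Otimes>\<^sub>M M)) \<le> ennreal (sqrt n * (C + 1))" for n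
  proof -
    have "(\<integral>\<^sup>+x. ennreal (norm (?f n x)) \<partial>(\<mu> \<Otimes>\<^sub>M M)) \<le> (\<integral>\<^sup>+x. ennreal \<bar>path_sum \<psi> (fst (fst x)) n (snd x)\<bar> \<partial>(\<mu> \<Otimes>\<^sub>M M))"
      by (intro nn_integral_mono) (auto simp: indicator_def)
    also have "\<dots> = (\<integral>\<^sup>+z. \<integral>\<^sup>+\<omega>. ennreal \<bar>path_sum \<psi> (fst z) n \<omega>\<bar> \<partial>M \<partial>\<mu>)"
      by (subst nn_integral_fst[symmetric]) auto
    also have "\<dots> \<le> (\<integral>\<^sup>+z. ennreal (sqrt n * (C + 1)) \<partial>\<mu>)" by (intro nn_integral_mono one)
    also have "\<dots> = ennreal (sqrt n * (C + 1))" by (simp add: m.emeasure_space_1)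
    finally show ?thesis .
  qed
  show int: "integrable (\<mu> \<Otimes>\<^sub>M M) (?f n)" for n
    using bound[of n] by (intro integrableI_bounded) (auto simp: le_less_trans)
  have ib: "\<bar>integral\<^sup>L (\<mu> \<Otimes>\<^sub>M M) (?f n)\<bar> \<le> sqrt n * (C + 1)" for n
  proof -
    have "ennreal (norm (integral\<^sup>L (\<mu> \<Otimes>\<^sub>M M) (?f n))) \<le> ennreal (sqrt n * (C + 1))"
      by (rule order_trans[OF integral_norm_bound_ennreal[OF int] bound])
    then show ?thesis using C by (subst (asm) ennreal_le_iff) auto
  qed
  show "(\<lambda>n. (1 / real n) * integral\<^sup>L (\<mu> \<Otimes>\<^sub>M M) (?f n)) \<longlonglongrightarrow> 0"
  proof (rule Lim_null_comparison)
    show "\<forall>\<^sub>F n in sequentially. norm ((1 / real n) * integral\<^sup>L (\<mu> \<Otimes>\<^sub>M M) (?f n)) \<le> (C + 1) / sqrt n"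
      using eventually_gt_at_top[of 0]
    proof eventually_elim
      case (elim n)
      have "norm ((1 / real n) * integral\<^sup>L (\<mu> \<Otimes>\<^sub>M M) (?f n)) \<le> (1 / real n) * (sqrt n * (C + 1))"
        using ib[of n] by (simp add: abs_mult divide_right_mono)
      also have "\<dots> = (C + 1) / sqrt n" using elim by (simp add: field_simps)
      finally show ?case .
    qed
    have "filterlim (\<lambda>n. sqrt (real n)) at_top sequentially"
      by (rule filterlim_compose[OF sqrt_at_top filterlim_real_sequentially])
    then show "(\<lambda>n. (C + 1) / sqrt (real n)) \<longlonglongrightarrow> 0"
      by (intro tendsto_divide_0[OF tendsto_const]) (rule filterlim_at_top_imp_at_infinity)
  qed
qed

text \<open>Let \<open>f n \<phi>\<close> be the time average of \<open>\<phi>\<close> along the chain, restricted to \<open>E n\<close>.  These functionals are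
  dominated by \<open>\<mu>\<close>, so along a filter they converge to integration against a measure \<open>\<nu> \<le> \<mu>\<close>.  Replacing \<open>\<phi>\<close> by
  its image under the transition operator changes \<open>f n \<phi>\<close> by an average of centred increments and
  boundary terms, both negligible; hence \<open>\<nu>\<close> is invariant and a multiple of \<open>\<mu>\<close>, with a factor of at least \<open>p\<close>.
  Finally, \<open>G\<close> may be replaced by its conditional mean \<open>g\<close> up to another average of centred increments.\<close>

lemma increments_nonneg:
  fixes G :: "'d proj_space \<times> 'e \<Rightarrow> real \<Rightarrow> real"
  assumes erg: "ergodic_invariant_measure A P lam \<tau> \<mu>"
    and G [measurable]: "(\<lambda>x. G (fst x) (snd x)) \<in> borel_measurable (state_space \<Otimes>\<^sub>M borel)"
    and K: "\<And>z t. \<bar>G z t\<bar> \<le> K * (1 + \<bar>t\<bar>)"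
    and E [measurable]: "\<And>n. E n \<in> sets (\<mu> \<Otimes>\<^sub>M M)" and Esub: "\<And>n. E n \<subseteq> same_mode"
    and p: "p > 0" "eventually (\<lambda>n. p \<le> measure (\<mu> \<Otimes>\<^sub>M M) (E n)) sequentially"
    and pos: "eventually (\<lambda>n. \<forall>x\<in>E n. 0 \<le> (\<Sum>k<n. G (state (fst (fst x)) k (snd x)) (U (Suc k) (snd x)))) sequentially"
  shows "0 \<le> (\<integral>z. (\<integral>t. G z t \<partial>dwell lam \<tau>) \<partial>\<mu>)"
proof -
  let ?N = "\<mu> \<Otimes>\<^sub>M M"
  let ?s = "\<lambda>k x. state (fst (fst x)) k (snd x)"
  define a where "a n k \<phi> = (\<integral>x. indicator (E n) x * \<phi> (?s k x) \<partial>?N)" for n k and \<phi> :: "'d proj_space \<times> 'e \<Rightarrow> real"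
  define f where "f n \<phi> = (1 / real n) * (\<Sum>k<n. a n k \<phi>)" for n \<phi>
  have ia: "integrable ?N (\<lambda>x. indicator (E n) x * \<phi> (?s k x))" if "integrable \<mu> \<phi>" for \<phi> :: "_ \<Rightarrow> real" and n k
    using integrable_state(1)[OF that E Esub] .
  have abs_a: "\<bar>a n k \<phi>\<bar> \<le> (\<integral>z. \<bar>\<phi> z\<bar> \<partial>\<mu>)" if "integrable \<mu> \<phi>" for \<phi> n k
    unfolding a_def using integrable_state(2)[OF that E Esub] .
  have abs_f: "\<bar>f n \<phi>\<bar> \<le> (\<integral>z. \<bar>\<phi> z\<bar> \<partial>\<mu>)" if "integrable \<mu> \<phi>" for \<phi> n
  proof (cases "n = 0")
    case True
    then show ?thesis by (simp add: f_def Bochner_Integration.integral_nonneg)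
  next
    case False
    have "\<bar>\<Sum>k<n. a n k \<phi>\<bar> \<le> (\<Sum>k<n. (\<integral>z. \<bar>\<phi> z\<bar> \<partial>\<mu>))"
      using abs_a[OF that] by (intro order_trans[OF sum_abs] sum_mono)
    then show ?thesis using False by (simp add: f_def abs_mult field_simps)
  qed
  \<comment> \<open>The cut-off makes the functionals pointwise bounded on all functions, as compactness requires.\<close>
  define F where "F n \<phi> = (if integrable \<mu> \<phi> then f n \<phi> else 0)" for n \<phi>
  have Fb: "\<bar>F n \<phi>\<bar> \<le> (\<integral>z. \<bar>\<phi> z\<bar> \<partial>\<mu>)" for n \<phi>
    using abs_f by (simp add: F_def Bochner_Integration.integral_nonneg)
  obtain \<G> \<Lambda> where \<G>: "\<G> \<noteq> bot" "\<G> \<le> sequentially" and F\<Lambda>: "\<And>\<phi>. ((\<lambda>n. F n \<phi>) \<longlongrightarrow> \<Lambda> \<phi>) \<G>"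
    by (rule pointwise_cluster_filter[where F=F and K="\<lambda>\<phi>. \<integral>z. \<bar>\<phi> z\<bar> \<partial>\<mu>", OF Fb]) blast
  have lim: "((\<lambda>n. f n \<phi>) \<longlongrightarrow> \<Lambda> \<phi>) \<G>" if "integrable \<mu> \<phi>" for \<phi>
    using F\<Lambda>[of \<phi>] that by (simp add: F_def)
  have seqlim: "(X \<longlongrightarrow> l) \<G>" if "X \<longlonglongrightarrow> l" for X and l :: real
    using that \<G>(2) by (rule tendsto_mono[rotated])
  have evG: "eventually R \<G>" if "eventually R sequentially" for R
    using that \<G>(2) by (auto simp: le_filter_def)
  obtain \<nu> where \<nu>: "sets \<nu> = sets \<mu>" "\<And>B. B \<in> sets \<mu> \<Longrightarrow> emeasure \<nu> B \<le> emeasure \<mu> B"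
    "\<And>\<phi>. integrable \<mu> \<phi> \<Longrightarrow> \<Lambda> \<phi> = (\<integral>z. \<phi> z \<partial>\<nu>)"
  proof (rule dominated_functional_representation[of \<mu> \<Lambda>])
    show "finite_measure \<mu>" by (rule m.finite_measure_axioms)
    fix \<phi> \<phi>' :: "'d proj_space \<times> 'e \<Rightarrow> real" and c assume i: "integrable \<mu> \<phi>"
    show "\<Lambda> (\<lambda>x. c * \<phi> x) = c * \<Lambda> \<phi>"
    proof (rule tendsto_unique[OF \<G>(1) lim])
      have "f n (\<lambda>x. c * \<phi> x) = c * f n \<phi>" for n
      proof -
        have "a n k (\<lambda>x. c * \<phi> x) = c * a n k \<phi>" for k
          unfolding a_def Bochner_Integration.integral_mult_right_zero[symmetric]
          by (simp add: mult.left_commute)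
        then show ?thesis by (simp add: f_def sum_distrib_left[symmetric])
      qed
      then show "((\<lambda>n. f n (\<lambda>x. c * \<phi> x)) \<longlongrightarrow> c * \<Lambda> \<phi>) \<G>" using tendsto_mult_left[OF lim[OF i]] by simp
    qed (use i in simp)
    show "\<bar>\<Lambda> \<phi>\<bar> \<le> (\<integral>x. \<bar>\<phi> x\<bar> \<partial>\<mu>)"
      by (rule tendsto_upperbound[OF tendsto_rabs[OF lim[OF i]] _ \<G>(1)]) (simp add: abs_f i)
    show "0 \<le> \<Lambda> \<phi>" if "\<And>x. 0 \<le> \<phi> x"
    proof (rule tendsto_lowerbound[OF lim[OF i] _ \<G>(1)])
      show "\<forall>\<^sub>F n in \<G>. 0 \<le> f n \<phi>"
        unfolding f_def a_def using that
        by (intro always_eventually allI mult_nonneg_nonneg sum_nonneg Bochner_Integration.integral_nonneg) auto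
    qed
    show "\<Lambda> (\<lambda>x. \<phi> x + \<phi>' x) = \<Lambda> \<phi> + \<Lambda> \<phi>'" if i': "integrable \<mu> \<phi>'"
    proof (rule tendsto_unique[OF \<G>(1) lim])
      have "f n (\<lambda>x. \<phi> x + \<phi>' x) = f n \<phi> + f n \<phi>'" for n
      proof -
        have "a n k (\<lambda>x. \<phi> x + \<phi>' x) = a n k \<phi> + a n k \<phi>'" for k
          unfolding a_def distrib_left by (rule Bochner_Integration.integral_add[OF ia[OF i] ia[OF i']])
        then show ?thesis by (simp add: f_def sum.distrib distrib_left)
      qed
      then show "((\<lambda>n. f n (\<lambda>x. \<phi> x + \<phi>' x)) \<longlongrightarrow> \<Lambda> \<phi> + \<Lambda> \<phi>') \<G>"
        using tendsto_add[OF lim[OF i] lim[OF i']] by simp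
    qed (use i i' in simp)
  qed blast
  have fin\<nu>: "finite_measure \<nu>"
  proof (rule finite_measureI)
    have "UNIV \<in> sets \<mu>" using sets.top[of \<mu>] by (simp add: space_invariant)
    from \<nu>(2)[OF this] show "emeasure \<nu> (space \<nu>) \<noteq> \<infinity>"
      using sets_eq_imp_space_eq[OF \<nu>(1)] by (auto simp: m.emeasure_eq_measure top_unique space_invariant)
  qed
  interpret n: finite_measure \<nu> by fact
  have sets\<nu>: "sets \<nu> = sets state_space" using \<nu>(1) sets_invariant by simp
  note [measurable_cong] = sets\<nu>
  have space\<nu>: "space \<nu> = UNIV" by (rule state_space_sets(1)[OF sets\<nu>])
  have int_bounded: "integrable \<mu> \<phi>" if "\<phi> \<in> borel_measurable state_space" "\<And>z. \<bar>\<phi> z\<bar> \<le> C" for \<phi> :: "_ \<Rightarrow> real" and C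
    using that by (intro m.integrable_const_bound[where B=C]) (auto cong: measurable_cong_sets simp: sets_invariant)
  have inv: "emeasure \<nu> B = (\<integral>\<^sup>+ z. transition_prob A P lam \<tau> z B \<partial>\<nu>)" if B': "B \<in> sets \<mu>" for B
  proof -
    have B [measurable]: "B \<in> sets state_space" using B' sets_invariant by simp
    define \<phi> where "\<phi> = (indicator B :: 'd proj_space \<times> 'e \<Rightarrow> real)"
    define T\<phi> where "T\<phi> = mean_step P lam \<tau> (\<lambda>x. \<phi> (next_state A x))"
    have [measurable]: "\<phi> \<in> borel_measurable state_space" unfolding \<phi>_def by measurable
    have Tm [measurable]: "T\<phi> \<in> borel_measurable state_space"
      unfolding T\<phi>_def by (intro measurable_mean_step lam_pos) measurable
    have b: "0 \<le> \<phi> z" "\<phi> z \<le> 1" for z by (auto simp: \<phi>_def)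
    have Tb: "0 \<le> T\<phi> z" "T\<phi> z \<le> 1" for z
      unfolding T\<phi>_def by (intro mean_step_bounded lam_pos switching b)+
    have i: "integrable \<mu> \<phi>" by (rule int_bounded[of _ 1]) (use b in auto)
    have iT: "integrable \<mu> T\<phi>" by (rule int_bounded[of _ 1]) (use Tb in auto)
    \<comment> \<open>The centred increment that compares the next state with its conditional law.\<close>
    define \<psi> where "\<psi> x = \<phi> (next_state A x) - T\<phi> (fst x)" for x
    have \<psi>m [measurable]: "\<psi> \<in> borel_measurable step_space" unfolding \<psi>_def[abs_def] by measurable
    have \<psi>b: "\<bar>\<psi> (z, t, j)\<bar> \<le> 1 * (1 + \<bar>t\<bar>)" for z t j
      using b[of "next_state A (z, t, j)"] Tb[of z] unfolding \<psi>_def by simp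
    have centred: "mean_step P lam \<tau> \<psi> z = 0" for z
    proof -
      have "integrable (dwell lam \<tau>) (\<lambda>t. \<phi> (next_state A (z, t, j)))" for j
        using b by (intro dwell.integrable_const_bound[where B=1]) auto
      then have "mean_step P lam \<tau> \<psi> z = T\<phi> z - (\<Sum>j\<in>UNIV. P (snd z) j) * T\<phi> z"
        using dwell.prob_space by (simp add: \<psi>_def mean_step_def T\<phi>_def right_diff_distrib sum_subtractf sum_distrib_right)
      then show ?thesis using switching_matrixD(1)[OF switching] by simp
    qed
    note ca = centred_average[OF \<psi>m \<psi>b centred, of E, OF E]
    have eq: "f n \<phi> - f n T\<phi> = (1 / real n) * (\<integral>x. indicator (E n) x * path_sum \<psi> (fst (fst x)) n (snd x) \<partial>?N)
        + (1 / real n) * (a n 0 \<phi> - a n n \<phi>)" for n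
    proof -
      have "(\<integral>x. indicator (E n) x * path_sum \<psi> (fst (fst x)) n (snd x) \<partial>?N)
          = (\<integral>x. (\<Sum>k<n. indicator (E n) x * \<phi> (?s (Suc k) x) - indicator (E n) x * T\<phi> (?s k x)) \<partial>?N)"
        by (simp add: path_sum_def \<psi>_def state_Suc sum_distrib_left right_diff_distrib)
      also have "\<dots> = (\<Sum>k<n. a n (Suc k) \<phi> - a n k T\<phi>)"
        unfolding a_def using ia[OF i] ia[OF iT]
        by (simp add: Bochner_Integration.integral_sum Bochner_Integration.integral_diff)
      also have "\<dots> = (\<Sum>k<n. a n k \<phi>) - (\<Sum>k<n. a n k T\<phi>) + (a n n \<phi> - a n 0 \<phi>)"
        using sum_lessThan_telescope[of "\<lambda>k. a n k \<phi>" n] by (simp add: sum_subtractf)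
      finally have e: "(\<Sum>k<n. a n k \<phi>) - (\<Sum>k<n. a n k T\<phi>)
          = (\<integral>x. indicator (E n) x * path_sum \<psi> (fst (fst x)) n (snd x) \<partial>?N) + (a n 0 \<phi> - a n n \<phi>)"
        by simp
      show ?thesis unfolding f_def right_diff_distrib[symmetric] distrib_left[symmetric] e ..
    qed
    have "(\<lambda>n. f n \<phi> - f n T\<phi>) \<longlonglongrightarrow> 0 + 0"
      unfolding eq
    proof (rule tendsto_add[OF ca(2)], rule Lim_null_comparison)
      have a1: "\<bar>a n k \<phi>\<bar> \<le> 1" for n k
      proof -
        have "(\<integral>z. \<bar>\<phi> z\<bar> \<partial>\<mu>) \<le> (\<integral>z. 1 \<partial>\<mu>)" using i b by (intro integral_mono) auto
        then show ?thesis using abs_a[OF i, of n k] m.prob_space by simp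
      qed
      have "\<bar>a n 0 \<phi> - a n n \<phi>\<bar> \<le> 2" for n
        using abs_triangle_ineq4[of "a n 0 \<phi>" "a n n \<phi>"] a1[of n 0] a1[of n n] by linarith
      then have "norm ((1 / real n) * (a n 0 \<phi> - a n n \<phi>)) \<le> 2 * inverse (real n)" for n
        by (simp add: abs_mult divide_inverse mult.commute mult_left_mono)
      then show "\<forall>\<^sub>F n in sequentially. norm ((1 / real n) * (a n 0 \<phi> - a n n \<phi>)) \<le> 2 * inverse (real n)" by simp
      show "(\<lambda>n. 2 * inverse (real n)) \<longlonglongrightarrow> 0"
        by (rule tendsto_mult_right_zero[OF lim_inverse_n])
    qed
    then have "((\<lambda>n. f n \<phi> - f n T\<phi>) \<longlongrightarrow> 0) \<G>" using seqlim by simp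
    then have "\<Lambda> \<phi> - \<Lambda> T\<phi> = 0" using tendsto_unique[OF \<G>(1) tendsto_diff[OF lim[OF i] lim[OF iT]]] by blast
    then have e: "(\<integral>z. \<phi> z \<partial>\<nu>) = (\<integral>z. T\<phi> z \<partial>\<nu>)" using \<nu>(3) i iT by simp
    have "emeasure \<nu> B = ennreal (\<integral>z. \<phi> z \<partial>\<nu>)"
      unfolding \<phi>_def using B sets\<nu> by (simp add: n.emeasure_eq_measure space\<nu>)
    also have "\<dots> = (\<integral>\<^sup>+z. ennreal (T\<phi> z) \<partial>\<nu>)"
      unfolding e by (rule nn_integral_eq_integral[symmetric])
        (use Tb in \<open>auto intro!: n.integrable_const_bound[where B=1]\<close>)
    also have "\<dots> = (\<integral>\<^sup>+ z. transition_prob A P lam \<tau> z B \<partial>\<nu>)"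
      using transition_prob_eq_mean_step[OF lam_pos switching B] by (simp add: T\<phi>_def \<phi>_def)
    finally show ?thesis .
  qed
  have mult: "measure \<nu> B = measure \<nu> UNIV * measure \<mu> B" if "B \<in> sets \<mu>" for B
    by (rule dominated_invariant_multiple[OF lam_pos switching erg \<nu>(1) \<nu>(2) inv that])
  define c where "c = measure \<nu> UNIV"
  have c: "c > 0"
  proof -
    have i: "integrable \<mu> (\<lambda>_. 1 :: real)" by simp
    have "c = \<Lambda> (\<lambda>_. 1)" using \<nu>(3)[OF i] by (simp add: c_def space\<nu>)
    moreover have "p \<le> \<Lambda> (\<lambda>_. 1)"
    proof (rule tendsto_lowerbound[OF lim[OF i] evG \<G>(1)])
      show "\<forall>\<^sub>F n in sequentially. p \<le> f n (\<lambda>_. 1)"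
        using p(2) eventually_gt_at_top[of 0]
      proof eventually_elim
        case (elim n)
        have "a n k (\<lambda>_. 1) = measure ?N (E n)" for k
          unfolding a_def using sets.sets_into_space[OF E] by (simp add: Int_absorb2)
        then show ?case using elim by (simp add: f_def)
      qed
    qed
    ultimately show ?thesis using p(1) by simp
  qed
  \<comment> \<open>Extremality has turned the limit measure into a positive multiple of the invariant one.\<close>
  have \<nu>_scale: "\<nu> = scale_measure (ennreal c) \<mu>"
  proof (rule measure_eqI)
    fix B assume "B \<in> sets \<nu>"
    then have "B \<in> sets \<mu>" using \<nu>(1) by simp
    from mult[OF this] show "emeasure \<nu> B = emeasure (scale_measure (ennreal c) \<mu>) B"
      using c by (simp add: n.emeasure_eq_measure m.emeasure_eq_measure ennreal_mult c_def)
  qed (simp add: \<nu>(1))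
  define g where "g z = (\<integral>t. G z t \<partial>dwell lam \<tau>)" for z
  have gm [measurable]: "g \<in> borel_measurable state_space" unfolding g_def[abs_def] by measurable
  have Gi: "integrable (dwell lam \<tau>) (G z)" for z
  proof (rule Bochner_Integration.integrable_bound)
    show "integrable (dwell lam \<tau>) (\<lambda>t. K * (1 + \<bar>t\<bar>))" using integrable_dwell(3)[OF lam_pos, of \<tau>] by simp
    have "(\<lambda>t. G (fst (z, t)) (snd (z, t))) \<in> borel_measurable borel"
      by (rule measurable_compose[OF measurable_Pair1' G]) (simp add: space_pair_measure)
    then show "G z \<in> borel_measurable (dwell lam \<tau>)" by simp
    show "AE t in dwell lam \<tau>. norm (G z t) \<le> norm (K * (1 + \<bar>t\<bar>))"
      using K by (intro AE_I2) (smt (verit) real_norm_def)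
  qed
  define K' where "K' = (\<integral>t. K * (1 + \<bar>t\<bar>) \<partial>dwell lam \<tau>)"
  have gb: "\<bar>g z\<bar> \<le> K'" for z
  proof -
    have "\<bar>g z\<bar> \<le> (\<integral>t. \<bar>G z t\<bar> \<partial>dwell lam \<tau>)" unfolding g_def by (rule integral_abs_bound)
    also have "\<dots> \<le> K'" unfolding K'_def
      using Gi integrable_dwell(3)[OF lam_pos, of \<tau>] by (intro integral_mono K) auto
    finally show ?thesis .
  qed
  have ig: "integrable \<mu> g" using gm gb by (rule int_bounded)
  define \<psi> where "\<psi> x = G (fst x) (fst (snd x)) - g (fst x)" for x :: "('d proj_space \<times> 'e) \<times> real \<times> 'e"
  have \<psi>m [measurable]: "\<psi> \<in> borel_measurable step_space"
  proof -
    have "(\<lambda>x. (fst x, fst (snd x))) \<in> measurable (step_space :: (('d proj_space \<times> 'e) \<times> real \<times> 'e) measure) (state_space \<Otimes>\<^sub>M borel)"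
      by measurable
    from measurable_compose[OF this G] measurable_compose[OF measurable_fst gm]
    show ?thesis unfolding \<psi>_def[abs_def] by simp
  qed
  have K'0: "0 \<le> K'" using gb[of undefined] by simp
  have \<psi>b: "\<bar>\<psi> (z, t, j)\<bar> \<le> (K + K') * (1 + \<bar>t\<bar>)" for z t j
  proof -
    have "\<bar>\<psi> (z, t, j)\<bar> \<le> K * (1 + \<bar>t\<bar>) + K' * 1"
      using K[of z t] gb[of z] unfolding \<psi>_def by simp
    also have "K' * 1 \<le> K' * (1 + \<bar>t\<bar>)" using K'0 by (intro mult_left_mono) auto
    finally show ?thesis by (simp add: distrib_right)
  qed
  have centred: "mean_step P lam \<tau> \<psi> z = 0" for z
    using Gi[of z] dwell.prob_space by (simp add: \<psi>_def mean_step_def g_def)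
  note ca = centred_average[OF \<psi>m \<psi>b centred, of E, OF E]
  have "0 \<le> \<Lambda> g + 0"
  proof (rule tendsto_lowerbound[OF tendsto_add[OF lim[OF ig] seqlim[OF ca(2)]] evG \<G>(1)])
    show "\<forall>\<^sub>F n in sequentially. 0 \<le> f n g + (1 / real n) * (\<integral>x. indicator (E n) x * path_sum \<psi> (fst (fst x)) n (snd x) \<partial>?N)"
      using pos
    proof eventually_elim
      case (elim n)
      have "(\<Sum>k<n. a n k g) + (\<integral>x. indicator (E n) x * path_sum \<psi> (fst (fst x)) n (snd x) \<partial>?N)
          = (\<integral>x. (\<Sum>k<n. indicator (E n) x * g (?s k x)) + indicator (E n) x * path_sum \<psi> (fst (fst x)) n (snd x) \<partial>?N)"
      proof -
        have "(\<Sum>k<n. a n k g) = (\<integral>x. (\<Sum>k<n. indicator (E n) x * g (?s k x)) \<partial>?N)"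
          unfolding a_def by (intro Bochner_Integration.integral_sum[symmetric] ia ig)
        moreover have "integrable ?N (\<lambda>x. \<Sum>k<n. indicator (E n) x * g (?s k x))"
          by (intro Bochner_Integration.integrable_sum ia ig)
        ultimately show ?thesis by (simp only: Bochner_Integration.integral_add[OF _ ca(1)])
      qed
      also have "\<dots> = (\<integral>x. indicator (E n) x * (\<Sum>k<n. G (?s k x) (U (Suc k) (snd x))) \<partial>?N)"
        by (simp add: path_sum_def \<psi>_def sum_subtractf right_diff_distrib sum_distrib_left)
      also have "\<dots> \<ge> 0"
        using elim by (intro Bochner_Integration.integral_nonneg) (auto simp: indicator_def)
      finally have "0 \<le> (1 / real n) * ((\<Sum>k<n. a n k g) + (\<integral>x. indicator (E n) x * path_sum \<psi> (fst (fst x)) n (snd x) \<partial>?N))"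
        by (intro mult_nonneg_nonneg) auto
      then show ?case by (simp only: f_def distrib_left)
    qed
  qed
  also have "\<Lambda> g = c * (\<integral>z. g z \<partial>\<mu>)"
  proof -
    have "\<Lambda> g = (\<integral>z. g z \<partial>\<nu>)" by (rule \<nu>(3)[OF ig])
    also have "\<nu> = density \<mu> (\<lambda>_. ennreal c)"
      unfolding \<nu>_scale by (rule measure_eqI) (auto simp: emeasure_density nn_integral_cmult)
    also have "(\<integral>z. g z \<partial>density \<mu> (\<lambda>_. ennreal c)) = c * (\<integral>z. g z \<partial>\<mu>)"
      using c by (subst integral_density) auto
    finally show ?thesis .
  qed
  finally show ?thesis using c by (simp add: zero_le_mult_iff g_def)
qed

end

end

section \<open>The Lyapunov exponent as a mean growth rate\<close>

text \<open>Equivalent to the operator norm, and visibly measurable as a function of the matrix.\<close>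

definition column_norm :: "real^'d^'d::finite \<Rightarrow> real" where
  "column_norm B = (\<Sum>j\<in>UNIV. norm (B *v axis j 1))"

lemma norm_mult_le_column_norm: "norm (B *v x) \<le> column_norm B * norm x"
proof -
  have "B *v x = B *v (\<Sum>j\<in>UNIV. (x $ j) *\<^sub>R axis j 1)" by (simp only: vec_sum_axis)
  also have "\<dots> = (\<Sum>j\<in>UNIV. (x $ j) *\<^sub>R (B *v axis j 1))"
    by (simp add: linear_sum matrix_vector_mult_scaleR)
  finally have "norm (B *v x) \<le> (\<Sum>j\<in>UNIV. norm ((x $ j) *\<^sub>R (B *v axis j 1)))"
    using norm_sum[of "\<lambda>j. (x $ j) *\<^sub>R (B *v axis j 1)" UNIV] by simp
  also have "\<dots> \<le> (\<Sum>j\<in>UNIV. norm x * norm (B *v axis j 1))"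
    by (intro sum_mono) (auto intro!: mult_right_mono component_le_norm_cart)
  finally show ?thesis by (simp add: column_norm_def sum_distrib_left mult.commute)
qed

lemma onorm_le_column_norm: "onorm ((*v) B) \<le> column_norm B" for B :: "real^'d^'d::finite"
  by (rule onorm_le) (rule norm_mult_le_column_norm)

lemma column_norm_le_onorm: "column_norm B \<le> CARD('d) * onorm ((*v) B)" for B :: "real^'d^'d::finite"
proof -
  have "norm (B *v axis j 1) \<le> onorm ((*v) B)" for j
    using onorm[OF matrix_vector_mul_bounded_linear, of B "axis j 1"] by simp
  then show ?thesis unfolding column_norm_def using sum_bounded_above[of UNIV "\<lambda>j. norm (B *v axis j 1)"] by simp
qed

text \<open>Among finitely many vectors \<open>V\<close> that span the space and whose lines lie in the support, \<open>B\<close> maps one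
  to a vector whose norm is at least a fixed multiple of the norm of \<open>B\<close>; the same holds
  for the unit vectors in the lines that meet a ball of fixed radius \<open>\<delta>\<close> around it.  The smallest of the
  masses of these neighbourhoods is a bound that does not depend on \<open>B\<close>.\<close>

lemma spread_directions:
  fixes \<mu> :: "('d::finite proj_space \<times> 'e::finite) measure"
  assumes "prob_space \<mu>" and sets: "sets \<mu> = sets state_space"
    and span: "span {x. x \<noteq> 0 \<and> (to_proj x, i) \<in> measure_support \<mu>} = UNIV"
  obtains \<kappa> p where "\<kappa> > 0" "p > 0"
    "\<And>B. p \<le> measure \<mu> {z. snd z = i \<and> column_norm B \<le> \<kappa> * norm (B *v proj_section (fst z))}"
proof -
  interpret prob_space \<mu> by fact
  note [measurable_cong] = sets
  have space: "space \<mu> = UNIV" by (rule state_space_sets(1)[OF sets])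
  obtain V where V: "V \<subseteq> {x. x \<noteq> 0 \<and> (to_proj x, i) \<in> measure_support \<mu>}" "independent V"
    "{x. x \<noteq> 0 \<and> (to_proj x, i) \<in> measure_support \<mu>} \<subseteq> span V"
    using maximal_independent_subset by blast
  have finV: "finite V" using V(2) by (rule independent_imp_finite)
  have spanV: "span V = UNIV" using span_mono[OF V(3)] span by (simp add: span_span top.extremum_unique)
  have "\<exists>r. axis j 1 = (\<Sum>v\<in>V. r v *\<^sub>R v)" for j :: 'd
  proof -
    have "axis j 1 \<in> range (\<lambda>u. \<Sum>v\<in>V. u v *\<^sub>R v)"
      unfolding span_finite[OF finV, symmetric] spanV by simp
    then show ?thesis by (auto simp: image_iff)
  qed
  then have "\<forall>j. \<exists>r. axis j 1 = (\<Sum>v\<in>V. r v *\<^sub>R v)" by blast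
  from choice[OF this] obtain r where r: "\<And>j. axis j 1 = (\<Sum>v\<in>V. r j v *\<^sub>R v)" by blast
  define C0 where "C0 = (\<Sum>j\<in>UNIV. \<Sum>v\<in>V. \<bar>r j v\<bar>) + 1"
  have C0: "C0 > 0" unfolding C0_def by (intro add_nonneg_pos sum_nonneg) auto
  have cn: "column_norm B \<le> C0 * (\<Sum>v\<in>V. norm (B *v v))" for B :: "real^'d^'d"
  proof -
    let ?s = "\<Sum>v\<in>V. norm (B *v v)"
    have "norm (B *v axis j 1) \<le> (\<Sum>v\<in>V. \<bar>r j v\<bar>) * ?s" for j
    proof -
      have "norm (B *v axis j 1) \<le> (\<Sum>v\<in>V. norm (r j v *\<^sub>R (B *v v)))"
        using norm_sum[of "\<lambda>v. r j v *\<^sub>R (B *v v)" V]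
        by (subst r) (simp add: linear_sum matrix_vector_mult_scaleR)
      also have "\<dots> \<le> (\<Sum>v\<in>V. \<bar>r j v\<bar> * ?s)"
        using finV by (auto intro!: sum_mono mult_left_mono member_le_sum)
      finally show ?thesis by (simp add: sum_distrib_right)
    qed
    then have "column_norm B \<le> (\<Sum>j\<in>UNIV. (\<Sum>v\<in>V. \<bar>r j v\<bar>) * ?s)"
      unfolding column_norm_def by (intro sum_mono)
    also have "\<dots> \<le> C0 * ?s" unfolding sum_distrib_right[symmetric] C0_def
      by (intro mult_right_mono) (auto simp: sum_nonneg)
    finally show ?thesis .
  qed
  have Vne: "V \<noteq> {}"
  proof
    assume "V = {}"
    then have "(axis undefined 1 :: real^'d) = 0" using r[of undefined] by simp
    then show False by (simp add: axis_eq_0_iff)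
  qed
  define n where "n = real (card V)"
  have n: "n > 0" using finV Vne by (simp add: n_def card_gt_0_iff)
  \<comment> \<open>Small enough to absorb half of the norm of the matrix in the final estimate.\<close>
  define \<delta> where "\<delta> = 1 / (2 * C0 * n)"
  have \<delta>: "\<delta> > 0" using C0 n by (simp add: \<delta>_def)
  define K where "K = (\<Sum>v\<in>V. norm v) + \<delta>"
  have K: "K > 0" using \<delta> unfolding K_def by (intro add_nonneg_pos sum_nonneg) auto
  define \<kappa> where "\<kappa> = 2 * C0 * n * K"
  define N where "N v = to_proj ` (ball v \<delta> - {0})" for v :: "real^'d"
  have N: "open (N v)" for v unfolding N_def by (intro open_to_proj_image) simp
  define p where "p = Min ((\<lambda>v. measure \<mu> (N v \<times> {i})) ` V)"
  have "measure \<mu> (N v \<times> {i}) > 0" if "v \<in> V" for v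
  proof -
    have "v \<noteq> 0" "(to_proj v, i) \<in> measure_support \<mu>" using V(1) that by auto
    moreover have "to_proj v \<in> N v" unfolding N_def using \<open>v \<noteq> 0\<close> \<delta> by auto
    ultimately have "emeasure \<mu> (N v \<times> {i}) > 0" using N unfolding measure_support_def by auto
    then show ?thesis by (simp add: emeasure_eq_measure)
  qed
  then have p: "p > 0" unfolding p_def using finV Vne by (subst Min_gr_iff) auto
  have "p \<le> measure \<mu> {z. snd z = i \<and> column_norm B \<le> \<kappa> * norm (B *v proj_section (fst z))}" for B :: "real^'d^'d"
  proof -
    obtain v where v: "v \<in> V" "\<And>w. w \<in> V \<Longrightarrow> norm (B *v w) \<le> norm (B *v v)"
    proof -
      let ?m = "Max ((\<lambda>w. norm (B *v w)) ` V)"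
      have "?m \<in> (\<lambda>w. norm (B *v w)) ` V" using finV Vne by (intro Max_in) auto
      then obtain v where "v \<in> V" "?m = norm (B *v v)" by auto
      moreover have "norm (B *v w) \<le> ?m" if "w \<in> V" for w using finV that by (intro Max_ge) auto
      ultimately show ?thesis using that by auto
    qed
    have "(\<Sum>w\<in>V. norm (B *v w)) \<le> n * norm (B *v v)"
      unfolding n_def using v(2) by (rule sum_bounded_above)
    then have R: "column_norm B \<le> C0 * (n * norm (B *v v))"
      using C0 by (intro order_trans[OF cn[of B]] mult_left_mono) auto
    have "N v \<times> {i} \<subseteq> {z. snd z = i \<and> column_norm B \<le> \<kappa> * norm (B *v proj_section (fst z))}"
    proof (clarsimp)
      fix q assume "q \<in> N v"
      then have "q \<in> to_proj ` (ball v \<delta> - {0})" by (simp add: N_def)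
      then obtain y where "q = to_proj y" "y \<in> ball v \<delta> - {0}" by (rule imageE)
      then have y: "q = to_proj y" "y \<noteq> 0" "dist v y < \<delta>" by simp_all
      then obtain c where c: "c \<noteq> 0" "y = c *\<^sub>R proj_section q"
        using to_proj_eq_iff[of "proj_section q" y] by auto
      then have cy: "\<bar>c\<bar> = norm y" by (metis norm_scaleR norm_proj_section mult.right_neutral)
      have "norm v \<le> (\<Sum>w\<in>V. norm w)" using v(1) finV by (intro member_le_sum) auto
      then have "norm y \<le> K" using y(3) norm_triangle_sub[of y v] by (simp add: K_def dist_norm norm_minus_commute)
      then have By: "norm (B *v y) \<le> K * norm (B *v proj_section q)"
        by (subst c(2)) (simp add: matrix_vector_mult_scaleR cy mult_right_mono)
      have "norm (B *v v) \<le> norm (B *v y) + norm (B *v (v - y))"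
        using norm_triangle_ineq[of "B *v y" "B *v (v - y)"] by (simp add: matrix_vector_mult_diff_distrib)
      also have "norm (B *v (v - y)) \<le> column_norm B * \<delta>"
        using y(3) by (intro order_trans[OF norm_mult_le_column_norm] mult_left_mono)
          (auto simp: dist_norm column_norm_def sum_nonneg)
      finally have "norm (B *v v) \<le> K * norm (B *v proj_section q) + column_norm B * \<delta>" using By by simp
      then have "column_norm B \<le> C0 * (n * (K * norm (B *v proj_section q) + column_norm B * \<delta>))"
        using C0 n by (intro order_trans[OF R] mult_left_mono) auto
      also have "\<dots> = C0 * n * K * norm (B *v proj_section q) + column_norm B / 2"
        using C0 n by (simp add: \<delta>_def field_simps)
      finally show "column_norm B \<le> \<kappa> * norm (B *v proj_section q)" by (simp add: \<kappa>_def)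
    qed
    moreover have "{z. snd z = i \<and> column_norm B \<le> \<kappa> * norm (B *v proj_section (fst z))} \<in> sets \<mu>"
    proof -
      have [measurable]: "(\<lambda>x. B *v x) \<in> borel_measurable borel"
        by (intro borel_measurable_continuous_onI linear_continuous_on matrix_vector_mul_bounded_linear)
      have "{z \<in> space \<mu>. snd z = i \<and> column_norm B \<le> \<kappa> * norm (B *v proj_section (fst z))} \<in> sets \<mu>"
        by measurable
      then show ?thesis by (simp add: space)
    qed
    ultimately have "measure \<mu> (N v \<times> {i}) \<le> measure \<mu> {z. snd z = i \<and> column_norm B \<le> \<kappa> * norm (B *v proj_section (fst z))}"
      by (rule finite_measure_mono)
    moreover have "p \<le> measure \<mu> (N v \<times> {i})" unfolding p_def using finV v(1) by simp
    ultimately show ?thesis by simp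
  qed
  moreover have "\<kappa> > 0" using C0 n K by (simp add: \<kappa>_def)
  ultimately show ?thesis using that p by blast
qed

lemma jump_time_Suc [simp]: "jump_time U (Suc n) \<omega> = jump_time U n \<omega> + U (Suc n) \<omega>"
  and jump_time_0 [simp]: "jump_time U 0 \<omega> = 0"
  by (auto simp: jump_time_def)

text \<open>The cocycle property: the line of the vector follows the orbit, and its norm is multiplied at each
  step by the stretching factor at the current line.\<close>

lemma Phi_orbit:
  fixes A :: "'e \<Rightarrow> real^'d^'d::finite"
  shows "Phi A U L n \<omega> *v proj_section q \<noteq> 0"
    and "to_proj (Phi A U L n \<omega> *v proj_section q) = orbit A (\<lambda>i. L i \<omega>) (\<lambda>i. U i \<omega>) q n"
    and "ln (norm (Phi A U L n \<omega> *v proj_section q))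
      = (\<Sum>k<n. log_growth (A (L k \<omega>)) (U (Suc k) \<omega>) (orbit A (\<lambda>i. L i \<omega>) (\<lambda>i. U i \<omega>) q k))"
proof (induction n)
  case (Suc n)
  have e: "Phi A U L (Suc n) \<omega> *v proj_section q = mat_exp (U (Suc n) \<omega> *\<^sub>R A (L n \<omega>)) *v (Phi A U L n \<omega> *v proj_section q)"
    by (simp add: matrix_vector_mul_assoc)
  {
    case 1
    show ?case unfolding e using Suc by simp
  next
    case 2
    show ?case unfolding e using Suc proj_flow_to_proj[of "Phi A U L n \<omega> *v proj_section q"] by simp
  next
    case 3
    show ?case unfolding e using Suc log_norm_mat_exp[of "Phi A U L n \<omega> *v proj_section q"] by simp
  }
qed auto

context standard_switching_process
begin

lemma AE_durations: "AE \<omega> in M. \<forall>n. \<tau> \<le> U (Suc n) \<omega>"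
proof (subst AE_all_countable, intro allI)
  fix n
  have "AE t in distr M borel (U (Suc n)). \<tau> \<le> t" unfolding distr_duration by (rule AE_dwell)
  then show "AE \<omega> in M. \<tau> \<le> U (Suc n) \<omega>" by (subst (asm) AE_distr_iff) auto
qed

lemma Psi_jump_time:
  assumes "\<tau> > 0" and \<omega>: "\<forall>n. \<tau> \<le> U (Suc n) \<omega>"
  shows "Psi A U L (jump_time U n \<omega>) \<omega> = Phi A U L n \<omega>"
proof -
  let ?T = "\<lambda>n. jump_time U n \<omega>"
  have sm: "strict_mono ?T" using assms by (intro strict_mono_Suc_iff[THEN iffD2] allI) (simp add: less_le_trans)
  have "(THE m. ?T m \<le> ?T n \<and> ?T n < ?T (Suc m)) = n"
    unfolding strict_mono_less_eq[OF sm] strict_mono_less[OF sm] by (rule the_equality) auto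
  then show ?thesis by (simp add: Psi_def Let_def mat_exp_zero)
qed

lemma jump_time_ge:
  assumes "\<forall>n. \<tau> \<le> U (Suc n) \<omega>" shows "real n * \<tau> \<le> jump_time U n \<omega>"
proof (induction n)
  case (Suc n)
  then show ?case using assms[rule_format, of n] by (simp add: algebra_simps)
qed simp

lemma measurable_Phi_mult [measurable (raw)]:
  assumes "f \<in> measurable N M" "g \<in> borel_measurable N"
  shows "(\<lambda>x. Phi A U L n (f x) *v g x) \<in> borel_measurable N"
proof (induction n)
  case (Suc n)
  have 1: "(\<lambda>x. U (Suc n) (f x)) \<in> borel_measurable N" "(\<lambda>x. L n (f x)) \<in> measurable N (count_space UNIV)"
    using assms(1) by measurable
  have "(\<lambda>x. mat_exp (U (Suc n) (f x) *\<^sub>R A (L n (f x))) *v (Phi A U L n (f x) *v g x)) \<in> borel_measurable N"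
    by (rule measurable_compose_countable'[OF _ 1(2), of "\<lambda>i x. mat_exp (U (Suc n) (f x) *\<^sub>R A i) *v (Phi A U L n (f x) *v g x)"])
      (use 1(1) Suc in \<open>auto intro: countable_finite\<close>)
  then show ?case by (simp add: matrix_vector_mul_assoc)
qed (use assms in simp)

lemma measurable_column_norm_Phi [measurable]: "(\<lambda>\<omega>. column_norm (Phi A U L n \<omega>)) \<in> borel_measurable M"
  unfolding column_norm_def by measurable

lemma measurable_jump_time [measurable]: "jump_time U n \<in> borel_measurable M"
proof (induction n)
  case 0
  then show ?case by (simp add: jump_time_def[abs_def])
next
  case (Suc n)
  have "jump_time U (Suc n) = (\<lambda>\<omega>. jump_time U n \<omega> + U (Suc n) \<omega>)" by auto
  then show ?case using Suc by simp
qed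

lemma column_norm_Phi_pos: "column_norm (Phi A U L n \<omega>) > 0"
proof -
  have "0 < norm (Phi A U L n \<omega> *v proj_section undefined)" using Phi_orbit(1) by simp
  also have "\<dots> \<le> column_norm (Phi A U L n \<omega>)" using norm_mult_le_column_norm[of _ "proj_section undefined"] by simp
  finally show ?thesis .
qed

text \<open>At a jump time the current piece has length 0, so \<open>\<Psi>\<close> equals \<open>\<Phi> n\<close>; the limit in continuous time is
  read off along the jump times, which tend to infinity as all durations are at least \<open>\<tau>\<close>.\<close>

lemma AE_column_norm_limit:
  assumes tau: "\<tau> > 0" and chi: "is_lyapunov_exponent M A U L chi"
  shows "AE \<omega> in M. (\<lambda>n. ln (column_norm (Phi A U L n \<omega>)) / jump_time U n \<omega>) \<longlonglongrightarrow> chi"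
  using AE_durations chi[unfolded is_lyapunov_exponent_def]
proof eventually_elim
  case (elim \<omega>)
  let ?T = "\<lambda>n. jump_time U n \<omega>" and ?o = "\<lambda>n. onorm ((*v) (Phi A U L n \<omega>))" and ?c = "\<lambda>n. column_norm (Phi A U L n \<omega>)"
  have T: "filterlim ?T at_top sequentially"
  proof (rule filterlim_at_top_mono)
    show "filterlim (\<lambda>n. real n * \<tau>) at_top sequentially"
      by (rule filterlim_at_top_mult_tendsto_pos[OF tendsto_const tau filterlim_real_sequentially])
    show "\<forall>\<^sub>F n in sequentially. real n * \<tau> \<le> ?T n" using jump_time_ge[OF elim(1)] by simp
  qed
  have d: "CARD('d) > 0" by simp
  have o: "ln (?o n) \<le> ln (?c n)" "ln (?c n) \<le> ln CARD('d) + ln (?o n)" for n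
  proof -
    have "?c n \<le> CARD('d) * ?o n" by (rule column_norm_le_onorm)
    then have op: "?o n > 0" using column_norm_Phi_pos[of n \<omega>] d by (metis less_le_trans zero_less_mult_pos of_nat_0_less_iff)
    show "ln (?o n) \<le> ln (?c n)" using op onorm_le_column_norm[of "Phi A U L n \<omega>"] by simp
    have "ln (?c n) \<le> ln (CARD('d) * ?o n)" using column_norm_Phi_pos[of n \<omega>] column_norm_le_onorm by (intro ln_mono) auto
    then show "ln (?c n) \<le> ln CARD('d) + ln (?o n)" using op d by (simp add: ln_mult)
  qed
  have "((\<lambda>n. 1 / ?T n * ln (onorm ((*v) (Psi A U L (?T n) \<omega>)))) \<longlongrightarrow> chi) sequentially"
    using filterlim_compose[OF elim(2) T] .
  then have 1: "(\<lambda>n. ln (?o n) / ?T n) \<longlonglongrightarrow> chi" using Psi_jump_time[OF tau elim(1)] by simp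
  have "(\<lambda>n. ln CARD('d) / ?T n) \<longlonglongrightarrow> 0"
    by (intro tendsto_divide_0[OF tendsto_const] filterlim_at_top_imp_at_infinity T)
  from tendsto_add[OF this 1] have 2: "(\<lambda>n. ln CARD('d) / ?T n + ln (?o n) / ?T n) \<longlonglongrightarrow> chi" by simp
  have ev: "\<forall>\<^sub>F n in sequentially. ?T n > 0" using T by (simp add: filterlim_at_top_dense)
  show ?case
  proof (rule tendsto_sandwich[OF _ _ 1 2])
    show "\<forall>\<^sub>F n in sequentially. ln (?o n) / ?T n \<le> ln (?c n) / ?T n"
      using ev by eventually_elim (simp add: divide_right_mono o)
    show "\<forall>\<^sub>F n in sequentially. ln (?c n) / ?T n \<le> ln CARD('d) / ?T n + ln (?o n) / ?T n"
      using ev by eventually_elim (simp add: divide_right_mono o flip: add_divide_distrib)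
  qed
qed

end

context standard_switching_process
begin

lemma path_sum_log_growth:
  "(\<Sum>k<n. log_growth (A (snd (state q k \<omega>))) (U (Suc k) \<omega>) (fst (state q k \<omega>)) - a * U (Suc k) \<omega>)
    = ln (norm (Phi A U L n \<omega> *v proj_section q)) - a * jump_time U n \<omega>"
proof -
  have "jump_time U n \<omega> = (\<Sum>k<n. U (Suc k) \<omega>)" by (induction n) auto
  then show ?thesis by (simp add: Phi_orbit(3) state_def sum_subtractf sum_distrib_left)
qed

lemma initial_mode_exists: "\<exists>i. prob {\<omega> \<in> space M. L 0 \<omega> = i} > 0"
proof (rule ccontr)
  assume "\<nexists>i. prob {\<omega> \<in> space M. L 0 \<omega> = i} > 0"
  then have z: "prob {\<omega> \<in> space M. L 0 \<omega> = i} = 0" for i by (simp add: not_less measure_le_0_iff)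
  have "prob (\<Union>i\<in>UNIV. {\<omega> \<in> space M. L 0 \<omega> = i}) \<le> (\<Sum>i\<in>UNIV. prob {\<omega> \<in> space M. L 0 \<omega> = i})"
    by (intro finite_measure_subadditive_finite) auto
  moreover have "(\<Union>i\<in>UNIV. {\<omega> \<in> space M. L 0 \<omega> = i}) = space M" by auto
  ultimately show False using prob_space by (simp add: z)
qed

text \<open>On the event \<open>E n\<close> the initial modes agree, \<open>\<Phi> n\<close> grows at the rate \<open>chi\<close> up to \<open>\<epsilon>\<close>, and the drawn line is stretched
  like \<open>\<Phi> n\<close> up to the factor \<open>\<kappa>\<close>.  Its probability stays above a positive constant, since the
  second property holds with probability tending to 1 and the third one with probability at least
  \<open>p\<close> given the process.  Hence the sign lemma for increments applies on both sides of \<open>chi\<close>.\<close>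

lemma mean_log_growth:
  assumes tau: "\<tau> > 0" and card: "CARD('e) \<ge> 2" and larc: "lie_algebra_rank_condition A"
    and erg: "ergodic_invariant_measure A P lam \<tau> \<mu>" and chi: "is_lyapunov_exponent M A U L chi"
  shows "(\<integral>z. (\<integral>t. log_growth (A (snd z)) t (fst z) \<partial>dwell lam \<tau>) \<partial>\<mu>) = chi * ((\<tau> * lam + 1) / lam)"
proof -
  have \<mu>: "invariant_measure A P lam \<tau> \<mu>" using erg by (simp add: ergodic_invariant_measure_def)
  interpret m: prob_space \<mu> by (rule invariant_measureD(1)[OF \<mu>])
  interpret N: pair_prob_space \<mu> M ..
  note [measurable_cong] = invariant_measureD(2)[OF \<mu>]
  have sp: "space \<mu> = UNIV" by (rule state_space_sets(1)[OF invariant_measureD(2)[OF \<mu>]])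
  define m where "m = (\<tau> * lam + 1) / lam"
  have m: "m > 0" using tau lam_pos by (simp add: m_def add_pos_pos)
  obtain i0 where i0: "prob {\<omega> \<in> space M. L 0 \<omega> = i0} > 0" using initial_mode_exists by blast
  define J where "J = {\<omega> \<in> space M. L 0 \<omega> = i0}"
  have J [measurable]: "J \<in> sets M" unfolding J_def by measurable
  obtain \<kappa> p where \<kappa>: "\<kappa> > 0" and p: "p > 0"
    and spread: "\<And>B. p \<le> measure \<mu> {z. snd z = i0 \<and> column_norm B \<le> \<kappa> * norm (B *v proj_section (fst z))}"
    using spread_directions[OF invariant_measureD(1,2)[OF \<mu>] span_support_UNIV[OF lam_pos card switching larc \<mu>, of i0]] by blast
  define K0 where "K0 = (\<Sum>i\<in>UNIV. onorm ((*v) (A i)))"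
  have K0: "onorm ((*v) (A i)) \<le> K0" for i
    unfolding K0_def by (intro member_le_sum) (auto intro: onorm_pos_le)
  have lgb: "\<bar>log_growth (A i) t q\<bar> \<le> K0 * \<bar>t\<bar>" for i t q by (rule abs_log_growth_le[OF K0])
  define g where "g z = (\<integral>t. log_growth (A (snd z)) t (fst z) \<partial>dwell lam \<tau>)" for z
  have lgm: "(\<lambda>x. log_growth (A (snd (fst x))) (snd x) (fst (fst x))) \<in> borel_measurable (state_space \<Otimes>\<^sub>M borel)"
    by (intro measurable_log_growth_mode) measurable
  then have "(\<lambda>x. log_growth (A (snd (fst x))) (snd x) (fst (fst x))) \<in> borel_measurable (state_space \<Otimes>\<^sub>M dwell lam \<tau>)"
    by (simp cong: measurable_cong_sets sets_pair_measure_cong)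
  then have gm [measurable]: "g \<in> borel_measurable state_space" unfolding g_def[abs_def]
    by (intro dwell.borel_measurable_lebesgue_integral) (simp add: case_prod_beta)
  have il: "integrable (dwell lam \<tau>) (\<lambda>t. log_growth B t q)" if "\<And>t. \<bar>log_growth B t q\<bar> \<le> K0 * \<bar>t\<bar>" for B :: "real^'d^'d" and q
  proof (rule Bochner_Integration.integrable_bound)
    show "integrable (dwell lam \<tau>) (\<lambda>t. K0 * \<bar>t\<bar>)" using integrable_dwell(1)[OF lam_pos] by simp
    show "AE t in dwell lam \<tau>. norm (log_growth B t q) \<le> norm (K0 * \<bar>t\<bar>)"
      using that by (intro AE_I2) (simp add: order_trans[OF _ abs_ge_self])
  qed measurable
  have ig: "integrable \<mu> g"
  proof (rule m.integrable_const_bound)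
    show "AE z in \<mu>. norm (g z) \<le> (\<integral>t. K0 * \<bar>t\<bar> \<partial>dwell lam \<tau>)"
    proof (rule AE_I2)
      fix z
      have "norm (g z) \<le> (\<integral>t. \<bar>log_growth (A (snd z)) t (fst z)\<bar> \<partial>dwell lam \<tau>)"
        unfolding g_def by (simp add: integral_abs_bound)
      also have "\<dots> \<le> (\<integral>t. K0 * \<bar>t\<bar> \<partial>dwell lam \<tau>)"
        using integrable_dwell(1)[OF lam_pos, of \<tau>] il[OF lgb] lgb by (intro integral_mono) auto
      finally show "norm (g z) \<le> (\<integral>t. K0 * \<bar>t\<bar> \<partial>dwell lam \<tau>)" .
    qed
  qed (use gm invariant_measureD(2)[OF \<mu>] in \<open>simp cong: measurable_cong_sets\<close>)
  \<comment> \<open>The factor s is a sign, which gives bounds in both directions.\<close>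
  have growth: "0 \<le> s * ((\<integral>z. g z \<partial>\<mu>) - a * m)"
    if E: "\<And>n. E n \<in> sets (\<mu> \<Otimes>\<^sub>M M)" "\<And>n. E n \<subseteq> same_mode \<mu> i0"
      and pE: "p' > 0" "eventually (\<lambda>n. p' \<le> measure (\<mu> \<Otimes>\<^sub>M M) (E n)) sequentially"
      and pos: "eventually (\<lambda>n. \<forall>x\<in>E n. 0 \<le> s * (ln (norm (Phi A U L n (snd x) *v proj_section (fst (fst x)))) - a * jump_time U n (snd x))) sequentially"
    for s a p' :: real and E
  proof -
    define G where "G z t = s * (log_growth (A (snd z)) t (fst z) - a * t)" for z :: "'d proj_space \<times> 'e" and t
    have "0 \<le> (\<integral>z. (\<integral>t. G z t \<partial>dwell lam \<tau>) \<partial>\<mu>)"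
    proof (rule increments_nonneg[OF \<mu> erg _ _ E pE])
      show "(\<lambda>x. G (fst x) (snd x)) \<in> borel_measurable (state_space \<Otimes>\<^sub>M borel)"
        unfolding G_def using lgm by simp
      show "\<bar>G z t\<bar> \<le> \<bar>s\<bar> * (K0 + \<bar>a\<bar>) * (1 + \<bar>t\<bar>)" for z t
      proof -
        have "K0 \<ge> 0" unfolding K0_def by (intro sum_nonneg onorm_pos_le) simp
        have "\<bar>log_growth (A (snd z)) t (fst z) - a * t\<bar> \<le> K0 * \<bar>t\<bar> + \<bar>a\<bar> * \<bar>t\<bar>"
          using lgb[of "snd z" t "fst z"] abs_triangle_ineq4[of "log_growth (A (snd z)) t (fst z)" "a * t"] by (simp add: abs_mult)
        also have "\<dots> \<le> (K0 + \<bar>a\<bar>) * (1 + \<bar>t\<bar>)" using \<open>K0 \<ge> 0\<close> by (simp add: algebra_simps)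
        finally show ?thesis unfolding G_def abs_mult mult.assoc by (intro mult_left_mono) auto
      qed
      show "\<forall>\<^sub>F n in sequentially. \<forall>x\<in>E n. 0 \<le> (\<Sum>k<n. G (state (fst (fst x)) k (snd x)) (U (Suc k) (snd x)))"
        using pos by eventually_elim (simp add: G_def sum_distrib_left[symmetric] path_sum_log_growth)
    qed
    also have "(\<lambda>z. \<integral>t. G z t \<partial>dwell lam \<tau>) = (\<lambda>z. s * (g z - a * m))"
      using il[OF lgb] integrable_dwell(1)[OF lam_pos, of \<tau>] dwell_mean[OF lam_pos, of \<tau>]
      by (simp add: G_def g_def m_def)
    also have "(\<integral>z. s * (g z - a * m) \<partial>\<mu>) = s * ((\<integral>z. g z \<partial>\<mu>) - a * m)"
      using ig m.prob_space by simp
    finally show ?thesis .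
  qed
  have both: "(chi - 2 * \<epsilon>) * m \<le> (\<integral>z. g z \<partial>\<mu>) \<and> (\<integral>z. g z \<partial>\<mu>) \<le> (chi + 2 * \<epsilon>) * m" if \<epsilon>: "\<epsilon> > 0" for \<epsilon>
  proof -
    define C where "C n = {\<omega> \<in> space M. \<bar>ln (column_norm (Phi A U L n \<omega>)) - chi * jump_time U n \<omega>\<bar> \<le> \<epsilon> * jump_time U n \<omega>
      \<and> real n * \<tau> \<le> jump_time U n \<omega>}" for n
    have C [measurable]: "C n \<in> sets M" for n unfolding C_def by measurable
    have "(\<lambda>n. \<integral>\<omega>. indicator (C n \<inter> J) \<omega> \<partial>M) \<longlonglongrightarrow> (\<integral>\<omega>. indicator J \<omega> \<partial>M :: real)"
    proof (rule integral_dominated_convergence[where w="\<lambda>_. 1"])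
      show "AE \<omega> in M. (\<lambda>n. indicator (C n \<inter> J) \<omega> :: real) \<longlonglongrightarrow> indicator J \<omega>"
        using AE_column_norm_limit[OF tau chi] AE_durations AE_space
      proof eventually_elim
        case (elim \<omega>)
        have "eventually (\<lambda>n. dist (ln (column_norm (Phi A U L n \<omega>)) / jump_time U n \<omega>) chi < \<epsilon>) sequentially"
          by (rule tendstoD[OF elim(1) \<epsilon>])
        then have "eventually (\<lambda>n. \<omega> \<in> C n) sequentially"
          using eventually_gt_at_top[of 0]
        proof eventually_elim
          case (elim n)
          have T: "real n * \<tau> \<le> jump_time U n \<omega>" by (rule jump_time_ge) fact
          moreover have "0 < real n * \<tau>" using elim tau by simp
          ultimately have pos: "0 < jump_time U n \<omega>" by linarith
          have "ln (column_norm (Phi A U L n \<omega>)) - chi * jump_time U n \<omega>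
              = (ln (column_norm (Phi A U L n \<omega>)) / jump_time U n \<omega> - chi) * jump_time U n \<omega>"
            using pos by (simp add: field_simps)
          then have "\<bar>ln (column_norm (Phi A U L n \<omega>)) - chi * jump_time U n \<omega>\<bar> \<le> \<epsilon> * jump_time U n \<omega>"
            using elim(1) pos by (simp add: abs_mult dist_real_def)
          then show ?case using T \<open>\<omega> \<in> space M\<close> by (simp add: C_def)
        qed
        then have "eventually (\<lambda>n. indicator (C n \<inter> J) \<omega> = (indicator J \<omega> :: real)) sequentially"
          by eventually_elim (simp add: indicator_def)
        then show ?case by (rule tendsto_eventually)
      qed
    qed (auto simp: indicator_def)
    then have "(\<lambda>n. prob (C n \<inter> J)) \<longlonglongrightarrow> prob J"
      using sets.sets_into_space[OF J] by (simp add: Int_absorb2 le_infI2)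
    then have evC: "eventually (\<lambda>n. prob J / 2 < prob (C n \<inter> J)) sequentially"
      using i0 by (intro order_tendstoD) (auto simp: J_def)
    define E where "E n = {x \<in> space (\<mu> \<Otimes>\<^sub>M M). snd (fst x) = i0 \<and> snd x \<in> C n \<inter> J
      \<and> column_norm (Phi A U L n (snd x)) \<le> \<kappa> * norm (Phi A U L n (snd x) *v proj_section (fst (fst x)))}" for n
    have E [measurable]: "E n \<in> sets (\<mu> \<Otimes>\<^sub>M M)" for n
    proof -
      have s1: "(snd :: 'd proj_space \<times> 'e \<Rightarrow> 'e) \<in> measurable \<mu> (count_space UNIV)"
        using measurable_cong_sets[OF invariant_measureD(2)[OF \<mu>] refl] measurable_snd by blast
      have [measurable]: "(\<lambda>x. snd (fst x)) \<in> measurable (\<mu> \<Otimes>\<^sub>M M) (count_space UNIV)"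
        by (rule measurable_compose[OF measurable_fst s1])
      have "fst \<in> borel_measurable \<mu>"
        using measurable_cong_sets[OF invariant_measureD(2)[OF \<mu>] refl] measurable_fst by blast
      then have s2: "(\<lambda>z. proj_section (fst z)) \<in> borel_measurable \<mu>" by measurable
      have [measurable]: "(\<lambda>x. Phi A U L n (snd x) *v proj_section (fst (fst x))) \<in> borel_measurable (\<mu> \<Otimes>\<^sub>M M)"
        by (rule measurable_Phi_mult[OF measurable_snd measurable_compose[OF measurable_fst s2]])
      have [measurable]: "C n \<inter> J \<in> sets M" by measurable
      have [measurable]: "(\<lambda>x. column_norm (Phi A U L n (snd x))) \<in> borel_measurable (\<mu> \<Otimes>\<^sub>M M)"
        by (rule measurable_compose[OF measurable_snd measurable_column_norm_Phi])
      show ?thesis unfolding E_def by measurable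
    qed
    have Esub: "E n \<subseteq> same_mode \<mu> i0" for n unfolding E_def J_def same_mode_def[OF \<mu>] by auto
    have Em: "p * prob (C n \<inter> J) \<le> measure (\<mu> \<Otimes>\<^sub>M M) (E n)" for n
    proof -
      have "ennreal (p * prob (C n \<inter> J)) = (\<integral>\<^sup>+\<omega>. ennreal p * indicator (C n \<inter> J) \<omega> \<partial>M)"
        using p by (simp add: nn_integral_cmult_indicator emeasure_eq_measure ennreal_mult)
      also have "\<dots> \<le> (\<integral>\<^sup>+\<omega>. emeasure \<mu> ((\<lambda>z. (z, \<omega>)) -` E n) \<partial>M)"
      proof (rule nn_integral_mono)
        fix \<omega> assume "\<omega> \<in> space M"
        show "ennreal p * indicator (C n \<inter> J) \<omega> \<le> emeasure \<mu> ((\<lambda>z. (z, \<omega>)) -` E n)"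
        proof (cases "\<omega> \<in> C n \<inter> J")
          case True
          then have "(\<lambda>z. (z, \<omega>)) -` E n = {z. snd z = i0 \<and> column_norm (Phi A U L n \<omega>) \<le> \<kappa> * norm (Phi A U L n \<omega> *v proj_section (fst z))}"
            using \<open>\<omega> \<in> space M\<close> by (auto simp: E_def space_pair_measure sp)
          then show ?thesis using spread[of "Phi A U L n \<omega>"] True by (simp add: m.emeasure_eq_measure ennreal_leI)
        qed simp
      qed
      also have "\<dots> = emeasure (\<mu> \<Otimes>\<^sub>M M) (E n)" by (rule N.emeasure_pair_measure_alt2[symmetric, OF E])
      finally show ?thesis using p by (simp add: N.P.emeasure_eq_measure)
    qed
    have pE: "p * (prob J / 2) > 0" "eventually (\<lambda>n. p * (prob J / 2) \<le> measure (\<mu> \<Otimes>\<^sub>M M) (E n)) sequentially"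
    proof -
      show "p * (prob J / 2) > 0" using p i0 by (simp add: J_def)
      show "eventually (\<lambda>n. p * (prob J / 2) \<le> measure (\<mu> \<Otimes>\<^sub>M M) (E n)) sequentially"
        using evC
      proof eventually_elim
        case (elim n)
        then have "p * (prob J / 2) \<le> p * prob (C n \<inter> J)" using p by (intro mult_left_mono) auto
        then show ?case using Em[of n] by (rule order_trans)
      qed
    qed
    have "0 \<le> 1 * ((\<integral>z. g z \<partial>\<mu>) - (chi - 2 * \<epsilon>) * m)"
    proof (rule growth[OF E Esub pE])
      \<comment> \<open>The constant factor kappa is absorbed by a second epsilon.\<close>
      have "filterlim (\<lambda>n. \<epsilon> * (real n * \<tau>)) at_top sequentially"
        by (intro filterlim_tendsto_pos_mult_at_top[OF tendsto_const \<epsilon>] filterlim_at_top_mult_tendsto_pos[OF tendsto_const tau filterlim_real_sequentially])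
      then have "eventually (\<lambda>n. ln \<kappa> \<le> \<epsilon> * (real n * \<tau>)) sequentially" by (simp add: filterlim_at_top)
      then show "\<forall>\<^sub>F n in sequentially. \<forall>x\<in>E n. 0 \<le> 1 * (ln (norm (Phi A U L n (snd x) *v proj_section (fst (fst x)))) - (chi - 2 * \<epsilon>) * jump_time U n (snd x))"
      proof eventually_elim
        case (elim n)
        show ?case
        proof
          fix x assume x: "x \<in> E n"
          let ?T = "jump_time U n (snd x)" and ?n = "norm (Phi A U L n (snd x) *v proj_section (fst (fst x)))"
          have "snd x \<in> C n" using x by (simp add: E_def)
          then have c: "\<bar>ln (column_norm (Phi A U L n (snd x))) - chi * ?T\<bar> \<le> \<epsilon> * ?T" "real n * \<tau> \<le> ?T" by (auto simp: C_def)
          have np: "?n > 0" using Phi_orbit(1) by simp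
          have "ln (column_norm (Phi A U L n (snd x))) \<le> ln (\<kappa> * ?n)"
            using x column_norm_Phi_pos by (intro ln_mono) (auto simp: E_def)
          then have "ln (column_norm (Phi A U L n (snd x))) \<le> ln \<kappa> + ln ?n" using \<kappa> np by (simp add: ln_mult)
          moreover have "ln \<kappa> \<le> \<epsilon> * ?T" using elim mult_left_mono[OF c(2), of \<epsilon>] \<epsilon> by linarith
          ultimately show "0 \<le> 1 * (ln ?n - (chi - 2 * \<epsilon>) * ?T)" using c(1) by (simp add: algebra_simps)
        qed
      qed
    qed
    moreover have "0 \<le> (- 1) * ((\<integral>z. g z \<partial>\<mu>) - (chi + 2 * \<epsilon>) * m)"
    proof (rule growth[OF E Esub pE], rule always_eventually, intro allI ballI)
      fix n x assume x: "x \<in> E n"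
      let ?T = "jump_time U n (snd x)" and ?n = "norm (Phi A U L n (snd x) *v proj_section (fst (fst x)))"
      have "snd x \<in> C n" using x by (simp add: E_def)
      then have c: "\<bar>ln (column_norm (Phi A U L n (snd x))) - chi * ?T\<bar> \<le> \<epsilon> * ?T" "real n * \<tau> \<le> ?T" by (auto simp: C_def)
      have "0 \<le> real n * \<tau>" using tau by simp
      then have T: "0 \<le> \<epsilon> * ?T" using c(2) \<epsilon> by simp
      have "ln ?n \<le> ln (column_norm (Phi A U L n (snd x)))"
        using norm_mult_le_column_norm[of "Phi A U L n (snd x)" "proj_section (fst (fst x))"]
        by (intro ln_mono) (auto simp: Phi_orbit(1))
      then show "0 \<le> (- 1) * (ln ?n - (chi + 2 * \<epsilon>) * ?T)" using c(1) T by (simp add: algebra_simps)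
    qed
    ultimately show ?thesis by simp
  qed
  have "(\<integral>z. g z \<partial>\<mu>) = chi * m"
  proof (rule ccontr)
    assume ne: "(\<integral>z. g z \<partial>\<mu>) \<noteq> chi * m"
    define \<epsilon> where "\<epsilon> = \<bar>(\<integral>z. g z \<partial>\<mu>) - chi * m\<bar> / (4 * m)"
    have "\<epsilon> > 0" using ne m by (simp add: \<epsilon>_def)
    from both[OF this] have "\<bar>(\<integral>z. g z \<partial>\<mu>) - chi * m\<bar> \<le> 2 * \<epsilon> * m" by (auto simp: abs_le_iff algebra_simps)
    also have "\<dots> = \<bar>(\<integral>z. g z \<partial>\<mu>) - chi * m\<bar> / 2" using m by (simp add: \<epsilon>_def)
    finally show False using ne by simp
  qed
  then show ?thesis by (simp add: g_def[abs_def] m_def)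
qed

end

section \<open>The averaged measure\<close>

text \<open>A set function presented by a formula is countably additive as soon as it agrees with a measure.\<close>

lemma measure_of_eq_measure:
  fixes m :: "('d::finite proj_space \<times> 'e::finite) measure"
  assumes s: "sets m = sets state_space" and eq: "\<And>B. B \<in> sets state_space \<Longrightarrow> f B = emeasure m B"
  shows "measure_of UNIV (sets state_space) f = m"
proof -
  have sp: "space m = UNIV" by (rule state_space_sets(1)[OF s])
  have "measure_of UNIV (sets state_space) f = measure_of (space m) (sets m) (emeasure m)"
    unfolding sp s
  proof (rule measure_of_eq)
    fix X :: "('d proj_space \<times> 'e) set"
    assume "X \<in> sigma_sets UNIV (sets state_space)"
    then have "X \<in> sets state_space" using sets.sigma_sets_eq[of "state_space :: ('d proj_space \<times> 'e) measure"]
      by (simp add: space_pair_measure)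
    then show "f X = emeasure m X" by (rule eq)
  qed simp
  then show ?thesis by (simp add: measure_of_of_measure)
qed

context
  fixes \<mu> :: "('d::finite proj_space \<times> 'e::finite) measure" and A :: "'e \<Rightarrow> real^'d^'d"
    and lam \<tau> :: real
  assumes prob: "prob_space \<mu>" and sets: "sets \<mu> = sets state_space" and lam: "lam > 0" and tau: "\<tau> > 0"
begin

interpretation m: prob_space \<mu> by (rule prob)
interpretation d: prob_space "dwell lam \<tau>" by (rule prob_space_dwell[OF lam])
interpretation dl: pair_sigma_finite "dwell lam \<tau>" lborel ..
interpretation mdl: pair_sigma_finite \<mu> "dwell lam \<tau> \<Otimes>\<^sub>M lborel" ..

lemmas [measurable_cong] = sets

lemma mode_part_eq_density: "mode_part \<mu> i = density \<mu> (indicator (UNIV \<times> {i}))"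
  unfolding mode_part_def
proof (rule measure_of_eq_measure)
  fix B :: "('d proj_space \<times> 'e) set" assume "B \<in> sets state_space"
  then show "emeasure \<mu> (B \<inter> UNIV \<times> {i}) = emeasure (density \<mu> (indicator (UNIV \<times> {i}))) B"
    by (subst emeasure_restricted) (auto simp: sets Int_commute)
qed (simp add: sets)

lemma emeasure_flow_mode_part:
  assumes B [measurable]: "B \<in> sets state_space"
  shows "emeasure (distr (mode_part \<mu> i) state_space (\<lambda>(q, j). (proj_flow (A i) t q, j))) B
    = (\<integral>\<^sup>+z. indicator {i} (snd z) * indicator B (proj_flow (A (snd z)) t (fst z), snd z) \<partial>\<mu>)"
proof -
  have [measurable]: "(\<lambda>(q, j). (proj_flow (A i) t q, j)) \<in> measurable \<mu> state_space" by measurable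
  have "emeasure (distr (mode_part \<mu> i) state_space (\<lambda>(q, j). (proj_flow (A i) t q, j))) B
      = (\<integral>\<^sup>+z. indicator B z \<partial>distr (density \<mu> (indicator (UNIV \<times> {i}))) state_space (\<lambda>(q, j). (proj_flow (A i) t q, j)))"
    unfolding mode_part_eq_density by (rule nn_integral_indicator[symmetric]) simp
  also have "\<dots> = (\<integral>\<^sup>+z. indicator (UNIV \<times> {i}) z * indicator B (case z of (q, j) \<Rightarrow> (proj_flow (A i) t q, j)) \<partial>\<mu>)"
    by (subst nn_integral_distr, simp, simp, subst nn_integral_density) simp_all
  also have "\<dots> = (\<integral>\<^sup>+z. indicator {i} (snd z) * indicator B (proj_flow (A (snd z)) t (fst z), snd z) \<partial>\<mu>)"
    by (intro nn_integral_cong) (auto simp: indicator_def split: prod.splits)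
  finally show ?thesis .
qed

text \<open>The averaged measure is the law of the flow of \<open>z\<close> for the time \<open>t\<close>, where \<open>z\<close> has law \<open>\<mu>\<close> and \<open>(s, t)\<close> is
  independent of \<open>z\<close> with this density against the product of the dwell-time law and Lebesgue measure: \<open>s\<close> is a
  size-biased duration and \<open>t\<close> is uniform in \<open>[0, s]\<close>.\<close>

definition flow_density :: "real \<times> real \<Rightarrow> real" where
  "flow_density = (\<lambda>(s, t). lam / (\<tau> * lam + 1) * indicator {0..s} t)"

definition flow_average :: "('d proj_space \<times> 'e) measure" where
  "flow_average = distr (density (\<mu> \<Otimes>\<^sub>M (dwell lam \<tau> \<Otimes>\<^sub>M lborel)) (\<lambda>x. ennreal (flow_density (snd x))))
    state_space (\<lambda>x. (proj_flow (A (snd (fst x))) (snd (snd x)) (fst (fst x)), snd (fst x)))"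

lemma const_pos: "lam / (\<tau> * lam + 1) > 0"
  using lam tau by (simp add: add_pos_pos)

lemma flow_density_nonneg: "0 \<le> flow_density y"
  using less_imp_le[OF const_pos]
  by (cases y) (simp only: flow_density_def prod.case, intro mult_nonneg_nonneg, auto)

lemma measurable_flow_density [measurable]: "flow_density \<in> borel_measurable (dwell lam \<tau> \<Otimes>\<^sub>M lborel)"
proof -
  have "flow_density = (\<lambda>x. lam / (\<tau> * lam + 1) * (if 0 \<le> snd x \<and> snd x \<le> fst x then 1 else 0))"
    by (auto simp: flow_density_def indicator_def fun_eq_iff)
  then show ?thesis by simp
qed

lemma measurable_flow_map [measurable]:
  "(\<lambda>x. (proj_flow (A (snd (fst x))) (snd (snd x)) (fst (fst x)), snd (fst x)))
    \<in> measurable (\<mu> \<Otimes>\<^sub>M (dwell lam \<tau> \<Otimes>\<^sub>M lborel)) state_space"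
  by (intro measurable_Pair measurable_proj_flow_mode) measurable

lemma emeasure_flow_average:
  assumes B [measurable]: "B \<in> sets state_space"
  shows "emeasure flow_average B = ennreal (lam\<^sup>2 / (\<tau> * lam + 1)) *
      (\<Sum>i\<in>UNIV. \<integral>\<^sup>+ s\<in>{\<tau>..}.
        (\<integral>\<^sup>+ t\<in>{0..s}.
          emeasure (distr (mode_part \<mu> i) state_space (\<lambda>(q, j). (proj_flow (A i) t q, j))) B
          \<partial>lborel) * ennreal (exp (- lam * (s - \<tau>))) \<partial>lborel)"
proof -
  let ?c = "lam / (\<tau> * lam + 1)"
  let ?h = "\<lambda>t z. indicator B (proj_flow (A (snd z)) t (fst z), snd z) :: ennreal"
  have hm [measurable]: "(\<lambda>x. ?h (snd (snd x)) (fst x)) \<in> borel_measurable (\<mu> \<Otimes>\<^sub>M (dwell lam \<tau> \<Otimes>\<^sub>M lborel))"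
    by (rule measurable_compose[OF measurable_flow_map]) simp
  have hmt: "(\<lambda>z. ?h t z) \<in> borel_measurable \<mu>" for t
  proof -
    have "(\<lambda>z. (proj_flow (A (snd z)) t (fst z), snd z)) \<in> measurable \<mu> state_space"
      by (intro measurable_Pair measurable_proj_flow_mode) measurable
    from measurable_compose[OF this] show ?thesis by simp
  qed
  have hmt2: "(\<lambda>x. ?h (fst x) (snd x)) \<in> borel_measurable (lborel \<Otimes>\<^sub>M \<mu>)"
  proof -
    have "(\<lambda>x. (proj_flow (A (snd (snd x))) (fst x) (fst (snd x)), snd (snd x))) \<in> measurable (lborel \<Otimes>\<^sub>M \<mu>) state_space"
      by (intro measurable_Pair measurable_proj_flow_mode) measurable
    from measurable_compose[OF this] show ?thesis by simp
  qed
  have Hm [measurable]: "(\<lambda>t. \<integral>\<^sup>+z. ?h t z \<partial>\<mu>) \<in> borel_measurable lborel"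
    using m.borel_measurable_nn_integral[of "\<lambda>t z. ?h t z" lborel] hmt2 by (simp add: case_prod_beta)
  have Hmi: "(\<lambda>t. \<integral>\<^sup>+z. indicator {i} (snd z) * ?h t z \<partial>\<mu>) \<in> borel_measurable lborel" for i
  proof (rule m.borel_measurable_nn_integral)
    have "(\<lambda>x. indicator {i} (snd (snd x)) :: ennreal) \<in> borel_measurable (lborel \<Otimes>\<^sub>M \<mu>)" by measurable
    then show "(\<lambda>(t, z). indicator {i} (snd z) * ?h t z) \<in> borel_measurable (lborel \<Otimes>\<^sub>M \<mu>)"
      using hmt2 by (simp add: case_prod_beta)
  qed
  have im: "(\<lambda>s. \<integral>\<^sup>+ t\<in>{0..s}. f t \<partial>lborel) \<in> borel_measurable borel" if [measurable]: "f \<in> borel_measurable lborel" for f :: "real \<Rightarrow> ennreal"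
  proof -
    have "(\<lambda>x. f (snd x) * (if 0 \<le> snd x \<and> snd x \<le> fst x then 1 else 0)) \<in> borel_measurable (borel \<Otimes>\<^sub>M lborel)" by measurable
    then have "(\<lambda>(s, t). f t * indicator {0..s} t) \<in> borel_measurable (borel \<Otimes>\<^sub>M lborel)"
      by (simp add: case_prod_beta indicator_def of_bool_def)
    then show ?thesis by (rule lborel.borel_measurable_nn_integral)
  qed
  have "emeasure flow_average B = (\<integral>\<^sup>+z. indicator B z \<partial>flow_average)"
    by (rule nn_integral_indicator[symmetric]) (simp add: flow_average_def)
  also have "\<dots> = (\<integral>\<^sup>+x. ennreal (flow_density (snd x)) * ?h (snd (snd x)) (fst x) \<partial>(\<mu> \<Otimes>\<^sub>M (dwell lam \<tau> \<Otimes>\<^sub>M lborel)))"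
    unfolding flow_average_def by (subst nn_integral_distr, simp, simp, subst nn_integral_density) simp_all
  also have "\<dots> = (\<integral>\<^sup>+y. \<integral>\<^sup>+z. ennreal (flow_density y) * ?h (snd y) z \<partial>\<mu> \<partial>(dwell lam \<tau> \<Otimes>\<^sub>M lborel))"
    by (subst mdl.nn_integral_snd[symmetric]) auto
  also have "\<dots> = (\<integral>\<^sup>+y. ennreal (flow_density y) * (\<integral>\<^sup>+z. ?h (snd y) z \<partial>\<mu>) \<partial>(dwell lam \<tau> \<Otimes>\<^sub>M lborel))"
    by (simp add: nn_integral_cmult hmt)
  also have "\<dots> = (\<integral>\<^sup>+s. \<integral>\<^sup>+t. ennreal (flow_density (s, t)) * (\<integral>\<^sup>+z. ?h t z \<partial>\<mu>) \<partial>lborel \<partial>dwell lam \<tau>)"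
    by (subst lborel.nn_integral_fst[symmetric]) auto
  also have "\<dots> = (\<integral>\<^sup>+s. ennreal ?c * (\<integral>\<^sup>+t\<in>{0..s}. (\<integral>\<^sup>+z. ?h t z \<partial>\<mu>) \<partial>lborel) \<partial>dwell lam \<tau>)"
    using const_pos
    by (intro nn_integral_cong, subst nn_integral_cmult[symmetric])
      (auto intro!: nn_integral_cong simp: flow_density_def indicator_def)
  also have "\<dots> = ennreal ?c * (\<integral>\<^sup>+s. (\<integral>\<^sup>+t\<in>{0..s}. (\<integral>\<^sup>+z. ?h t z \<partial>\<mu>) \<partial>lborel) \<partial>dwell lam \<tau>)"
    using im[OF Hm] by (intro nn_integral_cmult) simp
  also have "(\<integral>\<^sup>+s. (\<integral>\<^sup>+t\<in>{0..s}. (\<integral>\<^sup>+z. ?h t z \<partial>\<mu>) \<partial>lborel) \<partial>dwell lam \<tau>)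
      = (\<integral>\<^sup>+s. (\<Sum>i\<in>UNIV. (\<integral>\<^sup>+t\<in>{0..s}. (\<integral>\<^sup>+z. indicator {i} (snd z) * ?h t z \<partial>\<mu>) \<partial>lborel)) \<partial>dwell lam \<tau>)"
  proof (intro nn_integral_cong)
    fix s
    have "(\<integral>\<^sup>+z. ?h t z \<partial>\<mu>) = (\<Sum>i\<in>UNIV. \<integral>\<^sup>+z. indicator {i} (snd z) * ?h t z \<partial>\<mu>)" for t
    proof -
      have "?h t z = (\<Sum>i\<in>UNIV. indicator {i} (snd z) * ?h t z)" for z
      proof -
        have "(\<Sum>i\<in>UNIV. indicator {i} (snd z) * ?h t z) = (\<Sum>i\<in>UNIV. if snd z = i then ?h t z else 0)"
          by (intro sum.cong) (auto simp: indicator_def)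
        then show ?thesis by simp
      qed
      then have "(\<integral>\<^sup>+z. ?h t z \<partial>\<mu>) = (\<integral>\<^sup>+z. (\<Sum>i\<in>UNIV. indicator {i} (snd z) * ?h t z) \<partial>\<mu>)"
        by (intro nn_integral_cong)
      also have "\<dots> = (\<Sum>i\<in>UNIV. \<integral>\<^sup>+z. indicator {i} (snd z) * ?h t z \<partial>\<mu>)"
      proof (intro nn_integral_sum borel_measurable_times_ennreal hmt)
        fix i show "(\<lambda>z. indicator {i} (snd z) :: ennreal) \<in> borel_measurable \<mu>" by measurable
      qed
      finally show ?thesis .
    qed
    then have "(\<integral>\<^sup>+t\<in>{0..s}. (\<integral>\<^sup>+z. ?h t z \<partial>\<mu>) \<partial>lborel)
        = (\<integral>\<^sup>+t. (\<Sum>i\<in>UNIV. (\<integral>\<^sup>+z. indicator {i} (snd z) * ?h t z \<partial>\<mu>) * indicator {0..s} t) \<partial>lborel)"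
      by (simp only: sum_distrib_right)
    also have "\<dots> = (\<Sum>i\<in>UNIV. (\<integral>\<^sup>+t\<in>{0..s}. (\<integral>\<^sup>+z. indicator {i} (snd z) * ?h t z \<partial>\<mu>) \<partial>lborel))"
      using Hmi by (intro nn_integral_sum borel_measurable_times_ennreal) auto
    finally show "(\<integral>\<^sup>+t\<in>{0..s}. (\<integral>\<^sup>+z. ?h t z \<partial>\<mu>) \<partial>lborel)
        = (\<Sum>i\<in>UNIV. (\<integral>\<^sup>+t\<in>{0..s}. (\<integral>\<^sup>+z. indicator {i} (snd z) * ?h t z \<partial>\<mu>) \<partial>lborel))" .
  qed
  also have "\<dots> = (\<Sum>i\<in>UNIV. \<integral>\<^sup>+s. (\<integral>\<^sup>+t\<in>{0..s}. (\<integral>\<^sup>+z. indicator {i} (snd z) * ?h t z \<partial>\<mu>) \<partial>lborel) \<partial>dwell lam \<tau>)"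
    using im[OF Hmi] by (intro nn_integral_sum) simp
  also have "\<dots> = (\<Sum>i\<in>UNIV. ennreal lam * (\<integral>\<^sup>+ s\<in>{\<tau>..}. (\<integral>\<^sup>+ t\<in>{0..s}.
          emeasure (distr (mode_part \<mu> i) state_space (\<lambda>(q, j). (proj_flow (A i) t q, j))) B
          \<partial>lborel) * ennreal (exp (- lam * (s - \<tau>))) \<partial>lborel))"
  proof (rule sum.cong[OF refl])
    fix i
    let ?I = "\<lambda>s. (\<integral>\<^sup>+t\<in>{0..s}. (\<integral>\<^sup>+z. indicator {i} (snd z) * ?h t z \<partial>\<mu>) \<partial>lborel)"
    have [measurable]: "?I \<in> borel_measurable borel" by (rule im[OF Hmi])
    have "(\<integral>\<^sup>+s. ?I s \<partial>dwell lam \<tau>) = (\<integral>\<^sup>+s. ennreal (dwell_density lam \<tau> s) * ?I s \<partial>lborel)"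
      unfolding dwell_def by (rule nn_integral_density) simp_all
    also have "\<dots> = (\<integral>\<^sup>+s. ennreal lam * (?I s * ennreal (exp (- lam * (s - \<tau>))) * indicator {\<tau>..} s) \<partial>lborel)"
      using lam by (intro nn_integral_cong) (auto simp: dwell_density_def indicator_def ennreal_mult mult_ac)
    also have "\<dots> = ennreal lam * (\<integral>\<^sup>+s. ?I s * ennreal (exp (- lam * (s - \<tau>))) * indicator {\<tau>..} s \<partial>lborel)"
      by (rule nn_integral_cmult) simp
    finally show "(\<integral>\<^sup>+s. ?I s \<partial>dwell lam \<tau>) = ennreal lam * (\<integral>\<^sup>+ s\<in>{\<tau>..}. (\<integral>\<^sup>+ t\<in>{0..s}.
          emeasure (distr (mode_part \<mu> i) state_space (\<lambda>(q, j). (proj_flow (A i) t q, j))) B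
          \<partial>lborel) * ennreal (exp (- lam * (s - \<tau>))) \<partial>lborel)"
      by (simp only: emeasure_flow_mode_part[OF B])
  qed
  finally have "emeasure flow_average B = ennreal ?c * (ennreal lam * (\<Sum>i\<in>UNIV. \<integral>\<^sup>+ s\<in>{\<tau>..}. (\<integral>\<^sup>+ t\<in>{0..s}.
          emeasure (distr (mode_part \<mu> i) state_space (\<lambda>(q, j). (proj_flow (A i) t q, j))) B
          \<partial>lborel) * ennreal (exp (- lam * (s - \<tau>))) \<partial>lborel))"
    by (simp only: sum_distrib_left)
  moreover have "ennreal ?c * ennreal lam = ennreal (lam\<^sup>2 / (\<tau> * lam + 1))"
    using lam const_pos by (simp add: ennreal_mult[symmetric] power2_eq_square)
  ultimately show ?thesis by (simp only: mult.assoc[symmetric])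
qed

lemma averaged_measure_eq: "averaged_measure A lam \<tau> \<mu> = flow_average"
  unfolding averaged_measure_def
  by (rule measure_of_eq_measure) (simp_all only: emeasure_flow_average, simp add: flow_average_def)

lemma nn_integral_flow_density: "(\<integral>\<^sup>+y. ennreal (flow_density y) \<partial>(dwell lam \<tau> \<Otimes>\<^sub>M lborel)) = 1"
proof -
  have "(\<integral>\<^sup>+y. ennreal (flow_density y) \<partial>(dwell lam \<tau> \<Otimes>\<^sub>M lborel))
      = (\<integral>\<^sup>+s. \<integral>\<^sup>+t. ennreal (lam / (\<tau> * lam + 1)) * indicator {0..s} t \<partial>lborel \<partial>dwell lam \<tau>)"
    using const_pos by (subst lborel.nn_integral_fst[symmetric])
      (auto intro!: nn_integral_cong simp: flow_density_def indicator_def)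
  also have "\<dots> = (\<integral>\<^sup>+s. ennreal (lam / (\<tau> * lam + 1) * s) \<partial>dwell lam \<tau>)"
  proof (rule nn_integral_cong_AE)
    show "AE s in dwell lam \<tau>. (\<integral>\<^sup>+t. ennreal (lam / (\<tau> * lam + 1)) * indicator {0..s} t \<partial>lborel) = ennreal (lam / (\<tau> * lam + 1) * s)"
      using AE_dwell
    proof eventually_elim
      case (elim s)
      then have "0 \<le> s" using tau by simp
      then have "(\<integral>\<^sup>+t. ennreal (lam / (\<tau> * lam + 1)) * indicator {0..s} t \<partial>lborel) = ennreal (lam / (\<tau> * lam + 1)) * ennreal s"
        by (simp add: nn_integral_cmult_indicator)
      also have "\<dots> = ennreal (lam / (\<tau> * lam + 1) * s)"
        by (rule ennreal_mult[symmetric, OF less_imp_le[OF const_pos] \<open>0 \<le> s\<close>])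
      finally show ?case .
    qed
  qed
  also have "\<dots> = ennreal (\<integral>s. lam / (\<tau> * lam + 1) * s \<partial>dwell lam \<tau>)"
  proof (rule nn_integral_eq_integral)
    show "integrable (dwell lam \<tau>) (\<lambda>s. lam / (\<tau> * lam + 1) * s)" using integrable_dwell(1)[OF lam] by simp
    show "AE s in dwell lam \<tau>. 0 \<le> lam / (\<tau> * lam + 1) * s"
      using AE_dwell
    proof eventually_elim
      case (elim s)
      then show ?case using tau by (intro mult_nonneg_nonneg less_imp_le[OF const_pos]) simp
    qed
  qed
  also have "(\<integral>s. lam / (\<tau> * lam + 1) * s \<partial>dwell lam \<tau>) = lam / (\<tau> * lam + 1) * ((\<tau> * lam + 1) / lam)"
    using dwell_mean[OF lam, of \<tau>] by simp
  also have "\<dots> = 1"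
    using lam const_pos by (simp add: zero_less_divide_iff less_imp_neq[symmetric])
  finally show ?thesis by simp
qed

lemma prob_space_flow_average: "prob_space flow_average"
proof -
  have "prob_space (density (\<mu> \<Otimes>\<^sub>M (dwell lam \<tau> \<Otimes>\<^sub>M lborel)) (\<lambda>x. ennreal (flow_density (snd x))))"
  proof (rule prob_spaceI)
    let ?N = "\<mu> \<Otimes>\<^sub>M (dwell lam \<tau> \<Otimes>\<^sub>M lborel)"
    have "emeasure (density ?N (\<lambda>x. ennreal (flow_density (snd x)))) (space ?N)
      = (\<integral>\<^sup>+x. ennreal (flow_density (snd x)) \<partial>?N)"
    proof (subst emeasure_density[OF _ sets.top])
      show "(\<lambda>x. ennreal (flow_density (snd x))) \<in> borel_measurable ?N" by measurable
      show "(\<integral>\<^sup>+x. ennreal (flow_density (snd x)) * indicator (space ?N) x \<partial>?N) = (\<integral>\<^sup>+x. ennreal (flow_density (snd x)) \<partial>?N)"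
        by (intro nn_integral_cong) simp
    qed
    also have "\<dots> = (\<integral>\<^sup>+z. \<integral>\<^sup>+y. ennreal (flow_density y) \<partial>(dwell lam \<tau> \<Otimes>\<^sub>M lborel) \<partial>\<mu>)"
      by (subst dl.nn_integral_fst[symmetric]) auto
    also have "\<dots> = 1" by (simp add: nn_integral_flow_density m.emeasure_space_1)
    finally show "emeasure (density ?N (\<lambda>x. ennreal (flow_density (snd x)))) (space (density ?N (\<lambda>x. ennreal (flow_density (snd x))))) = 1"
      by simp
  qed
  then show ?thesis unfolding flow_average_def by (rule prob_space.prob_space_distr) simp
qed

end

lemma proj_section_form: "proj_section q \<bullet> (B *v proj_section q) = unit_rep q \<bullet> (B *v unit_rep q)"
proof -
  have "B *v (- unit_rep q) = - (B *v unit_rep q)"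
    using matrix_vector_mult_scaleR[of B "-1" "unit_rep q"] by simp
  then show ?thesis using proj_section_cases[of q] by auto
qed

text \<open>The logarithmic derivative of the norm along the flow is the quadratic form of the generator.\<close>

lemma integral_form_along_flow:
  fixes B :: "real^'d^'d::finite"
  assumes "0 \<le> s"
  shows "(\<integral>t. unit_rep (proj_flow B t q) \<bullet> (B *v unit_rep (proj_flow B t q)) * indicator {0..s} t \<partial>lborel) = log_growth B s q"
proof -
  let ?y = "\<lambda>t. mat_exp (t *\<^sub>R B) *v proj_section q"
  let ?f = "\<lambda>t. (?y t \<bullet> (B *v ?y t)) / (?y t \<bullet> ?y t)"
  have form: "unit_rep (proj_flow B t q) \<bullet> (B *v unit_rep (proj_flow B t q)) = ?f t" for t
  proof -
    let ?p = "proj_section (proj_flow B t q)"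
    have "to_proj ?p = to_proj (?y t)" by (simp add: proj_flow_section)
    then obtain c where c: "c \<noteq> 0" "?y t = c *\<^sub>R ?p"
      using to_proj_eq_iff[of ?p "?y t"] by auto
    have "?f t = (c * c * (?p \<bullet> (B *v ?p))) / (c * c)"
      unfolding c(2) by (simp add: matrix_vector_mult_scaleR dot_square_norm mult.assoc power2_eq_square)
    then show ?thesis using c(1) by (simp add: proj_section_form)
  qed
  have d: "((\<lambda>t. ?y t \<bullet> ?y t) has_real_derivative 2 * (?y t \<bullet> (B *v ?y t))) (at t)" for t
    by (rule norm_square_mat_exp_derivative)
  have pos: "?y t \<bullet> ?y t > 0" for t by simp
  have F: "((\<lambda>t. ln (?y t \<bullet> ?y t) / 2) has_real_derivative ?f t) (at t)" for t
    by (auto intro!: derivative_eq_intros d simp: pos)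
  have cy: "continuous_on UNIV ?y"
    by (intro continuous_on_vector_derivative) (use mat_exp_has_vector_derivative in auto)
  have "(\<integral>t. ?f t * indicator {0..s} t \<partial>lborel) = ln (?y s \<bullet> ?y s) / 2 - ln (?y 0 \<bullet> ?y 0) / 2"
  proof (rule integral_FTC_Icc_real[OF assms F])
    fix t
    have "continuous_on UNIV (\<lambda>t. B *v ?y t)"
      by (rule bounded_linear.continuous_on[OF matrix_vector_mul_bounded_linear cy])
    then have "continuous_on UNIV ?f" using cy by (auto intro!: continuous_intros)
    then show "isCont ?f t" by (simp add: continuous_on_eq_continuous_at)
  qed
  also have "\<dots> = log_growth B s q"
    by (simp add: mat_exp_zero dot_square_norm log_growth_def ln_realpow)
  finally show ?thesis by (simp add: form)
qed

context
  fixes \<mu> :: "('d::finite proj_space \<times> 'e::finite) measure" and A :: "'e \<Rightarrow> real^'d^'d"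
    and lam \<tau> :: real
  assumes prob: "prob_space \<mu>" and sets: "sets \<mu> = sets state_space" and lam: "lam > 0" and tau: "\<tau> > 0"
begin

interpretation m: prob_space \<mu> by (rule prob)
interpretation d: prob_space "dwell lam \<tau>" by (rule prob_space_dwell[OF lam])
interpretation dl: pair_sigma_finite "dwell lam \<tau>" lborel ..
interpretation mdl: pair_sigma_finite \<mu> "dwell lam \<tau> \<Otimes>\<^sub>M lborel" ..

lemmas [measurable_cong] = sets

text \<open>Integrating first over \<open>t\<close> gives the logarithmic growth over a full duration \<open>s\<close>.\<close>

lemma integral_averaged_measure:
  "(\<integral>(\<theta>, i). unit_rep \<theta> \<bullet> (A i *v unit_rep \<theta>) \<partial>averaged_measure A lam \<tau> \<mu>)
    = lam / (\<tau> * lam + 1) * (\<integral>z. (\<integral>t. log_growth (A (snd z)) t (fst z) \<partial>dwell lam \<tau>) \<partial>\<mu>)"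
proof -
  let ?N = "\<mu> \<Otimes>\<^sub>M (dwell lam \<tau> \<Otimes>\<^sub>M lborel)"
  let ?w = "flow_density lam \<tau>"
  let ?\<Phi> = "\<lambda>x. (proj_flow (A (snd (fst x))) (snd (snd x)) (fst (fst x)), snd (fst x))"
  define h where "h z = proj_section (fst z) \<bullet> (A (snd z) *v proj_section (fst z))" for z
  define K where "K = (\<Sum>i\<in>UNIV. onorm ((*v) (A i)))"
  have hK: "\<bar>h z\<bar> \<le> K" for z
  proof -
    have "\<bar>h z\<bar> \<le> norm (A (snd z) *v proj_section (fst z))"
      unfolding h_def using Cauchy_Schwarz_ineq2[of "proj_section (fst z)" "A (snd z) *v proj_section (fst z)"] by simp
    also have "\<dots> \<le> onorm ((*v) (A (snd z)))"
      using onorm[OF matrix_vector_mul_bounded_linear, of "A (snd z)" "proj_section (fst z)"] by simp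
    also have "\<dots> \<le> K" unfolding K_def by (intro member_le_sum) (auto intro: onorm_pos_le)
    finally show ?thesis .
  qed
  have h [measurable]: "h \<in> borel_measurable state_space"
    unfolding h_def[abs_def]
  proof (rule measurable_compose_countable'[where g=snd and I=UNIV and f="\<lambda>i z. proj_section (fst z) \<bullet> (A i *v proj_section (fst z))"])
    fix i
    have [measurable]: "(\<lambda>x. A i *v x) \<in> borel_measurable borel"
      by (intro borel_measurable_continuous_onI linear_continuous_on matrix_vector_mul_bounded_linear)
    show "(\<lambda>z. proj_section (fst z) \<bullet> (A i *v proj_section (fst z))) \<in> borel_measurable (borel \<Otimes>\<^sub>M count_space (UNIV :: 'e set))"
      by measurable
  qed (auto intro: countable_finite)
  have \<Phi> [measurable]: "?\<Phi> \<in> measurable ?N state_space"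
    by (rule measurable_flow_map[OF prob sets lam tau])
  have w [measurable]: "?w \<in> borel_measurable (dwell lam \<tau> \<Otimes>\<^sub>M lborel)"
    by (rule measurable_flow_density[OF prob sets lam tau])
  have w0: "0 \<le> ?w y" for y by (rule flow_density_nonneg[OF prob sets lam tau])
  have wN [measurable]: "(\<lambda>x. ?w (snd x)) \<in> borel_measurable ?N" by (rule measurable_compose[OF measurable_snd w])
  have h\<Phi> [measurable]: "(\<lambda>x. h (?\<Phi> x)) \<in> borel_measurable ?N" by (rule measurable_compose[OF \<Phi> h])
  have K0: "K \<ge> 0" using hK[of undefined] by simp
  have iw: "integrable (dwell lam \<tau> \<Otimes>\<^sub>M lborel) ?w"
    using nn_integral_flow_density[OF prob sets lam tau] w0 by (intro integrableI_nonneg) auto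
  have iN: "integrable ?N (\<lambda>x. ?w (snd x) * h (?\<Phi> x))"
  proof (rule integrableI_bounded)
    have "(\<integral>\<^sup>+x. ennreal (norm (?w (snd x) * h (?\<Phi> x))) \<partial>?N) \<le> (\<integral>\<^sup>+x. ennreal K * ennreal (?w (snd x)) \<partial>?N)"
    proof (intro nn_integral_mono)
      fix x
      have "norm (?w (snd x) * h (?\<Phi> x)) \<le> K * ?w (snd x)"
        using mult_right_mono[OF hK[of "?\<Phi> x"] w0[of "snd x"]] by (simp add: abs_mult mult.commute abs_of_nonneg[OF w0])
      then show "ennreal (norm (?w (snd x) * h (?\<Phi> x))) \<le> ennreal K * ennreal (?w (snd x))"
        using K0 w0 by (simp add: ennreal_mult[symmetric] ennreal_leI)
    qed
    also have "\<dots> = (\<integral>\<^sup>+z. \<integral>\<^sup>+y. ennreal K * ennreal (?w y) \<partial>(dwell lam \<tau> \<Otimes>\<^sub>M lborel) \<partial>\<mu>)"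
      by (subst dl.nn_integral_fst[symmetric]) auto
    also have "\<dots> = ennreal K"
      by (simp add: nn_integral_cmult nn_integral_flow_density[OF prob sets lam tau] m.emeasure_space_1)
    finally show "(\<integral>\<^sup>+x. ennreal (norm (?w (snd x) * h (?\<Phi> x))) \<partial>?N) < \<infinity>"
      by (simp add: le_less_trans)
  qed measurable
  have "(\<integral>(\<theta>, i). unit_rep \<theta> \<bullet> (A i *v unit_rep \<theta>) \<partial>averaged_measure A lam \<tau> \<mu>) = (\<integral>z. h z \<partial>flow_average \<mu> A lam \<tau>)"
    unfolding averaged_measure_eq[OF prob sets lam tau] h_def by (simp add: case_prod_unfold proj_section_form)
  also have "\<dots> = (\<integral>x. ?w (snd x) * h (?\<Phi> x) \<partial>?N)"
    unfolding flow_average_def[OF prob sets lam tau]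
    by (subst integral_distr, simp, simp, subst integral_density) (auto simp: w0)
  also have "\<dots> = (\<integral>z. \<integral>y. ?w y * h (?\<Phi> (z, y)) \<partial>(dwell lam \<tau> \<Otimes>\<^sub>M lborel) \<partial>\<mu>)"
    using mdl.integral_fst'[OF iN] by simp
  also have "\<dots> = (\<integral>z. lam / (\<tau> * lam + 1) * (\<integral>t. log_growth (A (snd z)) t (fst z) \<partial>dwell lam \<tau>) \<partial>\<mu>)"
  proof (intro Bochner_Integration.integral_cong refl)
    fix z :: "'d proj_space \<times> 'e"
    have hz: "(\<lambda>y. h (?\<Phi> (z, y))) \<in> borel_measurable (dwell lam \<tau> \<Otimes>\<^sub>M lborel)"
      by (rule measurable_compose[OF measurable_Pair1' h\<Phi>]) (simp add: state_space_sets(1)[OF sets])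
    have "integrable (dwell lam \<tau> \<Otimes>\<^sub>M lborel) (\<lambda>y. ?w y * h (?\<Phi> (z, y)))"
    proof (rule Bochner_Integration.integrable_bound[OF integrable_mult_right[OF iw, of K]])
      show "(\<lambda>y. ?w y * h (?\<Phi> (z, y))) \<in> borel_measurable (dwell lam \<tau> \<Otimes>\<^sub>M lborel)" using hz w by (rule borel_measurable_times[rotated])
      show "AE y in dwell lam \<tau> \<Otimes>\<^sub>M lborel. norm (?w y * h (?\<Phi> (z, y))) \<le> norm (K * ?w y)"
      proof (rule AE_I2)
        fix y show "norm (?w y * h (?\<Phi> (z, y))) \<le> norm (K * ?w y)"
          using mult_right_mono[OF hK[of "?\<Phi> (z, y)"] w0[of y]] K0
          by (simp add: abs_mult mult.commute abs_of_nonneg[OF w0])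
      qed
    qed
    from dl.integral_fst'[OF this]
    have "(\<integral>y. ?w y * h (?\<Phi> (z, y)) \<partial>(dwell lam \<tau> \<Otimes>\<^sub>M lborel)) = (\<integral>s. \<integral>t. ?w (s, t) * h (?\<Phi> (z, (s, t))) \<partial>lborel \<partial>dwell lam \<tau>)"
      by simp
    also have "\<dots> = (\<integral>s. lam / (\<tau> * lam + 1) * log_growth (A (snd z)) s (fst z) \<partial>dwell lam \<tau>)"
    proof (rule integral_cong_AE)
      show "AE s in dwell lam \<tau>. (\<integral>t. ?w (s, t) * h (?\<Phi> (z, (s, t))) \<partial>lborel) = lam / (\<tau> * lam + 1) * log_growth (A (snd z)) s (fst z)"
        using AE_dwell
      proof eventually_elim
        case (elim s)
        then have s: "0 \<le> s" using tau by simp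
        have "(\<integral>t. ?w (s, t) * h (?\<Phi> (z, (s, t))) \<partial>lborel)
          = (\<integral>t. lam / (\<tau> * lam + 1) * (unit_rep (proj_flow (A (snd z)) t (fst z)) \<bullet> (A (snd z) *v unit_rep (proj_flow (A (snd z)) t (fst z))) * indicator {0..s} t) \<partial>lborel)"
          by (simp add: flow_density_def[OF prob sets lam tau] h_def proj_section_form mult_ac)
        also have "\<dots> = lam / (\<tau> * lam + 1) * log_growth (A (snd z)) s (fst z)"
          by (subst Bochner_Integration.integral_mult_right_zero) (simp only: integral_form_along_flow[OF s])
        finally show ?case .
      qed
      show "(\<lambda>s. \<integral>t. ?w (s, t) * h (?\<Phi> (z, (s, t))) \<partial>lborel) \<in> borel_measurable (dwell lam \<tau>)"
        using borel_measurable_times[OF w hz] by (intro lborel.borel_measurable_lebesgue_integral) (simp add: case_prod_beta)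
    qed measurable
    finally show "(\<integral>y. ?w y * h (?\<Phi> (z, y)) \<partial>(dwell lam \<tau> \<Otimes>\<^sub>M lborel))
        = lam / (\<tau> * lam + 1) * (\<integral>t. log_growth (A (snd z)) t (fst z) \<partial>dwell lam \<tau>)"
      by simp
  qed
  finally show ?thesis by simp
qed

end

section \<open>The support of the averaged measure\<close>

lemma open_proj_flow_vimage:
  fixes B :: "real^'d^'d::finite"
  assumes V: "open V" shows "open {p. proj_flow B t p \<in> V}"
proof -
  have "open ((\<lambda>x. mat_exp (t *\<^sub>R B) *v x) -` {x. x \<noteq> 0 \<and> to_proj x \<in> V})"
    using V[unfolded open_proj_iff]
    by (rule open_vimage) (intro linear_continuous_on matrix_vector_mul_bounded_linear)
  moreover have "{x. x \<noteq> 0 \<and> to_proj x \<in> {p. proj_flow B t p \<in> V}}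
      = (\<lambda>x. mat_exp (t *\<^sub>R B) *v x) -` {x. x \<noteq> 0 \<and> to_proj x \<in> V}"
    by (auto simp: proj_flow_to_proj)
  ultimately show ?thesis unfolding open_proj_iff by simp
qed

lemma closed_mode_support: "closed {q. (q, i) \<in> measure_support \<mu>}"
  unfolding closed_def
proof (rule topological_space_class.openI)
  fix q assume "q \<in> - {q. (q, i) \<in> measure_support \<mu>}"
  then obtain V where V: "open V" "q \<in> V" "\<not> emeasure \<mu> (V \<times> {i}) > 0" by (auto simp: measure_support_def)
  then have "V \<subseteq> - {q. (q, i) \<in> measure_support \<mu>}" by (auto simp: measure_support_def)
  then show "\<exists>T. open T \<and> q \<in> T \<and> T \<subseteq> - {q. (q, i) \<in> measure_support \<mu>}" using V by blast
qed

text \<open>The unit vectors in the lines of \<open>C\<close> form a compact set, hence so do their normalised images under the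
  flow up to time \<open>s\<close>.  A nonzero vector spans a line of the image of \<open>C\<close> exactly if its normalisation
  lies in this compact set.\<close>

lemma closed_flow_image:
  fixes B :: "real^'d^'d::finite"
  assumes C: "closed C" shows "closed (\<Union>t\<in>{0..s}. proj_flow B t ` C)"
proof -
  let ?K = "{x. norm x = 1 \<and> to_proj x \<in> C}"
  let ?I = "(\<lambda>y. y /\<^sub>R norm y) ` (\<lambda>(t, x). mat_exp (t *\<^sub>R B) *v x) ` ({0..s} \<times> ?K)"
  have "closed ?K"
  proof -
    have "?K = sphere 0 1 - {x. x \<noteq> 0 \<and> to_proj x \<in> - C}" by auto
    moreover have "open {x. x \<noteq> 0 \<and> to_proj x \<in> - C}" using C unfolding closed_def open_proj_iff .
    ultimately show ?thesis by (simp add: closed_Diff)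
  qed
  then have "compact ?K"
    by (intro compact_eq_bounded_closed[THEN iffD2] conjI) (auto simp: bounded_iff intro: exI[of _ 1])
  then have "compact ((\<lambda>(t, x). mat_exp (t *\<^sub>R B) *v x) ` ({0..s} \<times> ?K))"
    by (intro compact_continuous_image compact_Times continuous_on_subset[OF continuous_on_mat_exp_mult]) auto
  then have "compact ?I"
    by (rule compact_continuous_image[rotated]) (auto intro!: continuous_intros)
  then have "open (- ?I)" by (simp add: compact_imp_closed open_Compl)
  moreover have "continuous_on (- {0 :: real^'d}) (\<lambda>y. y /\<^sub>R norm y)" by (auto intro!: continuous_intros)
  ultimately have "open ((\<lambda>y. y /\<^sub>R norm y) -` (- ?I) \<inter> - {0 :: real^'d})"
    using continuous_on_open_vimage[of "- {0 :: real^'d}" "\<lambda>y. y /\<^sub>R norm y"] by (auto simp: open_Compl)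
  moreover have "(\<lambda>y. y /\<^sub>R norm y) -` (- ?I) \<inter> - {0} = {x. x \<noteq> 0 \<and> to_proj x \<in> - (\<Union>t\<in>{0..s}. proj_flow B t ` C)}"
  proof -
    have iff: "x /\<^sub>R norm x \<in> ?I \<longleftrightarrow> to_proj x \<in> (\<Union>t\<in>{0..s}. proj_flow B t ` C)" if x: "x \<noteq> 0" for x
    proof
      assume "x /\<^sub>R norm x \<in> ?I"
      then obtain t y where ty: "t \<in> {0..s}" "norm y = 1" "to_proj y \<in> C"
        "x /\<^sub>R norm x = (mat_exp (t *\<^sub>R B) *v y) /\<^sub>R norm (mat_exp (t *\<^sub>R B) *v y)" by auto
      then have y: "y \<noteq> 0" by auto
      have "to_proj x = to_proj (x /\<^sub>R norm x)" using x by (simp add: to_proj_scaleR)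
      also have "\<dots> = to_proj (mat_exp (t *\<^sub>R B) *v y)" unfolding ty(4) using y by (simp add: to_proj_scaleR)
      also have "\<dots> = proj_flow B t (to_proj y)" using y by (simp add: proj_flow_to_proj)
      finally show "to_proj x \<in> (\<Union>t\<in>{0..s}. proj_flow B t ` C)" using ty by auto
    next
      assume "to_proj x \<in> (\<Union>t\<in>{0..s}. proj_flow B t ` C)"
      then obtain t c where tc: "t \<in> {0..s}" "c \<in> C" "to_proj x = proj_flow B t c" by auto
      let ?y = "mat_exp (t *\<^sub>R B) *v proj_section c"
      have "to_proj (?y /\<^sub>R norm ?y) = to_proj (x /\<^sub>R norm x)"
        using tc x by (simp add: to_proj_scaleR proj_flow_section)
      then have "x /\<^sub>R norm x = ?y /\<^sub>R norm ?y \<or> x /\<^sub>R norm x = - (?y /\<^sub>R norm ?y)"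
        by (rule unit_vectors_same_line) (use x in auto)
      then obtain v where v: "v = proj_section c \<or> v = - proj_section c"
        "x /\<^sub>R norm x = (mat_exp (t *\<^sub>R B) *v v) /\<^sub>R norm (mat_exp (t *\<^sub>R B) *v v)"
      proof
        assume e: "x /\<^sub>R norm x = - (?y /\<^sub>R norm ?y)"
        have "mat_exp (t *\<^sub>R B) *v (- proj_section c) = - ?y"
          using matrix_vector_mult_scaleR[of "mat_exp (t *\<^sub>R B)" "-1" "proj_section c"] by simp
        then show ?thesis using e that[of "- proj_section c"] by simp
      qed (use that in blast)
      have "to_proj (- proj_section c) = c" using to_proj_scaleR[of "-1" "proj_section c"] by simp
      then have "norm v = 1" "to_proj v \<in> C" using v(1) tc(2) by auto
      then show "x /\<^sub>R norm x \<in> ?I" using v(2) tc(1) by (auto intro!: image_eqI[of _ _ "mat_exp (t *\<^sub>R B) *v v"] image_eqI[of _ _ "(t, v)"])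
    qed
    show ?thesis
    proof (rule set_eqI)
      fix x
      show "x \<in> (\<lambda>y. y /\<^sub>R norm y) -` (- ?I) \<inter> - {0} \<longleftrightarrow> x \<in> {x. x \<noteq> 0 \<and> to_proj x \<in> - (\<Union>t\<in>{0..s}. proj_flow B t ` C)}"
        unfolding Int_iff vimage_eq Compl_iff mem_Collect_eq singleton_iff using iff[of x] by blast
    qed
  qed
  ultimately show ?thesis unfolding closed_def open_proj_iff by simp
qed

text \<open>From time \<open>\<tau>\<close> on, the flow of mode \<open>i\<close> carries the support of the \<open>i\<close>-part of \<open>\<mu>\<close> into that of another
  mode \<open>j\<close>, which lies in \<open>D\<close>, the image of \<open>D\<close> at time 0.  The images at times up to \<open>\<tau>\<close>, together with the
  support of the \<open>j\<close>-part, form a closed set \<open>C\<close>, whose complement is a null set in mode \<open>i\<close>.\<close>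

lemma support_averaged_measure:
  fixes A :: "'e::finite \<Rightarrow> real^'d^'d::finite"
  assumes lam: "lam > 0" and tau: "\<tau> > 0" and card: "CARD('e) \<ge> 2" and P: "switching_matrix P"
    and \<mu>: "invariant_measure A P lam \<tau> \<mu>" and D: "measure_support \<mu> \<subseteq> D \<times> UNIV"
  shows "measure_support (averaged_measure A lam \<tau> \<mu>) \<subseteq> (\<Union>i. \<Union>t\<in>{0..\<tau>}. proj_flow (A i) t ` D \<times> {i})"
proof clarify
  fix q i assume q: "(q, i) \<in> measure_support (averaged_measure A lam \<tau> \<mu>)"
  note sets = invariant_measureD(2)[OF \<mu>] and prob = invariant_measureD(1)[OF \<mu>]
  define S where "S j = {q. (q, j) \<in> measure_support \<mu>}" for j
  have SD: "S j \<subseteq> D" for j using D by (auto simp: S_def)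
  obtain j where j: "i \<noteq> j" using exists_other_mode[OF card] by blast
  define C where "C = (\<Union>t\<in>{0..\<tau>}. proj_flow (A i) t ` S i) \<union> S j"
  have "closed C" unfolding C_def S_def by (intro closed_Un closed_flow_image closed_mode_support)
  then have V: "open (- C)" by (simp add: closed_def)
  have flow: "proj_flow (A i) t p \<in> C" if "p \<in> S i" "0 \<le> t" for p t
  proof (cases "t \<le> \<tau>")
    case False
    then have "proj_flow (A i) t p \<in> S j"
      using support_flow_invariant[OF lam P \<mu> _ _ j, of p t] that by (simp add: S_def)
    then show ?thesis by (simp add: C_def)
  qed (use that in \<open>auto simp: C_def\<close>)
  have "q \<in> C"
  proof (rule ccontr)
    assume "q \<notin> C"
    then have pos: "emeasure (averaged_measure A lam \<tau> \<mu>) ((- C) \<times> {i}) > 0"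
      using q V unfolding measure_support_def by auto
    have Vm [measurable]: "(- C) \<times> {i} \<in> sets state_space" using V by auto
    have zero: "emeasure (distr (mode_part \<mu> k) state_space (\<lambda>(q, j). (proj_flow (A k) t q, j))) ((- C) \<times> {i}) = 0"
      if t: "0 \<le> t" for k t
    proof -
      let ?W = "{p. proj_flow (A i) t p \<in> - C}"
      have W: "open ?W" by (rule open_proj_flow_vimage[OF V])
      have "emeasure (distr (mode_part \<mu> k) state_space (\<lambda>(q, j). (proj_flow (A k) t q, j))) ((- C) \<times> {i})
        = (\<integral>\<^sup>+z. indicator {k} (snd z) * indicator ((- C) \<times> {i}) (proj_flow (A (snd z)) t (fst z), snd z) \<partial>\<mu>)"
        by (rule emeasure_flow_mode_part[OF prob sets lam tau Vm])
      also have "\<dots> \<le> (\<integral>\<^sup>+z. indicator (?W \<times> {i}) z \<partial>\<mu>)"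
        by (intro nn_integral_mono) (auto simp: indicator_def)
      also have "\<dots> = emeasure \<mu> (?W \<times> {i})" by (rule nn_integral_indicator) (rule state_space_sets(2)[OF sets W])
      also have "\<dots> = 0"
        by (rule measure_zero_off_support[OF sets W]) (use flow t in \<open>auto simp: S_def\<close>)
      finally show ?thesis by simp
    qed
    have "emeasure (averaged_measure A lam \<tau> \<mu>) ((- C) \<times> {i}) = 0"
      unfolding averaged_measure_eq[OF prob sets lam tau] emeasure_flow_average[OF prob sets lam tau Vm]
    proof -
      have "(\<integral>\<^sup>+ t\<in>{0..s}. emeasure (distr (mode_part \<mu> k) state_space (\<lambda>(q, j). (proj_flow (A k) t q, j))) ((- C) \<times> {i}) \<partial>lborel) = 0" for k s
      proof -
        have "(\<integral>\<^sup>+ t\<in>{0..s}. emeasure (distr (mode_part \<mu> k) state_space (\<lambda>(q, j). (proj_flow (A k) t q, j))) ((- C) \<times> {i}) \<partial>lborel)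
            = (\<integral>\<^sup>+ t. 0 \<partial>(lborel :: real measure))"
        proof (intro nn_integral_cong)
          fix t
          show "emeasure (distr (mode_part \<mu> k) state_space (\<lambda>(q, j). (proj_flow (A k) t q, j))) ((- C) \<times> {i}) * indicator {0..s} t = 0"
          proof (cases "0 \<le> t")
            case True
            then show ?thesis by (simp only: zero mult_zero_left)
          qed (simp add: indicator_def)
        qed
        then show ?thesis by simp
      qed
      then show "ennreal (lam\<^sup>2 / (\<tau> * lam + 1)) *
        (\<Sum>i'\<in>UNIV. \<integral>\<^sup>+ s\<in>{\<tau>..}. (\<integral>\<^sup>+ t\<in>{0..s}.
          emeasure (distr (mode_part \<mu> i') state_space (\<lambda>(q, j). (proj_flow (A i') t q, j))) ((- C) \<times> {i})
          \<partial>lborel) * ennreal (exp (- lam * (s - \<tau>))) \<partial>lborel) = 0"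
        by simp
    qed
    then show False using pos by simp
  qed
  then consider t p where "t \<in> {0..\<tau>}" "p \<in> S i" "q = proj_flow (A i) t p" | "q \<in> S j" by (auto simp: C_def)
  then show "(q, i) \<in> (\<Union>i. \<Union>t\<in>{0..\<tau>}. proj_flow (A i) t ` D \<times> {i})"
  proof cases
    case 1
    then have "q \<in> proj_flow (A i) t ` D" using SD by blast
    then show ?thesis using 1(1) by blast
  next
    case 2
    have "proj_flow (A i) 0 q = q" by (simp add: proj_flow_section mat_exp_zero)
    then have "q \<in> proj_flow (A i) 0 ` D" using 2 SD[of j] by (metis imageI subsetD)
    then show ?thesis using tau by (intro UN_I[of i] UN_I[of 0]) auto
  qed
qed

section \<open>Support and Lyapunov exponent\<close>

theorem proposition38:
  fixes A :: "'e::finite \<Rightarrow> real^'d^'d::finite"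
    and P :: "'e \<Rightarrow> 'e \<Rightarrow> real"
    and lam \<tau> chi :: real
    and D :: "'d proj_space set"
    and \<mu> :: "('d proj_space \<times> 'e) measure"
    and M :: "'w measure"
    and U :: "nat \<Rightarrow> 'w \<Rightarrow> real"
    and Q :: "nat \<Rightarrow> 'w \<Rightarrow> 'd proj_space"
    and L :: "nat \<Rightarrow> 'w \<Rightarrow> 'e"
  assumes "lam > 0" and "\<tau> > 0" and "CARD('e) \<ge> 2"
    and "switching_matrix P"
    and "lie_algebra_rank_condition A"
    and "invariant_dwell_control_set A \<tau> D"
    and "ergodic_invariant_measure A P lam \<tau> \<mu>"
    and "measure_support \<mu> \<subseteq> D \<times> UNIV"
    and "switching_process M A P lam \<tau> U Q L"
    and "is_lyapunov_exponent M A U L chi"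
  defines "\<nu> \<equiv> averaged_measure A lam \<tau> \<mu>"
  shows "prob_space \<nu> \<and>
    measure_support \<nu> \<subseteq> (\<Union>i. \<Union>t\<in>{0..\<tau>}. proj_flow (A i) t ` D \<times> {i}) \<and>
    chi = (\<integral>(\<theta>, i). unit_rep \<theta> \<bullet> (A i *v unit_rep \<theta>) \<partial>\<nu>)"
proof (intro conjI)
  have \<mu>: "invariant_measure A P lam \<tau> \<mu>"
    using assms(7) by (simp add: ergodic_invariant_measure_def)
  note \<mu>' = invariant_measureD(1,2)[OF \<mu>]
  interpret switching_process M A P lam \<tau> U Q L by fact
  interpret standard_switching_process M A P lam \<tau> U Q L
    by unfold_locales (use assms in auto)
  show "prob_space \<nu>"
    unfolding \<nu>_def averaged_measure_eq[OF \<mu>' assms(1,2)] by (rule prob_space_flow_average[OF \<mu>' assms(1,2)])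
  show "measure_support \<nu> \<subseteq> (\<Union>i. \<Union>t\<in>{0..\<tau>}. proj_flow (A i) t ` D \<times> {i})"
    unfolding \<nu>_def by (rule support_averaged_measure) fact+
  have "(\<integral>(\<theta>, i). unit_rep \<theta> \<bullet> (A i *v unit_rep \<theta>) \<partial>\<nu>) = lam / (\<tau> * lam + 1) * (chi * ((\<tau> * lam + 1) / lam))"
    unfolding \<nu>_def integral_averaged_measure[OF \<mu>' assms(1,2)]
    using mean_log_growth[OF assms(2,3,5,7,10)] by simp
  also have "\<dots> = chi"
  proof -
    have "lam / a * (chi * (a / lam)) = chi" if "a > 0" for a using that assms(1) by simp
    moreover have "\<tau> * lam + 1 > 0" using assms(1,2) by (simp add: add_pos_pos)
    ultimately show ?thesis by blast
  qed
  finally show "chi = (\<integral>(\<theta>, i). unit_rep \<theta> \<bullet> (A i *v unit_rep \<theta>) \<partial>\<nu>)" ..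
qed

end
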